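(* Let $K$ be a field, let $E$ be a graph, and let $I$ be a two-sided ideal of $L_K(E)$. The quotient $L_K(E)/I$ is purely infinite simple if and only if there exists a hereditary and saturated subset $H$ of $E^0$ such that $I=I(H,B_H)$, and also (1) the quotient graph $E\setminus H$ contains no nontrivial saturated hereditary subsets (i.e. the only ones are $\emptyset$ and $(E\setminus H)^0$), (2) $E\setminus H$ contains at least one closed path, and (3) $E\setminus H$ satisfies Condition (L).
   Context: A graph $E=(E^0,E^1,r,s)$ consists of a countable set of vertices $E^0$, a countable set of edges $E^1$, and range and source maps $r,s:E^1\to E^0$. A vertex $v$ is a finite emitter if $0<|s^{-1}(v)|<\infty$. A path of length $n\ge 1$ is $\alpha=e_1\ldots e_n$ with $e_i\in E^1$ and $r(e_i)=s(e_{i+1})$ for $1\le i<n$; $s(\alpha)=s(e_1)$, $r(\alpha)=r(e_n)$. A closed path is a path $\alpha$ of positive length with $s(\alpha)=r(\alpha)$; it is a simple closed path if in addition $s(e_i)\neq s(e_j)$ for $i\ne j$. A closed path $\alpha=e_1\ldots e_n$ has an exit if for some $i$ there is an edge $f\in s^{-1}(s(e_i))\setminus\{e_i\}$. Condition (L): every simple closed path has an exit. A subset $X\subseteq E^0$ is hereditary if $e\in E^1$, $s(e)\in X$ imply $r(e)\in X$; it is saturated if every finite emitter $v$ with $r(s^{-1}(v))\subseteq X$ lies in $X$. For a hereditary and saturated subset $H$, $E\setminus H$ denotes the graph $(E^0\setminus H,\ r^{-1}(E^0\setminus H),\ r,\ s)$, and $$B_H:=\{v\in E^0\setminus H:\ |s^{-1}(v)|=\infty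 \text{ and } 0<|s^{-1}(v)\cap r^{-1}(E^0\setminus H)|<\infty\}.$$ A Leavitt $E$-family in a ring is a set $\{v,e,e^*:v\in E^0,e\in E^1\}$ such that the $v$'s are pairwise orthogonal idempotents and: $s(e)e=er(e)=e$ and $r(e)e^*=e^*s(e)=e^*$ for all $e\in E^1$; $e^*f=\delta_{e,f}r(e)$ for all $e,f\in E^1$; $v=\sum_{s(e)=v}ee^*$ whenever $0<|s^{-1}(v)|<\infty$. The Leavitt path algebra $L_K(E)$ is the universal $K$-algebra generated by a Leavitt $E$-family. For $v\in B_H$ put $v^H:=v-\sum_{s(e)=v,\ r(e)\notin H}ee^*\in L_K(E)$. $I(H,B_H)$ is the two-sided ideal of $L_K(E)$ generated by $\{v:v\in H\}\cup\{v^H:v\in B_H\}$. An idempotent $a$ in a ring $R$ is infinite if $aR$ is isomorphic as a right $R$-module to a proper direct summand of itself. $R$ is purely infinite if every nonzero right ideal of $R$ contains an infinite idempotent. Purely infinite simple means purely infinite and simple. *)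

theory Defs
  imports
    "HOL-Algebra.QuotRing"
    "HOL-Algebra.Module"
    "HOL-Library.Poly_Mapping"
    "HOL-Library.Countable_Set"
    "Graph_Theory.Arc_Walk"
begin

section \<open>Rings without identity\<close>

text \<open>
  Leavitt path algebras have no identity when the graph has infinitely many vertices, so the
  locales \<^locale>\<open>ring\<close> and \<^locale>\<open>ideal\<close> of HOL-Algebra do not apply. We keep its records and
  its quotient construction \<^const>\<open>FactRing\<close>, which make sense without an identity; the field
  \<^const>\<open>one\<close> of these records is never used.
\<close>

locale rng = abelian_group R for R (structure) +
  assumes m_closed: "\<lbrakk>x \<in> carrier R; y \<in> carrier R\<rbrakk> \<Longrightarrow> x \<otimes> y \<in> carrier R"
    and m_assoc: "\<lbrakk>x \<in> carrier R; y \<in> carrier R; z \<in> carrier R\<rbrakk> \<Longrightarrow> (x \<otimes> y) \<otimes> z = x \<otimes> (y \<otimes> z)"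
    and l_distr: "\<lbrakk>x \<in> carrier R; y \<in> carrier R; z \<in> carrier R\<rbrakk> \<Longrightarrow> (x \<oplus> y) \<otimes> z = x \<otimes> z \<oplus> y \<otimes> z"
    and r_distr: "\<lbrakk>x \<in> carrier R; y \<in> carrier R; z \<in> carrier R\<rbrakk> \<Longrightarrow> z \<otimes> (x \<oplus> y) = z \<otimes> x \<oplus> z \<otimes> y"

definition right_ideal :: "'a set \<Rightarrow> ('a, 'm) ring_scheme \<Rightarrow> bool" where
  "right_ideal I R \<longleftrightarrow> additive_subgroup I R \<and> (\<forall>a\<in>I. \<forall>x\<in>carrier R. a \<otimes>\<^bsub>R\<^esub> x \<in> I)"

definition two_sided_ideal :: "'a set \<Rightarrow> ('a, 'm) ring_scheme \<Rightarrow> bool" where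
  "two_sided_ideal I R \<longleftrightarrow> additive_subgroup I R \<and>
     (\<forall>a\<in>I. \<forall>x\<in>carrier R. a \<otimes>\<^bsub>R\<^esub> x \<in> I \<and> x \<otimes>\<^bsub>R\<^esub> a \<in> I)"

definition ideal_generated :: "('a, 'm) ring_scheme \<Rightarrow> 'a set \<Rightarrow> 'a set" where
  "ideal_generated R S = \<Inter>{I. two_sided_ideal I R \<and> S \<subseteq> I}"

definition simple_rng :: "('a, 'm) ring_scheme \<Rightarrow> bool" where
  "simple_rng R \<longleftrightarrow>
     (\<exists>x\<in>carrier R. \<exists>y\<in>carrier R. x \<otimes>\<^bsub>R\<^esub> y \<noteq> \<zero>\<^bsub>R\<^esub>) \<and>
     (\<forall>I. two_sided_ideal I R \<longrightarrow> I = {\<zero>\<^bsub>R\<^esub>} \<or> I = carrier R)"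

definition idempotent :: "('a, 'm) ring_scheme \<Rightarrow> 'a \<Rightarrow> bool" where
  "idempotent R a \<longleftrightarrow> a \<in> carrier R \<and> a \<otimes>\<^bsub>R\<^esub> a = a"

definition right_module_iso :: "('a, 'm) ring_scheme \<Rightarrow> 'a set \<Rightarrow> 'a set \<Rightarrow> ('a \<Rightarrow> 'a) \<Rightarrow> bool" where
  "right_module_iso R M N f \<longleftrightarrow> bij_betw f M N \<and>
     (\<forall>x\<in>M. \<forall>y\<in>M. f (x \<oplus>\<^bsub>R\<^esub> y) = f x \<oplus>\<^bsub>R\<^esub> f y) \<and>
     (\<forall>x\<in>M. \<forall>r\<in>carrier R. f (x \<otimes>\<^bsub>R\<^esub> r) = f x \<otimes>\<^bsub>R\<^esub> r)"

text \<open>The submodules of the right module \<open>M \<subseteq> R\<close> are the right ideals of \<open>R\<close> contained in \<open>M\<close>.\<close>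

definition proper_direct_summand :: "('a, 'm) ring_scheme \<Rightarrow> 'a set \<Rightarrow> 'a set \<Rightarrow> bool" where
  "proper_direct_summand R N M \<longleftrightarrow> right_ideal N R \<and> N \<noteq> M \<and>
     (\<exists>N'. right_ideal N' R \<and> N <+>\<^bsub>R\<^esub> N' = M \<and> N \<inter> N' = {\<zero>\<^bsub>R\<^esub>})"

definition infinite_idempotent :: "('a, 'm) ring_scheme \<Rightarrow> 'a \<Rightarrow> bool" where
  "infinite_idempotent R a \<longleftrightarrow> idempotent R a \<and>
     (\<exists>N f. proper_direct_summand R N (a <#\<^bsub>R\<^esub> carrier R) \<and>
            right_module_iso R (a <#\<^bsub>R\<^esub> carrier R) N f)"

definition purely_infinite :: "('a, 'm) ring_scheme \<Rightarrow> bool" where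
  "purely_infinite R \<longleftrightarrow>
     (\<forall>J. right_ideal J R \<and> J \<noteq> {\<zero>\<^bsub>R\<^esub>} \<longrightarrow> (\<exists>a\<in>J. infinite_idempotent R a))"

definition purely_infinite_simple :: "('a, 'm) ring_scheme \<Rightarrow> bool" where
  "purely_infinite_simple R \<longleftrightarrow> purely_infinite R \<and> simple_rng R"


section \<open>Algebras without identity over a field\<close>

locale nonunital_algebra = rng A for A :: "('k::field, 'a, 'm) module_scheme" (structure) +
  assumes smult_closed: "x \<in> carrier A \<Longrightarrow> c \<odot> x \<in> carrier A"
    and smult_l_distr: "x \<in> carrier A \<Longrightarrow> (c + d) \<odot> x = c \<odot> x \<oplus> d \<odot> x"
    and smult_r_distr: "\<lbrakk>x \<in> carrier A; y \<in> carrier A\<rbrakk> \<Longrightarrow> c \<odot> (x \<oplus> y) = c \<odot> x \<oplus> c \<odot> y"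
    and smult_assoc: "x \<in> carrier A \<Longrightarrow> (c * d) \<odot> x = c \<odot> (d \<odot> x)"
    and smult_one: "x \<in> carrier A \<Longrightarrow> 1 \<odot> x = x"
    and smult_mult_l: "\<lbrakk>x \<in> carrier A; y \<in> carrier A\<rbrakk> \<Longrightarrow> (c \<odot> x) \<otimes> y = c \<odot> (x \<otimes> y)"
    and smult_mult_r: "\<lbrakk>x \<in> carrier A; y \<in> carrier A\<rbrakk> \<Longrightarrow> x \<otimes> (c \<odot> y) = c \<odot> (x \<otimes> y)"

definition algebra_ideal :: "'a set \<Rightarrow> ('k, 'a, 'm) module_scheme \<Rightarrow> bool" where
  "algebra_ideal I A \<longleftrightarrow> two_sided_ideal I A \<and> (\<forall>c. \<forall>a\<in>I. c \<odot>\<^bsub>A\<^esub> a \<in> I)"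

definition algebra_ideal_generated :: "('k, 'a, 'm) module_scheme \<Rightarrow> 'a set \<Rightarrow> 'a set" where
  "algebra_ideal_generated A S = \<Inter>{I. algebra_ideal I A \<and> S \<subseteq> I}"

text \<open>The ring \<open>A Quot I\<close> together with the scalar multiplication induced on cosets.\<close>

definition quotient_algebra ::
  "('k, 'a, 'm) module_scheme \<Rightarrow> 'a set \<Rightarrow> ('k, 'a set) module" where
  "quotient_algebra A I =
     ring.extend (A Quot I) (module.fields (\<lambda>c X. \<Union>x\<in>X. I +>\<^bsub>A\<^esub> (c \<odot>\<^bsub>A\<^esub> x)))"

definition algebra_hom ::
  "('k, 'a, 'm) module_scheme \<Rightarrow> ('k, 'b, 'n) module_scheme \<Rightarrow> ('a \<Rightarrow> 'b) \<Rightarrow> bool" where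
  "algebra_hom A B h \<longleftrightarrow> h \<in> carrier A \<rightarrow> carrier B \<and>
     (\<forall>x\<in>carrier A. \<forall>y\<in>carrier A. h (x \<oplus>\<^bsub>A\<^esub> y) = h x \<oplus>\<^bsub>B\<^esub> h y) \<and>
     (\<forall>x\<in>carrier A. \<forall>y\<in>carrier A. h (x \<otimes>\<^bsub>A\<^esub> y) = h x \<otimes>\<^bsub>B\<^esub> h y) \<and>
     (\<forall>c. \<forall>x\<in>carrier A. h (c \<odot>\<^bsub>A\<^esub> x) = c \<odot>\<^bsub>B\<^esub> h x)"

text \<open>
  The wrapper makes words a (noncommutative, additively written) monoid, so that
  \<open>'g free_monoid \<Rightarrow>\<^sub>0 'k\<close> with its library multiplication is the free unital algebra on \<open>'g\<close>.
\<close>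

datatype 'g free_monoid = Word (letters: "'g list")

instantiation free_monoid :: (type) monoid_add
begin

definition zero_free_monoid :: "'a free_monoid" where
  "0 = Word []"

definition plus_free_monoid :: "'a free_monoid \<Rightarrow> 'a free_monoid \<Rightarrow> 'a free_monoid" where
  "u + v = Word (letters u @ letters v)"

instance
  by standard (auto simp: zero_free_monoid_def plus_free_monoid_def)

end

text \<open>The free algebra without identity on a set \<open>X\<close> of generators: only nonempty words occur.\<close>

definition free_algebra :: "'g set \<Rightarrow> ('k::field, 'g free_monoid \<Rightarrow>\<^sub>0 'k) module" where
  "free_algebra X =
     \<lparr>carrier = {p. \<forall>w\<in>Poly_Mapping.keys p. letters w \<noteq> [] \<and> set (letters w) \<subseteq> X},
      mult = (*), one = undefined, zero = 0, add = (+),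
      smult = (\<lambda>c. Poly_Mapping.map ((*) c))\<rparr>"

definition generator :: "'g \<Rightarrow> 'g free_monoid \<Rightarrow>\<^sub>0 'k::field" where
  "generator g = Poly_Mapping.single (Word [g]) 1"


section \<open>Graphs\<close>

text \<open>
  A graph is a \<^locale>\<open>wf_digraph\<close>; source and range of an edge are its \<^const>\<open>tail\<close> and
  \<^const>\<open>head\<close>, so that \<open>s\<^sup>-\<^sup>1(v)\<close> is \<open>out_arcs E v\<close>. Paths are the walks
  \<^const>\<open>pre_digraph.awalk\<close>, given by their lists of edges.
\<close>

definition finite_emitter :: "('v, 'e) pre_digraph \<Rightarrow> 'v \<Rightarrow> bool" where
  "finite_emitter E v \<longleftrightarrow> v \<in> verts E \<and> out_arcs E v \<noteq> {} \<and> finite (out_arcs E v)"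

definition hereditary :: "('v, 'e) pre_digraph \<Rightarrow> 'v set \<Rightarrow> bool" where
  "hereditary E X \<longleftrightarrow> X \<subseteq> verts E \<and> (\<forall>e\<in>arcs E. tail E e \<in> X \<longrightarrow> head E e \<in> X)"

definition saturated :: "('v, 'e) pre_digraph \<Rightarrow> 'v set \<Rightarrow> bool" where
  "saturated E X \<longleftrightarrow> X \<subseteq> verts E \<and>
     (\<forall>v. finite_emitter E v \<and> head E ` out_arcs E v \<subseteq> X \<longrightarrow> v \<in> X)"

definition closed_path :: "('v, 'e) pre_digraph \<Rightarrow> 'e list \<Rightarrow> bool" where
  "closed_path E p \<longleftrightarrow> p \<noteq> [] \<and> (\<exists>u. pre_digraph.awalk E u p u)"

definition simple_closed_path :: "('v, 'e) pre_digraph \<Rightarrow> 'e list \<Rightarrow> bool" where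
  "simple_closed_path E p \<longleftrightarrow> closed_path E p \<and> distinct (map (tail E) p)"

definition has_exit :: "('v, 'e) pre_digraph \<Rightarrow> 'e list \<Rightarrow> bool" where
  "has_exit E p \<longleftrightarrow> (\<exists>e\<in>set p. \<exists>f. f \<in> out_arcs E (tail E e) - {e})"

definition condition_L :: "('v, 'e) pre_digraph \<Rightarrow> bool" where
  "condition_L E \<longleftrightarrow> (\<forall>p. simple_closed_path E p \<longrightarrow> has_exit E p)"

definition quotient_graph :: "('v, 'e) pre_digraph \<Rightarrow> 'v set \<Rightarrow> ('v, 'e) pre_digraph" where
  "quotient_graph E H =
     \<lparr>verts = verts E - H, arcs = {e \<in> arcs E. head E e \<in> verts E - H},
      tail = tail E, head = head E\<rparr>"

definition breaking_vertices :: "('v, 'e) pre_digraph \<Rightarrow> 'v set \<Rightarrow> 'v set" where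
  "breaking_vertices E H =
     {v \<in> verts E - H. infinite (out_arcs E v) \<and>
        {e \<in> out_arcs E v. head E e \<in> verts E - H} \<noteq> {} \<and>
        finite {e \<in> out_arcs E v. head E e \<in> verts E - H}}"


section \<open>Leavitt path algebras\<close>

text \<open>The family \<open>{v, e, e\<^sup>*}\<close> is given by three functions \<open>P\<close>, \<open>S\<close>, \<open>T\<close>, in this order.\<close>

definition leavitt_family ::
  "('v, 'e) pre_digraph \<Rightarrow> ('a, 'm) ring_scheme \<Rightarrow> ('v \<Rightarrow> 'a) \<Rightarrow> ('e \<Rightarrow> 'a) \<Rightarrow> ('e \<Rightarrow> 'a) \<Rightarrow> bool"
where
  "leavitt_family E R P S T \<longleftrightarrow>
     P \<in> verts E \<rightarrow> carrier R \<and> S \<in> arcs E \<rightarrow> carrier R \<and> T \<in> arcs E \<rightarrow> carrier R \<and>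
     (\<forall>v\<in>verts E. \<forall>w\<in>verts E. P v \<otimes>\<^bsub>R\<^esub> P w = (if v = w then P v else \<zero>\<^bsub>R\<^esub>)) \<and>
     (\<forall>e\<in>arcs E. P (tail E e) \<otimes>\<^bsub>R\<^esub> S e = S e \<and> S e \<otimes>\<^bsub>R\<^esub> P (head E e) = S e) \<and>
     (\<forall>e\<in>arcs E. P (head E e) \<otimes>\<^bsub>R\<^esub> T e = T e \<and> T e \<otimes>\<^bsub>R\<^esub> P (tail E e) = T e) \<and>
     (\<forall>e\<in>arcs E. \<forall>f\<in>arcs E. T e \<otimes>\<^bsub>R\<^esub> S f = (if e = f then P (head E e) else \<zero>\<^bsub>R\<^esub>)) \<and>
     (\<forall>v. finite_emitter E v \<longrightarrow> P v = (\<Oplus>\<^bsub>R\<^esub>e\<in>out_arcs E v. S e \<otimes>\<^bsub>R\<^esub> T e))"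

datatype ('v, 'e) lpa_gen = Vertex 'v | Edge 'e | Ghost 'e

definition lpa_gens :: "('v, 'e) pre_digraph \<Rightarrow> ('v, 'e) lpa_gen set" where
  "lpa_gens E = Vertex ` verts E \<union> Edge ` arcs E \<union> Ghost ` arcs E"

type_synonym ('k, 'v, 'e) lpa_free = "('v, 'e) lpa_gen free_monoid \<Rightarrow>\<^sub>0 'k"

definition leavitt_relators :: "('v, 'e) pre_digraph \<Rightarrow> ('k::field, 'v, 'e) lpa_free set" where
  "leavitt_relators E =
     (let V = (\<lambda>v. generator (Vertex v)); X = (\<lambda>e. generator (Edge e));
          Y = (\<lambda>e. generator (Ghost e)) in
      {V v * V w - (if v = w then V v else 0) | v w. v \<in> verts E \<and> w \<in> verts E} \<union>
      {V (tail E e) * X e - X e | e. e \<in> arcs E} \<union>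
      {X e * V (head E e) - X e | e. e \<in> arcs E} \<union>
      {V (head E e) * Y e - Y e | e. e \<in> arcs E} \<union>
      {Y e * V (tail E e) - Y e | e. e \<in> arcs E} \<union>
      {Y e * X f - (if e = f then V (head E e) else 0) | e f. e \<in> arcs E \<and> f \<in> arcs E} \<union>
      {V v - (\<Sum>e\<in>out_arcs E v. X e * Y e) | v. finite_emitter E v})"

definition leavitt_relation_ideal ::
  "('v, 'e) pre_digraph \<Rightarrow> ('k::field, 'v, 'e) lpa_free set" where
  "leavitt_relation_ideal E =
     algebra_ideal_generated (free_algebra (lpa_gens E)) (leavitt_relators E)"

definition leavitt_path_algebra ::
  "('v, 'e) pre_digraph \<Rightarrow> ('k::field, ('k, 'v, 'e) lpa_free set) module" where
  "leavitt_path_algebra E =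
     quotient_algebra (free_algebra (lpa_gens E)) (leavitt_relation_ideal E)"

definition lpa_class ::
  "('v, 'e) pre_digraph \<Rightarrow> ('v, 'e) lpa_gen \<Rightarrow> ('k::field, 'v, 'e) lpa_free set" where
  "lpa_class E g = leavitt_relation_ideal E +>\<^bsub>free_algebra (lpa_gens E)\<^esub> generator g"

definition lpa_vertex :: "('v, 'e) pre_digraph \<Rightarrow> 'v \<Rightarrow> ('k::field, 'v, 'e) lpa_free set" where
  "lpa_vertex E v = lpa_class E (Vertex v)"

definition lpa_edge :: "('v, 'e) pre_digraph \<Rightarrow> 'e \<Rightarrow> ('k::field, 'v, 'e) lpa_free set" where
  "lpa_edge E e = lpa_class E (Edge e)"

definition lpa_ghost :: "('v, 'e) pre_digraph \<Rightarrow> 'e \<Rightarrow> ('k::field, 'v, 'e) lpa_free set" where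
  "lpa_ghost E e = lpa_class E (Ghost e)"

text \<open>The element \<open>v\<^sup>H\<close>; for a breaking vertex \<open>v\<close> the sum is finite.\<close>

definition breaking_element ::
  "('v, 'e) pre_digraph \<Rightarrow> 'v set \<Rightarrow> 'v \<Rightarrow> ('k::field, 'v, 'e) lpa_free set" where
  "breaking_element E H v =
     lpa_vertex E v \<ominus>\<^bsub>leavitt_path_algebra E\<^esub>
       (\<Oplus>\<^bsub>leavitt_path_algebra E\<^esub>e\<in>{e \<in> out_arcs E v. head E e \<notin> H}.
          lpa_edge E e \<otimes>\<^bsub>leavitt_path_algebra E\<^esub> lpa_ghost E e)"

definition breaking_ideal ::
  "('v, 'e) pre_digraph \<Rightarrow> 'v set \<Rightarrow> ('k::field, 'v, 'e) lpa_free set set" where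
  "breaking_ideal E H =
     ideal_generated (leavitt_path_algebra E)
       (lpa_vertex E ` H \<union> breaking_element E H ` breaking_vertices E H)"


section \<open>The construction is the universal algebra generated by a Leavitt family\<close>

text \<open>
  \<open>lpa_algebra\<close>, \<open>lpa_family\<close> and \<open>lpa_universal\<close> below establish that
  \<^const>\<open>leavitt_path_algebra\<close> has the universal property by which it is characterised.
\<close>

lemma poly_mapping_single_induct [case_names zero add]:
  fixes p :: "'g \<Rightarrow>\<^sub>0 'k::monoid_add"
  assumes "P 0" and "\<And>w c q. w \<notin> Poly_Mapping.keys q \<Longrightarrow> c \<noteq> 0 \<Longrightarrow> P q \<Longrightarrow> P (Poly_Mapping.single w c + q)"
  shows "P p"
proof (induction p rule: Poly_Mapping.update_induct)
  case const
  then show ?case by (rule assms)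
next
  case (update f a b)
  have "Poly_Mapping.update a b f = Poly_Mapping.single a b + f"
    using update(1) by (intro poly_mapping_eqI)
      (auto simp: Poly_Mapping.lookup_update lookup_add lookup_single when_def in_keys_iff)
  then show ?case using assms(2) update by metis
qed

lemma map_scale: "Poly_Mapping.map ((*) c) p = Poly_Mapping.single 0 c * p"
  for p :: "'g::monoid_add \<Rightarrow>\<^sub>0 'k::field"
proof -
  have l: "Poly_Mapping.lookup (Poly_Mapping.map ((*) c) p) w = c * Poly_Mapping.lookup p w" for w and p :: "'g \<Rightarrow>\<^sub>0 'k"
    by (simp add: Poly_Mapping.map.rep_eq when_def)
  show ?thesis
  proof (induction p rule: poly_mapping_single_induct)
    case zero
    then show ?case by (intro poly_mapping_eqI) (simp add: l)
  next
    case (add w d q)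
    have "Poly_Mapping.map ((*) c) (Poly_Mapping.single w d + q) = Poly_Mapping.single w (c * d) + Poly_Mapping.map ((*) c) q"
      by (intro poly_mapping_eqI) (simp add: l lookup_add lookup_single when_def distrib_left)
    then show ?case by (simp add: add distrib_left mult_single)
  qed
qed

lemma single_0_mult: "Poly_Mapping.single 0 (c * d) = (Poly_Mapping.single 0 c * Poly_Mapping.single 0 d :: 'g::monoid_add \<Rightarrow>\<^sub>0 'k::field)"
  by (simp add: mult_single)

lemma scale_commute: "p * Poly_Mapping.single 0 c = Poly_Mapping.single 0 c * p"
  for p :: "'g::monoid_add \<Rightarrow>\<^sub>0 'k::field"
  by (induction p rule: poly_mapping_single_induct)
    (simp_all add: distrib_left distrib_right mult_single mult.commute)

lemma scale_mult_right: "p * (Poly_Mapping.single 0 c * q) = Poly_Mapping.single 0 c * (p * q)"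
  for p :: "'g::monoid_add \<Rightarrow>\<^sub>0 'k::field"
  by (metis mult.assoc scale_commute)

lemma free_algebra_carrier_iff:
  "p \<in> carrier (free_algebra X) \<longleftrightarrow> (\<forall>w\<in>Poly_Mapping.keys p. letters w \<noteq> [] \<and> set (letters w) \<subseteq> X)"
  by (simp add: free_algebra_def)

lemma free_algebra_carrier_add:
  "p \<in> carrier (free_algebra X) \<Longrightarrow> q \<in> carrier (free_algebra X) \<Longrightarrow> p + q \<in> carrier (free_algebra X)"
  unfolding free_algebra_carrier_iff using Poly_Mapping.keys_add[of p q] by blast

lemma letters_plus: "letters (u + v) = letters u @ letters v"
  by (simp add: plus_free_monoid_def)

lemma free_algebra_carrier_mult:
  assumes "p \<in> carrier (free_algebra X)" "q \<in> carrier (free_algebra X)"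
  shows "p * q \<in> carrier (free_algebra X)"
  unfolding free_algebra_carrier_iff
proof
  fix w assume "w \<in> Poly_Mapping.keys (p * q)"
  then obtain u v where "w = u + v" "u \<in> Poly_Mapping.keys p" "v \<in> Poly_Mapping.keys q"
    using Poly_Mapping.keys_mult[of p q] by blast
  then show "letters w \<noteq> [] \<and> set (letters w) \<subseteq> X"
    using assms unfolding free_algebra_carrier_iff by (auto simp: letters_plus)
qed

lemma free_algebra_carrier_uminus:
  "p \<in> carrier (free_algebra X) \<Longrightarrow> - p \<in> carrier (free_algebra X)"
  unfolding free_algebra_def by (simp add: in_keys_iff)

lemma free_algebra_carrier_diff:
  "p \<in> carrier (free_algebra X) \<Longrightarrow> q \<in> carrier (free_algebra X) \<Longrightarrow> p - q \<in> carrier (free_algebra X)"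
  using free_algebra_carrier_add[of p X "- q"] free_algebra_carrier_uminus[of q] by simp

lemma free_algebra_carrier_scale:
  assumes "p \<in> carrier (free_algebra X)"
  shows "Poly_Mapping.single 0 c * p \<in> carrier (free_algebra X)"
  unfolding free_algebra_carrier_iff
proof
  fix w assume "w \<in> Poly_Mapping.keys (Poly_Mapping.single 0 c * p)"
  then obtain u where "w = 0 + u" "u \<in> Poly_Mapping.keys p"
    using Poly_Mapping.keys_mult[of "Poly_Mapping.single 0 c" p] by (auto split: if_splits)
  then show "letters w \<noteq> [] \<and> set (letters w) \<subseteq> X"
    using assms unfolding free_algebra_carrier_iff by auto
qed

lemma free_algebra_carrier_0: "0 \<in> carrier (free_algebra X)"
  by (simp add: free_algebra_def)

lemma free_algebra_carrier_sum:
  "(\<And>i. i \<in> S \<Longrightarrow> f i \<in> carrier (free_algebra X)) \<Longrightarrow> sum f S \<in> carrier (free_algebra X)"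
  by (induction S rule: infinite_finite_induct)
    (auto simp: free_algebra_carrier_0 free_algebra_carrier_add)

lemma free_algebra_simps:
  "x \<otimes>\<^bsub>free_algebra X\<^esub> y = x * y" "x \<oplus>\<^bsub>free_algebra X\<^esub> y = x + y" "\<zero>\<^bsub>free_algebra X\<^esub> = 0"
  "c \<odot>\<^bsub>free_algebra X\<^esub> x = Poly_Mapping.single 0 c * x"
  by (simp_all add: free_algebra_def map_scale)

lemma generator_carrier: "g \<in> X \<Longrightarrow> generator g \<in> carrier (free_algebra X)"
  by (auto simp: generator_def free_algebra_def)

lemma free_algebra_nonunital_algebra: "nonunital_algebra (free_algebra X)"
proof -
  have "abelian_group (free_algebra X)"
    by (rule abelian_groupI)
      (auto simp: free_algebra_simps free_algebra_carrier_add free_algebra_carrier_0 add_ac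
        intro!: bexI[of _ "- _"] free_algebra_carrier_uminus)
  then have "rng (free_algebra X)"
    by (intro rng.intro rng_axioms.intro)
      (simp_all add: free_algebra_simps free_algebra_carrier_mult mult.assoc distrib_left distrib_right)
  then show ?thesis
    by (intro nonunital_algebra.intro nonunital_algebra_axioms.intro,
        simp_all add: free_algebra_simps free_algebra_carrier_scale single_add distrib_left distrib_right
          scale_mult_right[symmetric] mult.assoc[symmetric] single_0_mult)
      (subst scale_commute, rule refl)
qed

lemma (in rng) zero_mult:
  assumes "x \<in> carrier R" shows "\<zero> \<otimes> x = \<zero>" "x \<otimes> \<zero> = \<zero>"
proof -
  have "\<zero> \<otimes> x \<oplus> \<zero> \<otimes> x = \<zero> \<otimes> x"
    using l_distr[of \<zero> \<zero> x] assms by simp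
  then show "\<zero> \<otimes> x = \<zero>" using assms m_closed[of \<zero> x] add.l_cancel_one by auto
  have "x \<otimes> \<zero> \<oplus> x \<otimes> \<zero> = x \<otimes> \<zero>"
    using r_distr[of \<zero> \<zero> x] assms by simp
  then show "x \<otimes> \<zero> = \<zero>" using assms m_closed[of x \<zero>] add.l_cancel_one by auto
qed

locale alg_quot = nonunital_algebra A for A :: "('k::field, 'a, 'm) module_scheme" (structure) +
  fixes I assumes I: "algebra_ideal I A"
begin

lemma add_sub: "additive_subgroup I A" and
  Im: "a \<in> I \<Longrightarrow> x \<in> carrier A \<Longrightarrow> a \<otimes> x \<in> I" "a \<in> I \<Longrightarrow> x \<in> carrier A \<Longrightarrow> x \<otimes> a \<in> I" and
  Is: "a \<in> I \<Longrightarrow> c \<odot> a \<in> I"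
  using I by (auto simp: algebra_ideal_def two_sided_ideal_def)

sublocale abelian_subgroup I A
  by (intro abelian_subgroupI3 add_sub) unfold_locales

lemma mem_coset: "x \<in> carrier A \<Longrightarrow> z \<in> I +> x \<longleftrightarrow> (\<exists>i\<in>I. z = i \<oplus> x)"
  by (auto simp: a_r_coset_def r_coset_def)

lemma coset_eqI: "x \<in> carrier A \<Longrightarrow> i \<in> I \<Longrightarrow> I +> (i \<oplus> x) = I +> x"
  using a_repr_independence[of "i \<oplus> x" I x] mem_coset a_subgroup by auto

lemma mult_coset:
  assumes "x \<in> carrier A" "y \<in> carrier A"
  shows "rcoset_mult A I (I +> x) (I +> y) = I +> (x \<otimes> y)"
proof -
  have "I +> (a \<otimes> b) = I +> (x \<otimes> y)" if ab: "a \<in> I +> x" "b \<in> I +> y" for a b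
  proof -
    obtain i j where ij: "i \<in> I" "j \<in> I" "a = i \<oplus> x" "b = j \<oplus> y"
      using ab assms mem_coset[of x a] mem_coset[of y b] by auto
    note c = ij(1,2)[THEN a_Hcarr] assms
    have "a \<otimes> b = ((i \<otimes> j \<oplus> i \<otimes> y) \<oplus> x \<otimes> j) \<oplus> x \<otimes> y"
      using c by (simp add: ij l_distr r_distr m_closed a_ac)
    moreover have "(i \<otimes> j \<oplus> i \<otimes> y) \<oplus> x \<otimes> j \<in> I"
      using c ij Im by auto
    ultimately show ?thesis using coset_eqI c m_closed by metis
  qed
  moreover have "x \<in> I +> x" "y \<in> I +> y" using assms a_rcos_self by auto
  ultimately show ?thesis unfolding rcoset_mult_def by blast
qed

lemma smult_coset:
  assumes "x \<in> carrier A"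
  shows "(\<Union>a\<in>I +> x. I +> (c \<odot> a)) = I +> (c \<odot> x)"
proof -
  have "I +> (c \<odot> a) = I +> (c \<odot> x)" if ax: "a \<in> I +> x" for a
  proof -
    obtain i where i: "i \<in> I" "a = i \<oplus> x" using ax assms mem_coset[of x a] by auto
    then show ?thesis using coset_eqI[of "c \<odot> x" "c \<odot> i"] assms Is i
      by (simp add: smult_r_distr smult_closed)
  qed
  moreover have "x \<in> I +> x" using assms a_rcos_self by auto
  ultimately show ?thesis by blast
qed

lemma quot_simps:
  "carrier (quotient_algebra A I) = (\<lambda>x. I +> x) ` carrier A"
  "\<zero>\<^bsub>quotient_algebra A I\<^esub> = I"
  "x \<in> carrier A \<Longrightarrow> y \<in> carrier A \<Longrightarrow> (I +> x) \<oplus>\<^bsub>quotient_algebra A I\<^esub> (I +> y) = I +> (x \<oplus> y)"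
  "x \<in> carrier A \<Longrightarrow> y \<in> carrier A \<Longrightarrow> (I +> x) \<otimes>\<^bsub>quotient_algebra A I\<^esub> (I +> y) = I +> (x \<otimes> y)"
  "x \<in> carrier A \<Longrightarrow> c \<odot>\<^bsub>quotient_algebra A I\<^esub> (I +> x) = I +> (c \<odot> x)"
  by (auto simp: quotient_algebra_def ring.defs module.defs FactRing_simps a_rcos_sum mult_coset smult_coset)

lemma coset_0: "I +> \<zero> = I"
  using a_coset_add_zero a_subset by simp

lemma quot_algebra: "nonunital_algebra (quotient_algebra A I)"
proof -
  have "abelian_group (quotient_algebra A I)"
  proof (rule abelian_groupI)
    fix X assume "X \<in> carrier (quotient_algebra A I)"
    then obtain x where x: "x \<in> carrier A" "X = I +> x" by (auto simp: quot_simps)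
    show "\<exists>Y\<in>carrier (quotient_algebra A I). Y \<oplus>\<^bsub>quotient_algebra A I\<^esub> X = \<zero>\<^bsub>quotient_algebra A I\<^esub>"
      by (rule bexI[of _ "I +> (\<ominus> x)"]) (use x in \<open>auto simp: quot_simps coset_0 l_neg\<close>)
    show "\<zero>\<^bsub>quotient_algebra A I\<^esub> \<oplus>\<^bsub>quotient_algebra A I\<^esub> X = X"
      using quot_simps(3)[of \<zero> x] x by (simp add: quot_simps(2) coset_0)
  next
    show "\<zero>\<^bsub>quotient_algebra A I\<^esub> \<in> carrier (quotient_algebra A I)"
      using coset_0 by (auto simp: quot_simps intro!: image_eqI[of _ _ \<zero>])
  qed (auto simp: quot_simps a_ac)
  then have "rng (quotient_algebra A I)"
    by (intro rng.intro rng_axioms.intro)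
      (auto simp: quot_simps m_closed m_assoc l_distr r_distr)
  then show ?thesis
    by (intro nonunital_algebra.intro nonunital_algebra_axioms.intro)
      (auto simp: quot_simps m_closed smult_closed smult_l_distr smult_r_distr smult_assoc smult_one smult_mult_l smult_mult_r)
qed

end


lemma algebra_ideal_generated_ideal:
  assumes "nonunital_algebra A" "S \<subseteq> carrier A"
  shows "algebra_ideal (algebra_ideal_generated A S) A" "S \<subseteq> algebra_ideal_generated A S"
proof -
  interpret nonunital_algebra A by fact
  have c: "algebra_ideal (carrier A) A"
    unfolding algebra_ideal_def two_sided_ideal_def
    by (auto simp: m_closed smult_closed intro: additive_subgroupI add.subgroup_self)
  let ?F = "{I. algebra_ideal I A \<and> S \<subseteq> I}"
  have "subgroup (\<Inter>?F) (add_monoid A)"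
    by (rule add.subgroups_Inter)
      (use c assms in \<open>auto simp: algebra_ideal_def two_sided_ideal_def additive_subgroup_def\<close>)
  then show "algebra_ideal (algebra_ideal_generated A S) A"
    unfolding algebra_ideal_def two_sided_ideal_def algebra_ideal_generated_def
    by (auto simp: additive_subgroup_def)
  show "S \<subseteq> algebra_ideal_generated A S"
    unfolding algebra_ideal_generated_def by auto
qed

lemma algebra_ideal_generated_least:
  "algebra_ideal I A \<Longrightarrow> S \<subseteq> I \<Longrightarrow> algebra_ideal_generated A S \<subseteq> I"
  unfolding algebra_ideal_generated_def by auto

locale free_ev = nonunital_algebra B for B :: "('k::field, 'b, 'm) module_scheme" (structure) +
  fixes X :: "'g set" and \<phi> :: "'g \<Rightarrow> 'b"
  assumes \<phi>: "\<phi> \<in> X \<rightarrow> carrier B"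
begin

fun wev :: "'g list \<Rightarrow> 'b" where
  "wev [] = \<zero>"
| "wev [g] = \<phi> g"
| "wev (g # h # gs) = \<phi> g \<otimes> wev (h # gs)"

definition ev :: "('g free_monoid \<Rightarrow>\<^sub>0 'k) \<Rightarrow> 'b" where
  "ev p = (\<Oplus>w\<in>Poly_Mapping.keys p. Poly_Mapping.lookup p w \<odot> wev (letters w))"

abbreviation "ok w \<equiv> letters w \<noteq> [] \<and> set (letters w) \<subseteq> X"

lemma wev_closed: "set w \<subseteq> X \<Longrightarrow> wev w \<in> carrier B"
  using \<phi> by (induction w rule: wev.induct) (auto intro!: m_closed)

lemma wev_append: "u \<noteq> [] \<Longrightarrow> v \<noteq> [] \<Longrightarrow> set u \<subseteq> X \<Longrightarrow> set v \<subseteq> X \<Longrightarrow> wev (u @ v) = wev u \<otimes> wev v"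
proof (induction u rule: wev.induct)
  case (2 g)
  then show ?case by (cases v) auto
next
  case (3 g h gs)
  then show ?case using funcset_mem[OF \<phi>, of g] wev_closed[of "h # gs"] wev_closed[of v] by (auto simp: m_assoc)
qed auto

lemma smult_zero: "x \<in> carrier B \<Longrightarrow> 0 \<odot> x = \<zero>"
  using smult_l_distr[of x 0 0] add.l_cancel_one[of "0 \<odot> x" "0 \<odot> x"] smult_closed by auto

lemma smult_zero_right: "c \<odot> \<zero> = \<zero>"
  using smult_r_distr[of \<zero> \<zero> c] add.l_cancel_one[of "c \<odot> \<zero>" "c \<odot> \<zero>"] smult_closed by auto

lemma ev_superset:
  assumes "finite S" "Poly_Mapping.keys p \<subseteq> S" "\<And>w. w \<in> S \<Longrightarrow> ok w"
  shows "ev p = (\<Oplus>w\<in>S. Poly_Mapping.lookup p w \<odot> wev (letters w))"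
  unfolding ev_def
  by (rule add.finprod_mono_neutral_cong_left)
    (use assms in \<open>auto simp: in_keys_iff smult_zero wev_closed intro!: smult_closed\<close>)

lemma ev_closed: "p \<in> carrier (free_algebra X) \<Longrightarrow> ev p \<in> carrier B"
  unfolding ev_def free_algebra_carrier_iff by (auto intro!: finsum_closed smult_closed wev_closed)

lemma ev_add:
  assumes "p \<in> carrier (free_algebra X)" "q \<in> carrier (free_algebra X)"
  shows "ev (p + q) = ev p \<oplus> ev q"
proof -
  let ?S = "Poly_Mapping.keys p \<union> Poly_Mapping.keys q"
  have ok: "ok w" if "w \<in> ?S" for w using that assms unfolding free_algebra_carrier_iff by auto
  have "ev (p + q) = (\<Oplus>w\<in>?S. Poly_Mapping.lookup (p + q) w \<odot> wev (letters w))"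
    by (rule ev_superset) (use ok Poly_Mapping.keys_add[of p q] in auto)
  also have "\<dots> = (\<Oplus>w\<in>?S. Poly_Mapping.lookup p w \<odot> wev (letters w) \<oplus> Poly_Mapping.lookup q w \<odot> wev (letters w))"
    by (rule finsum_cong') (use ok in \<open>auto simp: lookup_add smult_l_distr wev_closed intro!: smult_closed\<close>)
  also have "\<dots> = (\<Oplus>w\<in>?S. Poly_Mapping.lookup p w \<odot> wev (letters w)) \<oplus> (\<Oplus>w\<in>?S. Poly_Mapping.lookup q w \<odot> wev (letters w))"
    by (rule finsum_addf) (use ok in \<open>auto simp: wev_closed intro!: smult_closed\<close>)
  also have "(\<Oplus>w\<in>?S. Poly_Mapping.lookup p w \<odot> wev (letters w)) = ev p"
    by (rule ev_superset[symmetric]) (use ok in auto)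
  also have "(\<Oplus>w\<in>?S. Poly_Mapping.lookup q w \<odot> wev (letters w)) = ev q"
    by (rule ev_superset[symmetric]) (use ok in auto)
  finally show ?thesis .
qed

lemma ev_single: "ok w \<Longrightarrow> ev (Poly_Mapping.single w c) = c \<odot> wev (letters w)"
  by (subst ev_superset[of "{w}"]) (auto simp: smult_closed wev_closed)

lemma ev_zero: "ev 0 = \<zero>"
  by (simp add: ev_def)

lemma carrier_induct [consumes 1, case_names zero add]:
  assumes "p \<in> carrier (free_algebra X)" and "P 0"
    and "\<And>w c q. ok w \<Longrightarrow> q \<in> carrier (free_algebra X) \<Longrightarrow> P q \<Longrightarrow> P (Poly_Mapping.single w c + q)"
  shows "P (p :: 'g free_monoid \<Rightarrow>\<^sub>0 'k)"
  using assms(1)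
proof (induction p rule: poly_mapping_single_induct)
  case (add w c q)
  have k: "Poly_Mapping.keys (Poly_Mapping.single w c + q) = insert w (Poly_Mapping.keys q)"
    using add(1,2) by (auto simp: in_keys_iff lookup_add lookup_single when_def split: if_splits)
  then have "ok w" "q \<in> carrier (free_algebra X)" using add(4) unfolding free_algebra_carrier_iff by auto
  then show ?case using assms(3) add(3) by blast
qed (rule assms)

lemma single_carrier: "ok w \<Longrightarrow> Poly_Mapping.single w (c::'k) \<in> carrier (free_algebra X)"
  unfolding free_algebra_carrier_iff by auto

lemma ev_mult_single:
  assumes "q \<in> carrier (free_algebra X)" "ok w"
  shows "ev (Poly_Mapping.single w c * q) = ev (Poly_Mapping.single w c) \<otimes> ev q"
  using assms
proof (induction q rule: carrier_induct)
  case zero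
  then show ?case using rng.zero_mult[OF rng_axioms] by (simp add: ev_zero ev_single smult_closed wev_closed)
next
  case (add u d q)
  have okm: "ok (w + u)" using add by (auto simp: letters_plus)
  note cl = single_carrier[OF add(1)] single_carrier[OF add(4)] add(2) single_carrier[OF okm]
  have "ev (Poly_Mapping.single w c * (Poly_Mapping.single u d + q)) =
     ev (Poly_Mapping.single (w + u) (c * d)) \<oplus> ev (Poly_Mapping.single w c * q)"
    using cl by (simp add: distrib_left mult_single ev_add free_algebra_carrier_mult)
  also have "ev (Poly_Mapping.single (w + u) (c * d)) = ev (Poly_Mapping.single w c) \<otimes> ev (Poly_Mapping.single u d)"
    using add(1,4) okm
    by (simp add: ev_single letters_plus wev_append smult_mult_l smult_mult_r
      smult_assoc[symmetric] mult.commute wev_closed smult_closed m_closed)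
  finally show ?case using add cl
    by (simp add: ev_add r_distr ev_closed)
qed

lemma ev_mult:
  assumes "p \<in> carrier (free_algebra X)" "q \<in> carrier (free_algebra X)"
  shows "ev (p * q) = ev p \<otimes> ev q"
  using assms
proof (induction p rule: carrier_induct)
  case zero
  then show ?case using rng.zero_mult[OF rng_axioms] by (simp add: ev_zero ev_closed)
next
  case (add u d p)
  then show ?case
    by (simp add: distrib_right ev_add ev_mult_single single_carrier free_algebra_carrier_mult l_distr ev_closed)
qed

lemma ev_smult:
  assumes "p \<in> carrier (free_algebra X)"
  shows "ev (Poly_Mapping.single 0 c * p) = c \<odot> ev p"
  using assms
proof (induction p rule: carrier_induct)
  case zero
  then show ?case by (simp add: ev_zero smult_zero_right)
next
  case (add u d p)
  then show ?case
    by (simp add: distrib_left ev_add free_algebra_carrier_scale mult_single single_carrier ev_single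
      smult_assoc wev_closed smult_r_distr ev_closed smult_closed)
qed

lemma ev_generator: "g \<in> X \<Longrightarrow> ev (generator g) = \<phi> g"
  using funcset_mem[OF \<phi>, of g] by (auto simp: generator_def ev_single smult_one)

lemma ev_hom: "algebra_hom (free_algebra X) B ev"
  unfolding algebra_hom_def
  by (auto simp: free_algebra_simps ev_closed ev_add ev_mult ev_smult)

lemma ev_uminus: "p \<in> carrier (free_algebra X) \<Longrightarrow> ev (- p) = \<ominus> ev p"
  using ev_add[of "- p" p] ev_closed[of p] ev_closed[of "- p"] free_algebra_carrier_uminus[of p X]
    minus_equality[of "ev (- p)" "ev p"] by (simp add: ev_zero)

lemma ev_diff: "p \<in> carrier (free_algebra X) \<Longrightarrow> q \<in> carrier (free_algebra X) \<Longrightarrow> ev (p - q) = ev p \<ominus> ev q"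
  using ev_add[of p "- q"] by (simp add: a_minus_def ev_uminus free_algebra_carrier_uminus)

lemma ev_sum: "(\<And>i. i \<in> S \<Longrightarrow> f i \<in> carrier (free_algebra X)) \<Longrightarrow> finite S \<Longrightarrow> ev (sum f S) = (\<Oplus>i\<in>S. ev (f i))"
  by (induction S rule: infinite_finite_induct)
    (auto simp: ev_zero ev_add free_algebra_carrier_sum ev_closed)

definition "ker = {p \<in> carrier (free_algebra X). ev p = \<zero>}"

lemma ker_ideal: "algebra_ideal ker (free_algebra X)"
proof -
  interpret F: nonunital_algebra "free_algebra X :: ('k, 'g free_monoid \<Rightarrow>\<^sub>0 'k) module"
    by (rule free_algebra_nonunital_algebra)
  have m: "\<ominus>\<^bsub>free_algebra X\<^esub> p = - p" if "p \<in> carrier (free_algebra X)" for p :: "'g free_monoid \<Rightarrow>\<^sub>0 'k"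
    using that F.minus_equality[of "- p" p] by (simp add: free_algebra_simps free_algebra_carrier_uminus)
  have "subgroup ker (add_monoid (free_algebra X))"
    by (rule F.add.subgroupI)
      (auto simp: ker_def ev_zero ev_add free_algebra_simps free_algebra_carrier_add free_algebra_carrier_0
        a_inv_def[symmetric] m free_algebra_carrier_uminus ev_uminus intro!: exI[of _ 0])
  then show ?thesis
    unfolding algebra_ideal_def two_sided_ideal_def additive_subgroup_def
    using rng.zero_mult[OF rng_axioms]
    by (auto simp: ker_def free_algebra_simps ev_mult ev_smult smult_zero_right ev_closed
       free_algebra_carrier_mult free_algebra_carrier_scale)
qed

end

lemma diff_in_coset_eq:
  assumes "alg_quot (free_algebra X) J" "p \<in> carrier (free_algebra X)" "q \<in> carrier (free_algebra X)" "p - q \<in> J"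
  shows "J +>\<^bsub>free_algebra X\<^esub> p = J +>\<^bsub>free_algebra X\<^esub> q"
  using alg_quot.coset_eqI[OF assms(1,3,4)] by (simp add: free_algebra_simps)

lemma finsum_coset:
  assumes "alg_quot (free_algebra X) J" "\<And>i. i \<in> S \<Longrightarrow> f i \<in> carrier (free_algebra X)" "finite S"
  shows "(\<Oplus>\<^bsub>quotient_algebra (free_algebra X) J\<^esub>i\<in>S. J +>\<^bsub>free_algebra X\<^esub> f i) = J +>\<^bsub>free_algebra X\<^esub> sum f S"
proof -
  interpret alg_quot "free_algebra X" J by fact
  interpret Q: nonunital_algebra "quotient_algebra (free_algebra X) J" by (rule quot_algebra)
  show ?thesis using assms(3,2)
    by (induction rule: finite_induct)
      (auto simp: quot_simps coset_0[unfolded free_algebra_simps] free_algebra_carrier_sum free_algebra_simps)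
qed

context
  fixes E :: "('v, 'e) pre_digraph"
  assumes wf: "wf_digraph E"
begin

lemma lpa_gens_carrier:
  "v \<in> verts E \<Longrightarrow> generator (Vertex v) \<in> carrier (free_algebra (lpa_gens E))"
  "e \<in> arcs E \<Longrightarrow> generator (Edge e) \<in> carrier (free_algebra (lpa_gens E))"
  "e \<in> arcs E \<Longrightarrow> generator (Ghost e) \<in> carrier (free_algebra (lpa_gens E))"
  "e \<in> arcs E \<Longrightarrow> generator (Vertex (tail E e)) \<in> carrier (free_algebra (lpa_gens E))"
  "e \<in> arcs E \<Longrightarrow> generator (Vertex (head E e)) \<in> carrier (free_algebra (lpa_gens E))"
  using wf by (auto intro!: generator_carrier simp: lpa_gens_def wf_digraph_def)

lemma finite_emitter_carrier: "finite_emitter E v \<Longrightarrow> v \<in> verts E" "e \<in> out_arcs E v \<Longrightarrow> e \<in> arcs E"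
  by (auto simp: finite_emitter_def out_arcs_def)

lemmas lpa_carrier_rules = lpa_gens_carrier free_algebra_carrier_mult free_algebra_carrier_diff free_algebra_carrier_sum free_algebra_carrier_0

lemma leavitt_relators_carrier: "leavitt_relators E \<subseteq> carrier (free_algebra (lpa_gens E))"
  unfolding leavitt_relators_def Let_def by (auto intro!: lpa_carrier_rules dest: finite_emitter_carrier)

lemma leavitt_relatorI:
  "v \<in> verts E \<Longrightarrow> w \<in> verts E \<Longrightarrow> generator (Vertex v) * generator (Vertex w) - (if v = w then generator (Vertex v) else 0) \<in> leavitt_relators E"
  "e \<in> arcs E \<Longrightarrow> generator (Vertex (tail E e)) * generator (Edge e) - generator (Edge e) \<in> leavitt_relators E"
  "e \<in> arcs E \<Longrightarrow> generator (Edge e) * generator (Vertex (head E e)) - generator (Edge e) \<in> leavitt_relators E"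
  "e \<in> arcs E \<Longrightarrow> generator (Vertex (head E e)) * generator (Ghost e) - generator (Ghost e) \<in> leavitt_relators E"
  "e \<in> arcs E \<Longrightarrow> generator (Ghost e) * generator (Vertex (tail E e)) - generator (Ghost e) \<in> leavitt_relators E"
  "e \<in> arcs E \<Longrightarrow> f \<in> arcs E \<Longrightarrow> generator (Ghost e) * generator (Edge f) - (if e = f then generator (Vertex (head E e)) else 0) \<in> leavitt_relators E"
  "finite_emitter E v \<Longrightarrow> generator (Vertex v) - (\<Sum>e\<in>out_arcs E v. generator (Edge e) * generator (Ghost e)) \<in> leavitt_relators E"
  unfolding leavitt_relators_def Let_def by blast+

lemma lpa_quot: "alg_quot (free_algebra (lpa_gens E)) (leavitt_relation_ideal E)"
  unfolding leavitt_relation_ideal_def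
  by (intro alg_quot.intro free_algebra_nonunital_algebra alg_quot_axioms.intro
    algebra_ideal_generated_ideal leavitt_relators_carrier)

lemma leavitt_relators_subset: "leavitt_relators E \<subseteq> leavitt_relation_ideal E"
  unfolding leavitt_relation_ideal_def
  by (intro algebra_ideal_generated_ideal free_algebra_nonunital_algebra leavitt_relators_carrier)

lemma lpa_algebra: "nonunital_algebra (leavitt_path_algebra E)"
  unfolding leavitt_path_algebra_def by (rule alg_quot.quot_algebra[OF lpa_quot])

lemma lpa_family:
  "leavitt_family E (leavitt_path_algebra E :: ('k::field, _) module) (lpa_vertex E) (lpa_edge E) (lpa_ghost E)"
proof -
  let ?F = "free_algebra (lpa_gens E) :: ('k, _) module"
  let ?J = "leavitt_relation_ideal E :: ('k, 'v, 'e) lpa_free set"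
  interpret alg_quot ?F ?J by (rule lpa_quot)
  note d = diff_in_coset_eq[OF lpa_quot]
  note q = quot_simps[unfolded free_algebra_simps]
  have r: "x \<in> leavitt_relators E \<Longrightarrow> x \<in> ?J" for x using leavitt_relators_subset by auto
  show ?thesis
    unfolding leavitt_family_def leavitt_path_algebra_def lpa_vertex_def lpa_edge_def lpa_ghost_def lpa_class_def
  proof (intro conjI ballI allI impI)
    fix v w assume vw: "v \<in> verts E" "w \<in> verts E"
    define z where "z = (if v = w then generator (Vertex v) else 0 :: ('k, 'v, 'e) lpa_free)"
    have "?J +>\<^bsub>?F\<^esub> (generator (Vertex v) * generator (Vertex w)) = ?J +>\<^bsub>?F\<^esub> z"
      unfolding z_def by (intro d r leavitt_relatorI lpa_carrier_rules vw) (use vw in \<open>auto intro: lpa_carrier_rules\<close>)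
    then show "(?J +>\<^bsub>?F\<^esub> generator (Vertex v)) \<otimes>\<^bsub>quotient_algebra ?F ?J\<^esub> (?J +>\<^bsub>?F\<^esub> generator (Vertex w)) =
      (if v = w then ?J +>\<^bsub>?F\<^esub> generator (Vertex v) else \<zero>\<^bsub>quotient_algebra ?F ?J\<^esub>)"
      using vw by (simp add: q lpa_carrier_rules z_def coset_0[unfolded free_algebra_simps] split: if_splits)
  next
    fix e f assume ef: "e \<in> arcs E" "f \<in> arcs E"
    define z where "z = (if e = f then generator (Vertex (head E e)) else 0 :: ('k, 'v, 'e) lpa_free)"
    have "?J +>\<^bsub>?F\<^esub> (generator (Ghost e) * generator (Edge f)) = ?J +>\<^bsub>?F\<^esub> z"
      unfolding z_def by (intro d r leavitt_relatorI lpa_carrier_rules ef) (use ef in \<open>auto intro: lpa_carrier_rules\<close>)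
    then show "(?J +>\<^bsub>?F\<^esub> generator (Ghost e)) \<otimes>\<^bsub>quotient_algebra ?F ?J\<^esub> (?J +>\<^bsub>?F\<^esub> generator (Edge f)) =
      (if e = f then ?J +>\<^bsub>?F\<^esub> generator (Vertex (head E e)) else \<zero>\<^bsub>quotient_algebra ?F ?J\<^esub>)"
      using ef by (simp add: q lpa_carrier_rules z_def coset_0[unfolded free_algebra_simps] split: if_splits)
  next
    fix v assume v: "finite_emitter E v"
    have "generator (Vertex v) - (\<Sum>e\<in>out_arcs E v. generator (Edge e) * generator (Ghost e)) \<in> ?J"
      using v by (intro r leavitt_relatorI)
    then have "?J +>\<^bsub>?F\<^esub> generator (Vertex v) = ?J +>\<^bsub>?F\<^esub> (\<Sum>e\<in>out_arcs E v. generator (Edge e) * generator (Ghost e))"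
      by (intro d) (use v finite_emitter_carrier in \<open>auto intro!: lpa_carrier_rules\<close>)
    also have "\<dots> = (\<Oplus>\<^bsub>quotient_algebra ?F ?J\<^esub>e\<in>out_arcs E v. ?J +>\<^bsub>?F\<^esub> (generator (Edge e) * generator (Ghost e)))"
      by (rule finsum_coset[OF lpa_quot, symmetric]) (use v finite_emitter_carrier in \<open>auto intro!: lpa_carrier_rules simp: finite_emitter_def\<close>)
    also have "\<dots> = (\<Oplus>\<^bsub>quotient_algebra ?F ?J\<^esub>e\<in>out_arcs E v.
       (?J +>\<^bsub>?F\<^esub> generator (Edge e)) \<otimes>\<^bsub>quotient_algebra ?F ?J\<^esub> (?J +>\<^bsub>?F\<^esub> generator (Ghost e)))"
    proof -
      interpret Q: nonunital_algebra "quotient_algebra ?F ?J" by (rule quot_algebra)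
      show ?thesis
        by (rule Q.finsum_cong') (use finite_emitter_carrier in \<open>auto simp: q lpa_carrier_rules intro!: Q.m_closed\<close>)
    qed
    finally show "?J +>\<^bsub>?F\<^esub> generator (Vertex v) = \<dots>" .
  qed ((auto simp: q lpa_carrier_rules)[3], (simp add: q lpa_carrier_rules, (intro d r leavitt_relatorI lpa_carrier_rules; assumption))+)
qed

theorem lpa_universal:
  assumes B: "nonunital_algebra (B :: ('k::field, 'b, 'm) module_scheme)" and fam: "leavitt_family E B P S T"
  shows "\<exists>h. algebra_hom (leavitt_path_algebra E) B h \<and>
     (\<forall>v\<in>verts E. h (lpa_vertex E v) = P v) \<and> (\<forall>e\<in>arcs E. h (lpa_edge E e) = S e \<and> h (lpa_ghost E e) = T e) \<and>
     (\<forall>h'. algebra_hom (leavitt_path_algebra E) B h' \<and>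
       (\<forall>v\<in>verts E. h' (lpa_vertex E v) = P v) \<and> (\<forall>e\<in>arcs E. h' (lpa_edge E e) = S e \<and> h' (lpa_ghost E e) = T e)
       \<longrightarrow> (\<forall>x\<in>carrier (leavitt_path_algebra E). h' x = h x))"
proof -
  let ?F = "free_algebra (lpa_gens E) :: ('k, _) module"
  let ?J = "leavitt_relation_ideal E :: ('k, 'v, 'e) lpa_free set"
  let ?L = "leavitt_path_algebra E :: ('k, _) module"
  interpret alg_quot ?F ?J by (rule lpa_quot)
  interpret B: nonunital_algebra B by fact
  note L = quot_simps[folded leavitt_path_algebra_def, unfolded free_algebra_simps]
  define \<phi> where "\<phi> = (\<lambda>g. case g of Vertex v \<Rightarrow> P v | Edge e \<Rightarrow> S e | Ghost e \<Rightarrow> T e)"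
  interpret free_ev B "lpa_gens E" \<phi>
    by unfold_locales (use fam in \<open>auto simp: \<phi>_def leavitt_family_def lpa_gens_def\<close>)
  have gv: "ev (generator (Vertex v)) = P v" if "v \<in> verts E" for v
    using that by (subst ev_generator) (auto simp: \<phi>_def lpa_gens_def)
  have ge: "ev (generator (Edge e)) = S e" "ev (generator (Ghost e)) = T e" 
    "ev (generator (Vertex (head E e))) = P (head E e)" "ev (generator (Vertex (tail E e))) = P (tail E e)" if "e \<in> arcs E" for e
    using that wf ev_generator[of "Edge e"] ev_generator[of "Ghost e"]
    by (auto intro!: gv simp: wf_digraph_def lpa_gens_def) (auto simp: \<phi>_def)
  have Pc: "P v \<in> carrier B" if "v \<in> verts E" for v using that fam by (auto simp: leavitt_family_def)
  have Ec: "S e \<in> carrier B" "T e \<in> carrier B" "P (head E e) \<in> carrier B" "P (tail E e) \<in> carrier B" if "e \<in> arcs E" for e 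
    using that fam wf by (auto simp: leavitt_family_def wf_digraph_def)
  have "leavitt_relators E \<subseteq> ker"
  proof -
    have ev0: "ev (p - q) = \<zero>\<^bsub>B\<^esub>" if "p \<in> carrier ?F" "q \<in> carrier ?F" "ev p = ev q" for p q
      using that by (simp add: ev_diff B.r_neg a_minus_def ev_closed)
    have k: "p - q \<in> ker" if "p \<in> carrier ?F" "q \<in> carrier ?F" "ev p = ev q" for p q
      using that ev0 by (auto simp: ker_def free_algebra_carrier_diff)
    have k0: "p * q \<in> ker" if "p \<in> carrier ?F" "q \<in> carrier ?F" "ev p \<otimes>\<^bsub>B\<^esub> ev q = \<zero>\<^bsub>B\<^esub>" for p q
      using that by (simp add: ker_def ev_mult free_algebra_carrier_mult)
    have 1: "generator (Vertex v) - (\<Sum>e\<in>out_arcs E v. generator (Edge e) * generator (Ghost e)) \<in> ker" if v: "finite_emitter E v" for v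
    proof (rule k)
      have "ev (\<Sum>e\<in>out_arcs E v. generator (Edge e) * generator (Ghost e)) = (\<Oplus>\<^bsub>B\<^esub>e\<in>out_arcs E v. ev (generator (Edge e) * generator (Ghost e)))"
        by (rule ev_sum) (use v finite_emitter_carrier in \<open>auto intro!: lpa_carrier_rules simp: finite_emitter_def\<close>)
      also have "\<dots> = (\<Oplus>\<^bsub>B\<^esub>e\<in>out_arcs E v. S e \<otimes>\<^bsub>B\<^esub> T e)"
        by (rule B.finsum_cong') (use finite_emitter_carrier in \<open>auto simp: ev_mult lpa_carrier_rules ge intro!: B.m_closed Ec\<close>)
      finally show "ev (generator (Vertex v)) = ev (\<Sum>e\<in>out_arcs E v. generator (Edge e) * generator (Ghost e))"
        using v fam by (simp add: gv finite_emitter_carrier leavitt_family_def)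
    qed (use v finite_emitter_carrier in \<open>auto intro!: lpa_carrier_rules\<close>)
    show ?thesis
      unfolding leavitt_relators_def Let_def
      by (use fam in \<open>auto intro!: k k0 lpa_carrier_rules 1 simp: ev_mult lpa_carrier_rules gv ge ev_zero leavitt_family_def\<close>)
  qed
  then have JK: "?J \<subseteq> ker"
    unfolding leavitt_relation_ideal_def by (rule algebra_ideal_generated_least[OF ker_ideal])
  define h where "h = (\<lambda>Y. ev (SOME x. x \<in> Y))"
  have h: "h (?J +>\<^bsub>?F\<^esub> p) = ev p" if p: "p \<in> carrier ?F" for p
  proof -
    have "(SOME x. x \<in> ?J +>\<^bsub>?F\<^esub> p) \<in> ?J +>\<^bsub>?F\<^esub> p" using a_rcos_self[OF p] by (rule someI)
    then obtain i where i: "i \<in> ?J" "(SOME x. x \<in> ?J +>\<^bsub>?F\<^esub> p) = i + p"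
      using mem_coset[OF p] by (auto simp: free_algebra_simps)
    then have "i \<in> ker" using JK by auto
    then show ?thesis using i p by (auto simp: h_def ker_def ev_add ev_closed)
  qed
  have hom: "algebra_hom ?L B h"
    unfolding algebra_hom_def
    by (auto simp: L h ev_closed free_algebra_carrier_add free_algebra_carrier_mult free_algebra_carrier_scale ev_add ev_mult ev_smult)
  have hg: "\<forall>v\<in>verts E. h (lpa_vertex E v) = P v" "\<forall>e\<in>arcs E. h (lpa_edge E e) = S e \<and> h (lpa_ghost E e) = T e"
    by (auto simp: lpa_vertex_def lpa_edge_def lpa_ghost_def lpa_class_def h lpa_carrier_rules gv ge)
  have uniq: "h' x = h x"
    if h': "algebra_hom ?L B h'" and g': "\<forall>v\<in>verts E. h' (lpa_vertex E v) = P v" "\<forall>e\<in>arcs E. h' (lpa_edge E e) = S e \<and> h' (lpa_ghost E e) = T e"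
      and x: "x \<in> carrier ?L" for h' x
  proof -
    let ?k = "\<lambda>p. h' (?J +>\<^bsub>?F\<^esub> p)"
    have ka: "?k (p + q) = ?k p \<oplus>\<^bsub>B\<^esub> ?k q" if "p \<in> carrier ?F" "q \<in> carrier ?F" for p q
      using h' that L(3)[OF that] by (metis (no_types, lifting) algebra_hom_def L(1) imageI)
    have km: "?k (p * q) = ?k p \<otimes>\<^bsub>B\<^esub> ?k q" if "p \<in> carrier ?F" "q \<in> carrier ?F" for p q
      using h' that L(4)[OF that] by (metis (no_types, lifting) algebra_hom_def L(1) imageI)
    have ks: "?k (Poly_Mapping.single 0 c * p) = c \<odot>\<^bsub>B\<^esub> ?k p" if "p \<in> carrier ?F" for p c
      using h' that L(5)[OF that] by (metis (no_types, lifting) algebra_hom_def L(1) imageI)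
    have kc: "?k p \<in> carrier B" if "p \<in> carrier ?F" for p
      using h' that unfolding algebra_hom_def L by blast
    have kg: "?k (generator g) = \<phi> g" if "g \<in> lpa_gens E" for g
      using that g' by (auto simp: lpa_gens_def \<phi>_def lpa_vertex_def lpa_edge_def lpa_ghost_def lpa_class_def)
    have kw: "?k (Poly_Mapping.single (Word w) 1) = wev w" if "w \<noteq> []" "set w \<subseteq> lpa_gens E" for w
      using that
    proof (induction w rule: wev.induct)
      case (2 g)
      then show ?case using kg by (auto simp: generator_def)
    next
      case (3 g a gs)
      have "Poly_Mapping.single (Word (g # a # gs)) (1::'k) = generator g * Poly_Mapping.single (Word (a # gs)) 1"
        by (simp add: generator_def mult_single plus_free_monoid_def)
      moreover have "Poly_Mapping.single (Word (a # gs)) (1::'k) \<in> carrier ?F" using 3 by (intro single_carrier) auto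
      ultimately show ?case using 3 km[of "generator g" "Poly_Mapping.single (Word (a # gs)) 1"] kg[of g]
        generator_carrier[of g "lpa_gens E"] by auto
    qed auto
    have kz: "?k 0 = \<zero>\<^bsub>B\<^esub>"
      using ka[of 0 0] kc[of 0] B.add.l_cancel_one[of "?k 0" "?k 0"] free_algebra_carrier_0 by auto
    have "?k p = ev p" if "p \<in> carrier ?F" for p
      using that
    proof (induction p rule: carrier_induct)
      case (add w c q)
      have "Poly_Mapping.single w c = Poly_Mapping.single 0 c * Poly_Mapping.single w 1" by (simp add: mult_single)
      then have "?k (Poly_Mapping.single w c) = c \<odot>\<^bsub>B\<^esub> wev (letters w)"
        using ks[of "Poly_Mapping.single w 1" c] kw[of "letters w"] add(1) single_carrier[OF add(1)] by simp
      then show ?case using add ka single_carrier[OF add(1)] by (simp add: ev_add ev_single)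
    qed (simp add: kz ev_zero)
    then show ?thesis using x h by (auto simp: L)
  qed
  show ?thesis using hom hg uniq by blast
qed

end

end

theory Submission
  imports Defs
begin

text \<open>
  Everything rests on a reduction: if \<open>G\<close> satisfies Condition (L) and an algebra is generated by a Leavitt
  \<open>G\<close>-family with nonzero vertices, then every nonzero \<open>a\<close> satisfies \<open>b a d = v\<close> for some \<open>b, d\<close> and some
  vertex \<open>v\<close>. Multiplying by edges on the right removes ghost edges from \<open>a\<close>; a nonzero combination of real
  paths into \<open>w\<close> becomes, after multiplying by the ghost of a shortest one, a nonzero multiple of \<open>w\<close> plus
  closed paths at \<open>w\<close>, and exits conjugate the closed paths to \<open>0\<close>. No grading is used, so the reduction
  applies to quotients of \<open>L\<^sub>K(E)\<close> directly, without identifying \<open>L\<^sub>K(E)/I(H, B\<^sub>H)\<close> with \<open>L\<^sub>K(E - H)\<close>.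

  Under (1)--(3) the reduction gives simplicity, and leads from any nonzero right ideal to a vertex on a
  closed path with an exit, which is an infinite idempotent. Conversely, put \<open>H = I \<inter> E\<^sup>0\<close>. A simple
  ring with a nonzero commutative corner \<open>eRe\<close> is not purely infinite, because \<open>eRe\<close> is then a field and
  \<open>eR\<close> a minimal right ideal. Nonzero images of the elements \<open>v\<^sup>H\<close> and vertices on closed paths without
  exit have commutative corners; this excludes both. So the reduction applies to \<open>L\<^sub>K(E)/I(H, B\<^sub>H)\<close> and
  shows that \<open>I\<close> is no larger than \<open>I(H, B\<^sub>H)\<close>. If \<open>E - H\<close> had no closed path, finitely many elements
  would lie in a finite-dimensional subalgebra, where \<open>ts = a\<close> forces \<open>st = a\<close>. For (1), a concrete
  representation on functions on \<open>(E\<^sup>0 - Y) \<times> \<nat>\<close> separates a hereditary and saturated set \<open>Y\<close> from the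
  other vertices.
\<close>

section \<open>Rings without identity\<close>

text \<open>The universal property of \<open>leavitt_path_algebra\<close> enters only through the
  concrete representation, which shows that vertices outside a hereditary and saturated set survive.
  All other steps calculate with the relations in an arbitrary algebra generated by a Leavitt
  family. The elements \<open>breaking_element E H v\<close> belong to the ideal for this reason: a
  vertex that emits infinitely many edges, of which finitely many but at least one end outside
  \<open>H\<close>, is an infinite emitter of \<open>E\<close> and a finite emitter of the quotient
  graph. Killing its element imposes exactly the sum relation that the quotient graph demands there.
  Since there is no identity, direct summands are translated into pairs \<open>s\<close>,
  \<open>t\<close> in a corner, and finite sums of vertices serve as local units.\<close>

context rng
begin

lemma minus_mult:
  assumes "x \<in> carrier R" "y \<in> carrier R"
  shows "(\<ominus> x) \<otimes> y = \<ominus> (x \<otimes> y)" "x \<otimes> (\<ominus> y) = \<ominus> (x \<otimes> y)"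
proof -
  have "(\<ominus> x) \<otimes> y \<oplus> x \<otimes> y = \<zero>"
    using assms by (simp add: l_distr[symmetric] l_neg zero_mult)
  then show "(\<ominus> x) \<otimes> y = \<ominus> (x \<otimes> y)"
    using assms by (simp add: minus_equality m_closed)
  have "x \<otimes> (\<ominus> y) \<oplus> x \<otimes> y = \<zero>"
    using assms by (simp add: r_distr[symmetric] l_neg zero_mult)
  then show "x \<otimes> (\<ominus> y) = \<ominus> (x \<otimes> y)"
    using assms by (simp add: minus_equality m_closed)
qed

lemma diff_mult:
  assumes "x \<in> carrier R" "y \<in> carrier R" "z \<in> carrier R"
  shows "(x \<ominus> y) \<otimes> z = x \<otimes> z \<ominus> y \<otimes> z" "z \<otimes> (x \<ominus> y) = z \<otimes> x \<ominus> z \<otimes> y"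
  using assms by (simp_all add: a_minus_def l_distr r_distr minus_mult)

lemma diff_eq_zero:
  assumes "x \<in> carrier R" "y \<in> carrier R"
  shows "x \<ominus> y = \<zero> \<longleftrightarrow> x = y"
proof
  assume "x \<ominus> y = \<zero>"
  moreover have "x = (x \<ominus> y) \<oplus> y" using assms by (simp add: a_minus_def a_assoc l_neg)
  ultimately show "x = y" using assms by simp
qed (use assms in \<open>simp add: a_minus_def r_neg\<close>)

lemma additive_subgroupI':
  assumes "M \<subseteq> carrier R" "\<zero> \<in> M"
    and "\<And>x y. x \<in> M \<Longrightarrow> y \<in> M \<Longrightarrow> x \<oplus> y \<in> M" "\<And>x. x \<in> M \<Longrightarrow> \<ominus> x \<in> M"
  shows "additive_subgroup M R"
proof (rule additive_subgroupI, rule add.subgroupI)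
  show "M \<noteq> {}" using assms(2) by auto
qed (use assms in auto)

lemma additive_subgroupD:
  assumes "additive_subgroup M R"
  shows "M \<subseteq> carrier R" "\<zero> \<in> M" "x \<in> M \<Longrightarrow> y \<in> M \<Longrightarrow> x \<oplus> y \<in> M" "x \<in> M \<Longrightarrow> \<ominus> x \<in> M"
    "x \<in> M \<Longrightarrow> y \<in> M \<Longrightarrow> x \<ominus> y \<in> M"
proof -
  interpret additive_subgroup M R by fact
  show "M \<subseteq> carrier R" "\<zero> \<in> M" "x \<in> M \<Longrightarrow> y \<in> M \<Longrightarrow> x \<oplus> y \<in> M"
    by auto
  show *: "x \<in> M \<Longrightarrow> \<ominus> x \<in> M" for x
    using add.subgroupE(3)[OF a_subgroup] by (simp add: a_inv_def)
  show "x \<in> M \<Longrightarrow> y \<in> M \<Longrightarrow> x \<ominus> y \<in> M"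
    by (simp add: a_minus_def *)
qed

lemma finsum_in_subgroup:
  assumes "additive_subgroup M R" "\<And>i. i \<in> F \<Longrightarrow> f i \<in> M"
  shows "finsum R f F \<in> M"
  using assms(2)
proof (induction F rule: infinite_finite_induct)
  case (insert i F)
  then have "f i \<in> carrier R" "f \<in> F \<rightarrow> carrier R" using additive_subgroupD(1)[OF assms(1)] by auto
  then show ?case using insert additive_subgroupD(3)[OF assms(1)] by auto
qed (use additive_subgroupD(2)[OF assms(1)] in auto)

lemma additive_subgroup_annihilator:
  assumes "b \<in> carrier R" shows "additive_subgroup {x \<in> carrier R. b \<otimes> x = \<zero>} R"
  by (rule additive_subgroupI') (use assms in \<open>auto simp: zero_mult r_distr minus_mult\<close>)

lemma right_idealI:
  assumes "M \<subseteq> carrier R" "\<zero> \<in> M"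
    and "\<And>x y. x \<in> M \<Longrightarrow> y \<in> M \<Longrightarrow> x \<oplus> y \<in> M" "\<And>x. x \<in> M \<Longrightarrow> \<ominus> x \<in> M"
    and "\<And>x r. x \<in> M \<Longrightarrow> r \<in> carrier R \<Longrightarrow> x \<otimes> r \<in> M"
  shows "right_ideal M R"
  unfolding right_ideal_def using additive_subgroupI'[OF assms(1-4)] assms(5) by blast

lemma two_sided_idealI:
  assumes "M \<subseteq> carrier R" "\<zero> \<in> M"
    and "\<And>x y. x \<in> M \<Longrightarrow> y \<in> M \<Longrightarrow> x \<oplus> y \<in> M" "\<And>x. x \<in> M \<Longrightarrow> \<ominus> x \<in> M"
    and "\<And>x r. x \<in> M \<Longrightarrow> r \<in> carrier R \<Longrightarrow> x \<otimes> r \<in> M"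
    and "\<And>x r. x \<in> M \<Longrightarrow> r \<in> carrier R \<Longrightarrow> r \<otimes> x \<in> M"
  shows "two_sided_ideal M R"
  unfolding two_sided_ideal_def using additive_subgroupI'[OF assms(1-4)] assms(5,6) by blast

lemma mem_principal: "x \<in> a <# carrier R \<longleftrightarrow> (\<exists>r\<in>carrier R. x = a \<otimes> r)"
  by (auto simp: l_coset_def)

lemma principal_right_ideal:
  assumes "a \<in> carrier R" shows "right_ideal (a <# carrier R) R"
proof (rule right_idealI)
  show "x \<oplus> y \<in> a <# carrier R" if "x \<in> a <# carrier R" "y \<in> a <# carrier R" for x y
    using that assms by (auto simp: l_coset_def r_distr[symmetric] intro!: exI[of _ "_ \<oplus> _"])
  show "\<ominus> x \<in> a <# carrier R" if "x \<in> a <# carrier R" for x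
    using that assms by (auto simp: l_coset_def minus_mult(2)[symmetric] intro!: exI[of _ "\<ominus> _"])
  show "x \<otimes> r \<in> a <# carrier R" if "x \<in> a <# carrier R" "r \<in> carrier R" for x r
    using that assms by (auto simp: l_coset_def m_assoc m_closed intro!: exI[of _ "_ \<otimes> _"])
  show "\<zero> \<in> a <# carrier R"
    unfolding mem_principal using zero_mult(2)[OF assms] by (intro bexI[of _ \<zero>]) auto
qed (use assms in \<open>auto simp: l_coset_def m_closed\<close>)

section \<open>Infinite idempotents in terms of elements, and commutative corners\<close>

text \<open>Left multiplication by \<open>s\<close> maps aR isomorphically onto pR, where p = st is
  an idempotent of the corner at a, and left multiplication by \<open>t\<close> undoes it. The
  complement of pR in aR is (a - p)R. If pR were all of aR, then p = pa = a.\<close>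

lemma infinite_idempotentI:
  assumes a: "idempotent R a"
    and st: "s \<in> carrier R" "t \<in> carrier R" "a \<otimes> s = s" "s \<otimes> a = s" "a \<otimes> t = t" "t \<otimes> a = t"
    and ts: "t \<otimes> s = a" and nst: "s \<otimes> t \<noteq> a"
  shows "infinite_idempotent R a"
proof -
  have ac: "a \<in> carrier R" and aa: "a \<otimes> a = a" using a by (auto simp: idempotent_def)
  define p where "p = s \<otimes> t"
  have pc: "p \<in> carrier R" using st by (simp add: p_def m_closed)
  have ap: "a \<otimes> p = p" "p \<otimes> a = p" using st ac by (simp_all add: p_def m_assoc[symmetric]) (simp add: m_assoc)
  have pp: "p \<otimes> p = p"
    using st ts ac by (metis m_assoc m_closed p_def)
  let ?N = "p <# carrier R" and ?N' = "(a \<ominus> p) <# carrier R"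
  have dc: "a \<ominus> p \<in> carrier R" using ac pc by simp
  have pd: "p \<otimes> (a \<ominus> p) = \<zero>"
    using ac pc by (simp add: diff_mult ap pp) (simp add: r_neg a_minus_def)
  have sum: "?N <+> ?N' = a <# carrier R"
  proof (intro equalityI subsetI)
    fix x assume "x \<in> set_add R ?N ?N'"
    then obtain r r' where r: "r \<in> carrier R" "r' \<in> carrier R" "x = p \<otimes> r \<oplus> (a \<ominus> p) \<otimes> r'"
      by (auto simp: set_add_def set_mult_def mem_principal)
    have "a \<otimes> (a \<ominus> p) = a \<ominus> p" using ac pc by (simp add: diff_mult aa ap)
    then have "x = a \<otimes> x"
      using r ac pc dc by (simp add: r_distr m_closed m_assoc[symmetric] ap)
    then show "x \<in> a <# carrier R" using r pc dc by (auto simp: mem_principal m_closed)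
  next
    fix x assume "x \<in> a <# carrier R"
    then obtain r where r: "r \<in> carrier R" "x = a \<otimes> r" by (auto simp: mem_principal)
    have "a = p \<oplus> (a \<ominus> p)" using ac pc by (simp add: a_minus_def a_lcomm r_neg)
    then have "x = p \<otimes> r \<oplus> (a \<ominus> p) \<otimes> r" using r pc dc l_distr by metis
    then show "x \<in> set_add R ?N ?N'" using r
      unfolding set_add_def set_mult_def by (auto simp: l_coset_def)
  qed
  have int: "?N \<inter> ?N' = {\<zero>}"
  proof -
    have "x = \<zero>" if "x \<in> ?N" "x \<in> ?N'" for x
    proof -
      obtain r r' where r: "r \<in> carrier R" "r' \<in> carrier R" "x = p \<otimes> r" "x = (a \<ominus> p) \<otimes> r'"
        using \<open>x \<in> ?N\<close> \<open>x \<in> ?N'\<close> by (auto simp: mem_principal)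
      have "x = p \<otimes> x" using r(1,3) pc pp by (simp add: m_assoc[symmetric])
      also have "\<dots> = \<zero>" using r(2,4) pc dc pd by (simp add: m_assoc[symmetric] zero_mult)
      finally show ?thesis .
    qed
    moreover have "\<zero> \<in> ?N" "\<zero> \<in> ?N'" using pc dc zero_mult by (auto simp: mem_principal intro!: bexI[of _ \<zero>])
    ultimately show ?thesis by blast
  qed
  have ne: "?N \<noteq> a <# carrier R"
  proof
    assume "?N = a <# carrier R"
    then have "a \<in> ?N" using aa ac by (force simp: mem_principal)
    then obtain r where "r \<in> carrier R" "a = p \<otimes> r" by (auto simp: mem_principal)
    then have "p \<otimes> a = a" using pp pc by (simp add: m_assoc[symmetric])
    then show False using ap nst p_def by simp
  qed
  have inj: "t \<otimes> (s \<otimes> x) = x" if "x \<in> a <# carrier R" for x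
    using that st ac aa ts by (auto simp: mem_principal m_assoc[symmetric] m_closed)
  have "bij_betw (\<lambda>x. s \<otimes> x) (a <# carrier R) ?N"
    unfolding bij_betw_def
  proof
    show "inj_on ((\<otimes>) s) (a <# carrier R)" using inj by (rule inj_on_inverseI)
    show "(\<otimes>) s ` (a <# carrier R) = ?N"
    proof (intro equalityI subsetI)
      fix x assume "x \<in> (\<otimes>) s ` (a <# carrier R)"
      then obtain r where r: "r \<in> carrier R" "x = s \<otimes> (a \<otimes> r)" by (auto simp: mem_principal)
      then have "x = p \<otimes> (s \<otimes> r)"
        using st ac ts by (metis m_assoc m_closed p_def)
      then show "x \<in> ?N" using r st by (auto simp: mem_principal m_closed)
    next
      fix x assume "x \<in> ?N"
      then obtain r where r: "r \<in> carrier R" "x = p \<otimes> r" by (auto simp: mem_principal)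
      then have "x = s \<otimes> (a \<otimes> (t \<otimes> r))" using st ac by (metis m_assoc m_closed p_def)
      moreover have "a \<otimes> (t \<otimes> r) \<in> a <# carrier R" using r st by (auto simp: mem_principal m_closed)
      ultimately show "x \<in> (\<otimes>) s ` (a <# carrier R)" by blast
    qed
  qed
  then have "right_module_iso R (a <# carrier R) ?N (\<lambda>x. s \<otimes> x)"
    unfolding right_module_iso_def using st ac by (auto simp: mem_principal m_closed r_distr m_assoc)
  moreover have "proper_direct_summand R ?N (a <# carrier R)"
    unfolding proper_direct_summand_def using sum int ne principal_right_ideal pc dc by blast
  ultimately show ?thesis using a unfolding infinite_idempotent_def by blast
qed

text \<open>A right module isomorphism defined on aR is left multiplication by its value
  \<open>s\<close> at a. The component \<open>n\<close> of a in the summand \<open>N\<close> has the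
  form st, which provides \<open>t\<close>.\<close>

lemma infinite_idempotentE:
  assumes "infinite_idempotent R a"
  obtains s t where "s \<in> carrier R" "t \<in> carrier R" "a \<otimes> s = s" "s \<otimes> a = s" "a \<otimes> t = t" "t \<otimes> a = t"
    "t \<otimes> s = a" "s \<otimes> t \<noteq> a"
proof -
  have ac: "a \<in> carrier R" and aa: "a \<otimes> a = a" using assms by (auto simp: infinite_idempotent_def idempotent_def)
  let ?M = "a <# carrier R"
  obtain N N' f where N: "right_ideal N R" "N \<noteq> ?M" "right_ideal N' R" "N <+> N' = ?M" "N \<inter> N' = {\<zero>}"
    and f: "bij_betw f ?M N" "\<And>x r. x \<in> ?M \<Longrightarrow> r \<in> carrier R \<Longrightarrow> f (x \<otimes> r) = f x \<otimes> r"
    using assms unfolding infinite_idempotent_def proper_direct_summand_def right_module_iso_def by blast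
  have M: "x \<in> ?M \<longleftrightarrow> x \<in> carrier R \<and> a \<otimes> x = x" for x
    using ac aa by (auto simp: mem_principal m_closed m_assoc[symmetric] intro: bexI[of _ x])
  have aM: "a \<in> ?M" using M ac aa by simp
  have Nc: "N \<subseteq> carrier R" "N' \<subseteq> carrier R" and z: "\<zero> \<in> N'"
    using N additive_subgroupD(1,2) unfolding right_ideal_def by auto
  have NM: "N \<subseteq> ?M"
  proof
    fix x assume x: "x \<in> N"
    then have "x \<oplus> \<zero> \<in> N <+> N'" using z unfolding set_add_def set_mult_def by auto
    then show "x \<in> ?M" using N(4) x Nc by auto
  qed
  define s where "s = f a"
  have sN: "s \<in> N" using f(1) aM by (auto simp: s_def bij_betw_def)
  then have s: "s \<in> carrier R" "a \<otimes> s = s" using NM M by auto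
  have sa: "s \<otimes> a = s" using f(2)[OF aM ac] aa by (simp add: s_def)
  have fx: "f x = s \<otimes> x" if "x \<in> ?M" for x
    using f(2)[OF aM, of x] that M by (simp add: s_def)
  obtain n n' where n: "n \<in> N" "n' \<in> N'" "a = n \<oplus> n'"
    using aM unfolding N(4)[symmetric] set_add_def set_mult_def by auto
  obtain t where t: "t \<in> ?M" "n = s \<otimes> t" using f(1) n(1) fx by (auto simp: bij_betw_def)
  then have tc: "t \<in> carrier R" "a \<otimes> t = t" using M by auto
  have nc: "n \<in> carrier R" "n' \<in> carrier R" using n Nc by auto
  \<comment> \<open>From s = ns + n's, the term n's = s - ns lies in both summands and therefore
    vanishes.\<close>
  have "n \<otimes> s = s"
  proof -
    have e: "s = n \<otimes> s \<oplus> n' \<otimes> s" using s n nc by (metis l_distr)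
    then have "n' \<otimes> s = s \<ominus> n \<otimes> s" using nc s
      by (metis a_minus_def m_closed a_comm add.inv_solve_right')
    moreover have "s \<ominus> n \<otimes> s \<in> N" using additive_subgroupD(5)[of N s "n \<otimes> s"] N(1) sN n(1) s by (auto simp: right_ideal_def)
    moreover have "n' \<otimes> s \<in> N'" using N(3) n(2) s by (auto simp: right_ideal_def)
    ultimately have "n' \<otimes> s = \<zero>" using N(5) by auto
    then show ?thesis using e nc s by (simp add: m_closed)
  qed
  then have "f (t \<otimes> s) = f a"
    using fx[of "t \<otimes> s"] fx[OF aM] t tc s sa M ac by (simp add: m_assoc[symmetric] m_closed)
  then have ts: "t \<otimes> s = a"
    using f(1) aM M tc s ac unfolding bij_betw_def inj_on_def by (metis m_assoc m_closed)
  \<comment> \<open>So far \<open>t\<close> is fixed by a only from the left; ta lies in the corner.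
    Equality would give a = na in \<open>N\<close>, and then \<open>N\<close> would be all of
    aR.\<close>
  have "s \<otimes> (t \<otimes> a) \<noteq> a"
  proof
    assume "s \<otimes> (t \<otimes> a) = a"
    then have "a = n \<otimes> a" using t tc s ac by (simp add: m_assoc)
    then have "a \<in> N" using N(1) n(1) ac unfolding right_ideal_def by metis
    then have "?M \<subseteq> N" using N(1) by (auto simp: right_ideal_def mem_principal)
    then show False using N(2) NM by auto
  qed
  moreover have "t \<otimes> a \<in> carrier R" "a \<otimes> (t \<otimes> a) = t \<otimes> a" "(t \<otimes> a) \<otimes> a = t \<otimes> a" "(t \<otimes> a) \<otimes> s = a"
    using tc ac aa s ts by (simp_all add: m_closed m_assoc) (simp add: m_assoc[symmetric])
  ultimately show ?thesis using that s sa by blast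
qed

text \<open>Simplicity makes every nonzero element of the corner eRe invertible there. An infinite
  idempotent a in eR then satisfies ea = a and ae = e, so right multiplication by e carries
  \<open>s\<close> and \<open>t\<close> into the commutative corner, where a one-sided inverse is
  two-sided.\<close>

lemma simple_commutative_corner_not_purely_infinite:
  assumes simple: "simple_rng R" and e: "idempotent R e" "e \<noteq> \<zero>"
    and comm: "\<And>x y. x \<in> carrier R \<Longrightarrow> y \<in> carrier R \<Longrightarrow>
      (e \<otimes> x \<otimes> e) \<otimes> (e \<otimes> y \<otimes> e) = (e \<otimes> y \<otimes> e) \<otimes> (e \<otimes> x \<otimes> e)"
  shows "\<not> purely_infinite R"
proof
  assume pi: "purely_infinite R"
  have ec: "e \<in> carrier R" and ee: "e \<otimes> e = e" using e by (auto simp: idempotent_def)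
  have corner_comm: "x \<otimes> y = y \<otimes> x"
    if "x \<in> carrier R" "y \<in> carrier R" "e \<otimes> x = x" "x \<otimes> e = x" "e \<otimes> y = y" "y \<otimes> e = y" for x y
    using comm[OF that(1,2)] that by simp
  have ideal: "M = carrier R" if "two_sided_ideal M R" "x \<in> M" "x \<noteq> \<zero>" for M x
    using simple that unfolding simple_rng_def by blast
  have inv: "\<exists>z\<in>carrier R. y \<otimes> (e \<otimes> z \<otimes> e) = e"
    if y: "y \<in> carrier R" "e \<otimes> y = y" "y \<otimes> e = y" "y \<noteq> \<zero>" for y
  proof -
    \<comment> \<open>The two-sided ideal of all m with epmqe in y(eRe) for all p, q. Commutativity
      moves y to the front of epyqe, so y is in \<open>M\<close>; by simplicity e is in
      \<open>M\<close> too, and p = q = e yields the inverse.\<close>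
    define M where "M = {m \<in> carrier R. \<forall>p\<in>carrier R. \<forall>q\<in>carrier R. \<exists>z\<in>carrier R.
      e \<otimes> p \<otimes> m \<otimes> q \<otimes> e = y \<otimes> (e \<otimes> z \<otimes> e)}"
    have "two_sided_ideal M R"
    proof (rule two_sided_idealI)
      show "\<zero> \<in> M" using ec y by (auto simp: M_def zero_mult m_closed intro!: bexI[of _ \<zero>])
      show "x \<oplus> x' \<in> M" if x: "x \<in> M" "x' \<in> M" for x x'
      proof -
        have "\<exists>z\<in>carrier R. e \<otimes> p \<otimes> (x \<oplus> x') \<otimes> q \<otimes> e = y \<otimes> (e \<otimes> z \<otimes> e)"
          if pq: "p \<in> carrier R" "q \<in> carrier R" for p q
        proof -
          obtain z z' where "z \<in> carrier R" "e \<otimes> p \<otimes> x \<otimes> q \<otimes> e = y \<otimes> (e \<otimes> z \<otimes> e)"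
            "z' \<in> carrier R" "e \<otimes> p \<otimes> x' \<otimes> q \<otimes> e = y \<otimes> (e \<otimes> z' \<otimes> e)"
            using x pq unfolding M_def by blast
          then show ?thesis using x pq ec y
            by (intro bexI[of _ "z \<oplus> z'"]) (auto simp: M_def r_distr l_distr m_closed)
        qed
        then show ?thesis using x by (auto simp: M_def)
      qed
      show "\<ominus> x \<in> M" if x: "x \<in> M" for x
      proof -
        have "\<exists>z\<in>carrier R. e \<otimes> p \<otimes> (\<ominus> x) \<otimes> q \<otimes> e = y \<otimes> (e \<otimes> z \<otimes> e)"
          if pq: "p \<in> carrier R" "q \<in> carrier R" for p q
        proof -
          obtain z where "z \<in> carrier R" "e \<otimes> p \<otimes> x \<otimes> q \<otimes> e = y \<otimes> (e \<otimes> z \<otimes> e)"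
            using x pq unfolding M_def by blast
          then show ?thesis using x pq ec y
            by (intro bexI[of _ "\<ominus> z"]) (auto simp: M_def minus_mult m_closed)
        qed
        then show ?thesis using x by (auto simp: M_def)
      qed
      show "x \<otimes> r \<in> M" if x: "x \<in> M" "r \<in> carrier R" for x r
      proof -
        have "e \<otimes> p \<otimes> (x \<otimes> r) \<otimes> q \<otimes> e = e \<otimes> p \<otimes> x \<otimes> (r \<otimes> q) \<otimes> e"
          if "p \<in> carrier R" "q \<in> carrier R" for p q
          using x that ec by (simp add: M_def m_assoc m_closed)
        then show ?thesis using x by (auto simp: M_def m_closed)
      qed
      show "r \<otimes> x \<in> M" if x: "x \<in> M" "r \<in> carrier R" for x r
      proof -
        have "e \<otimes> p \<otimes> (r \<otimes> x) \<otimes> q \<otimes> e = e \<otimes> (p \<otimes> r) \<otimes> x \<otimes> q \<otimes> e"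
          if "p \<in> carrier R" "q \<in> carrier R" for p q
          using x that ec by (simp add: M_def m_assoc m_closed)
        then show ?thesis using x by (auto simp: M_def m_closed)
      qed
    qed (auto simp: M_def)
    moreover have "y \<in> M"
    proof -
      have "e \<otimes> p \<otimes> y \<otimes> q \<otimes> e = y \<otimes> (e \<otimes> (p \<otimes> e \<otimes> q) \<otimes> e)" if pq: "p \<in> carrier R" "q \<in> carrier R" for p q
      proof -
        have "e \<otimes> p \<otimes> y \<otimes> q \<otimes> e = ((e \<otimes> p \<otimes> e) \<otimes> y) \<otimes> (e \<otimes> q \<otimes> e)"
          using pq ec y by (metis m_assoc m_closed)
        also have "(e \<otimes> p \<otimes> e) \<otimes> y = y \<otimes> (e \<otimes> p \<otimes> e)"
          using pq ec ee y by (intro corner_comm) (simp_all add: m_closed m_assoc, simp add: m_assoc[symmetric] m_closed)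
        also have "y \<otimes> (e \<otimes> p \<otimes> e) \<otimes> (e \<otimes> q \<otimes> e) = y \<otimes> (e \<otimes> (p \<otimes> (e \<otimes> e) \<otimes> q) \<otimes> e)"
          using pq ec y by (simp add: m_closed m_assoc)
        finally show ?thesis by (simp add: ee)
      qed
      then show ?thesis using y ec unfolding M_def by (blast intro: m_closed)
    qed
    ultimately have "e \<in> M" using ideal y ec by blast
    then obtain z where "z \<in> carrier R" "e \<otimes> e \<otimes> e \<otimes> e \<otimes> e = y \<otimes> (e \<otimes> z \<otimes> e)"
      unfolding M_def using ec by blast
    then show ?thesis using ee by metis
  qed
  have "e \<in> e <# carrier R" using ee ec by (force simp: mem_principal)
  then obtain a where a: "a \<in> e <# carrier R" "infinite_idempotent R a"
    using pi principal_right_ideal[OF ec] e(2) unfolding purely_infinite_def by blast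
  from a(2) obtain s t where st: "s \<in> carrier R" "t \<in> carrier R" "a \<otimes> s = s" "s \<otimes> a = s" "a \<otimes> t = t" "t \<otimes> a = t"
    "t \<otimes> s = a" "s \<otimes> t \<noteq> a" by (rule infinite_idempotentE)
  have ac: "a \<in> carrier R" and aa: "a \<otimes> a = a" using a(2) by (auto simp: infinite_idempotent_def idempotent_def)
  have ea: "e \<otimes> a = a" using a(1) ec ee by (auto simp: mem_principal m_assoc[symmetric])
  have a0: "a \<noteq> \<zero>" using st zero_mult by metis
  have "\<exists>r\<in>carrier R. a \<otimes> r \<otimes> e \<noteq> \<zero>"
  proof (rule ccontr)
    assume n: "\<not> ?thesis"
    \<comment> \<open>The left annihilator of Re is a two-sided ideal. If it contained the nonzero
      a, it would be the whole ring and contain e, although eee = e is nonzero.\<close>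
    define Z where "Z = {x \<in> carrier R. \<forall>r\<in>carrier R. x \<otimes> r \<otimes> e = \<zero>}"
    have "two_sided_ideal Z R"
    proof (rule two_sided_idealI)
      show "x \<otimes> r \<in> Z" if "x \<in> Z" "r \<in> carrier R" for x r
        using that ec m_assoc[of x r] by (auto simp: Z_def m_closed)
    qed (use ec in \<open>auto simp: Z_def zero_mult m_closed l_distr minus_mult m_assoc\<close>)
    moreover have "a \<in> Z" using n ac unfolding Z_def by blast
    ultimately have "e \<in> Z" using ideal a0 ec by blast
    then have "e \<otimes> e \<otimes> e = \<zero>" using ec unfolding Z_def by blast
    then show False using ee e by simp
  qed
  then obtain r where r: "r \<in> carrier R" "a \<otimes> r \<otimes> e \<noteq> \<zero>" by blast
  obtain z where z: "z \<in> carrier R" "(a \<otimes> r \<otimes> e) \<otimes> (e \<otimes> z \<otimes> e) = e"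
  proof -
    have "e \<otimes> (a \<otimes> r \<otimes> e) = a \<otimes> r \<otimes> e" "(a \<otimes> r \<otimes> e) \<otimes> e = a \<otimes> r \<otimes> e"
      using r ac ec ee ea by (simp_all add: m_closed m_assoc) (simp add: m_assoc[symmetric] m_closed)
    moreover have "a \<otimes> r \<otimes> e \<in> carrier R" using r ac ec by (simp add: m_closed)
    ultimately show ?thesis using inv[of "a \<otimes> r \<otimes> e"] r that by blast
  qed
  \<comment> \<open>The choice of \<open>z\<close> writes e as a multiple of a from the left, and a
    fixes such multiples.\<close>
  have ae: "a \<otimes> e = e"
  proof -
    have "a \<otimes> (a \<otimes> (r \<otimes> e \<otimes> (e \<otimes> z \<otimes> e))) = a \<otimes> (r \<otimes> e \<otimes> (e \<otimes> z \<otimes> e))"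
      using z(1) r ac ec aa by (simp add: m_assoc[of a a, symmetric] m_closed)
    then show ?thesis using z r ac ec by (simp add: m_assoc m_closed)
  qed
  have es: "e \<otimes> s = s" "e \<otimes> t = t" using st ea ec ac by (metis m_assoc)+
  \<comment> \<open>Both factors lie in eRe because es = s and et = t. Commuting them turns this
    into ste = e, and multiplication by a gives st = a.\<close>
  have "(t \<otimes> e) \<otimes> (s \<otimes> e) = e"
    using st ec es ae by (metis m_assoc m_closed)
  moreover have "(t \<otimes> e) \<otimes> (s \<otimes> e) = (s \<otimes> e) \<otimes> (t \<otimes> e)"
    using st ec es ee by (intro corner_comm) (simp_all add: m_closed m_assoc, simp_all add: m_assoc[symmetric] m_closed)
  ultimately have "s \<otimes> t \<otimes> e = e" using st ec es by (metis m_assoc m_closed)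
  then have "s \<otimes> t \<otimes> a = a" using st ec ac ea by (metis m_assoc m_closed)
  then show False using st ac by (simp add: m_assoc)
qed

end

section \<open>Linear spans\<close>

context nonunital_algebra
begin

lemma smult_zero_left: "x \<in> carrier A \<Longrightarrow> 0 \<odot> x = \<zero>"
  using smult_l_distr[of x 0 0] add.l_cancel_one[of "0 \<odot> x" "0 \<odot> x"] smult_closed by auto

lemma smult_zero_right: "c \<odot> \<zero> = \<zero>"
  using smult_r_distr[of \<zero> \<zero> c] add.l_cancel_one[of "c \<odot> \<zero>" "c \<odot> \<zero>"] smult_closed by auto

lemma smult_minus_one:
  assumes "x \<in> carrier A" shows "(- 1) \<odot> x = \<ominus> x"
proof -
  have "(- 1) \<odot> x \<oplus> 1 \<odot> x = \<zero>"
    using assms smult_l_distr[of x "- 1" 1] by (simp add: smult_zero_left)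
  then show ?thesis using assms by (simp add: smult_one smult_closed minus_equality)
qed

text \<open>The inductive form lets proofs peel off one term at a time, without index sets or
  coefficient functions.\<close>

inductive_set lspan :: "'a set \<Rightarrow> 'a set" for X where
  zero: "\<zero> \<in> lspan X"
| step: "t \<in> X \<Longrightarrow> x \<in> lspan X \<Longrightarrow> c \<odot> t \<oplus> x \<in> lspan X"

lemma lspan_closed:
  assumes "X \<subseteq> carrier A" shows "lspan X \<subseteq> carrier A"
proof
  fix x assume "x \<in> lspan X"
  then show "x \<in> carrier A" using assms by induction (auto simp: smult_closed)
qed

lemma lspan_base:
  assumes "X \<subseteq> carrier A" "x \<in> X" shows "x \<in> lspan X"
  using lspan.step[OF assms(2) lspan.zero, of 1] assms by (auto simp: smult_one)

lemma lspan_add: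
  assumes X: "X \<subseteq> carrier A" and "x \<in> lspan X" "y \<in> lspan X"
  shows "x \<oplus> y \<in> lspan X"
  using assms(2)
proof induction
  case zero
  then show ?case using assms(3) lspan_closed[OF X] by auto
next
  case (step t x c)
  then have "c \<odot> t \<oplus> x \<oplus> y = c \<odot> t \<oplus> (x \<oplus> y)"
    using X assms(3) lspan_closed[OF X] by (intro a_assoc) (auto simp: smult_closed)
  then show ?case using step lspan.step by metis
qed

lemma lspan_smult:
  assumes X: "X \<subseteq> carrier A" and "x \<in> lspan X"
  shows "c \<odot> x \<in> lspan X"
  using assms(2)
proof induction
  case zero
  then show ?case by (simp add: smult_zero_right lspan.zero)
next
  case (step t x d)
  then have "t \<in> carrier A" "x \<in> carrier A" using X lspan_closed[OF X] by auto
  then have "c \<odot> (d \<odot> t \<oplus> x) = (c * d) \<odot> t \<oplus> c \<odot> x"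
    by (simp add: smult_r_distr smult_assoc smult_closed)
  then show ?case using step lspan.step by metis
qed

lemma lspan_minus:
  assumes X: "X \<subseteq> carrier A" and "x \<in> lspan X" shows "\<ominus> x \<in> lspan X"
  using lspan_smult[OF assms, of "- 1"] lspan_closed[OF X] assms(2) smult_minus_one by auto

lemma lspan_diff:
  assumes "X \<subseteq> carrier A" "x \<in> lspan X" "y \<in> lspan X" shows "x \<ominus> y \<in> lspan X"
  unfolding a_minus_def by (intro lspan_add lspan_minus assms)

lemma lspan_least:
  assumes "Y \<subseteq> carrier A" "X \<subseteq> lspan Y" shows "lspan X \<subseteq> lspan Y"
proof
  fix x assume "x \<in> lspan X"
  then show "x \<in> lspan Y"
    by induction (use assms in \<open>auto intro!: lspan.zero lspan_add lspan_smult\<close>)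
qed

lemma lspan_mono:
  assumes "X \<subseteq> Y" shows "lspan X \<subseteq> lspan Y"
proof
  fix x assume "x \<in> lspan X"
  then show "x \<in> lspan Y" by induction (use assms in \<open>auto intro: lspan.intros\<close>)
qed

lemma lspan_empty: "lspan {} = {\<zero>}"
proof -
  have "x = \<zero>" if "x \<in> lspan {}" for x using that by cases auto
  then show ?thesis using lspan.zero by auto
qed

lemma lspan_insertE:
  assumes "insert t X \<subseteq> carrier A" "x \<in> lspan (insert t X)"
  obtains c y where "x = c \<odot> t \<oplus> y" "y \<in> lspan X"
proof -
  have t: "t \<in> carrier A" and X: "X \<subseteq> carrier A" using assms(1) by auto
  have "\<exists>c y. x = c \<odot> t \<oplus> y \<and> y \<in> lspan X"
    using assms(2)
  proof induction
    case zero
    then show ?case using t by (intro exI[of _ 0] exI[of _ \<zero>]) (simp add: smult_zero_left lspan.zero)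
  next
    case (step u x d)
    then obtain c y where cy: "x = c \<odot> t \<oplus> y" "y \<in> lspan X" by blast
    have y: "y \<in> carrier A" using cy lspan_closed[OF X] by auto
    show ?case
    proof (cases "u = t")
      case True
      then have "d \<odot> u \<oplus> x = (d + c) \<odot> t \<oplus> y"
        using t y cy by (simp add: smult_l_distr a_assoc smult_closed)
      then show ?thesis using cy by blast
    next
      case False
      then have u: "u \<in> X" "u \<in> carrier A" using step X by auto
      then have "d \<odot> u \<oplus> x = c \<odot> t \<oplus> (d \<odot> u \<oplus> y)"
        using t y cy by (simp add: a_lcomm smult_closed)
      then show ?thesis using cy u lspan.step by blast
    qed
  qed
  then show ?thesis using that by blast
qed

lemma lspan_finite:
  assumes "x \<in> lspan X"
  obtains F where "finite F" "F \<subseteq> X" "x \<in> lspan F"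
proof -
  have "\<exists>F. finite F \<and> F \<subseteq> X \<and> x \<in> lspan F"
    using assms
  proof induction
    case zero
    show ?case by (intro exI[of _ "{}"]) (simp add: lspan.zero)
  next
    case (step t x c)
    then obtain F where F: "finite F" "F \<subseteq> X" "x \<in> lspan F" by blast
    then have "x \<in> lspan (insert t F)" using lspan_mono[of F "insert t F"] by auto
    then show ?case using F step(1) lspan.step[of t "insert t F" x c]
      by (intro exI[of _ "insert t F"]) auto
  qed
  then show ?thesis using that by blast
qed

lemma lspan_mult_left:
  assumes X: "X \<subseteq> carrier A" and Y: "Y \<subseteq> carrier A" and a: "a \<in> carrier A"
    and "\<And>t. t \<in> X \<Longrightarrow> a \<otimes> t \<in> lspan Y" and "x \<in> lspan X"
  shows "a \<otimes> x \<in> lspan Y"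
  using assms(5)
proof induction
  case zero
  then show ?case using a by (simp add: zero_mult lspan.zero)
next
  case (step t x c)
  then have "t \<in> carrier A" "x \<in> carrier A" using X lspan_closed[OF X] by auto
  then have "a \<otimes> (c \<odot> t \<oplus> x) = c \<odot> (a \<otimes> t) \<oplus> a \<otimes> x"
    using a by (simp add: r_distr smult_mult_r smult_closed)
  then show ?case using step assms(4) Y by (simp add: lspan_add lspan_smult)
qed

lemma lspan_mult_right:
  assumes X: "X \<subseteq> carrier A" and Y: "Y \<subseteq> carrier A" and a: "a \<in> carrier A"
    and "\<And>t. t \<in> X \<Longrightarrow> t \<otimes> a \<in> lspan Y" and "x \<in> lspan X"
  shows "x \<otimes> a \<in> lspan Y"
  using assms(5)
proof induction
  case zero
  then show ?case using a by (simp add: zero_mult lspan.zero)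
next
  case (step t x c)
  then have "t \<in> carrier A" "x \<in> carrier A" using X lspan_closed[OF X] by auto
  then have "(c \<odot> t \<oplus> x) \<otimes> a = c \<odot> (t \<otimes> a) \<oplus> x \<otimes> a"
    using a by (simp add: l_distr smult_mult_l smult_closed)
  then show ?case using step assms(4) Y by (simp add: lspan_add lspan_smult)
qed

lemma lspan_mult:
  assumes X: "X \<subseteq> carrier A" and Y: "Y \<subseteq> carrier A" and Z: "Z \<subseteq> carrier A"
    and "\<And>s t. s \<in> X \<Longrightarrow> t \<in> Y \<Longrightarrow> s \<otimes> t \<in> lspan Z" and "x \<in> lspan X" "y \<in> lspan Y"
  shows "x \<otimes> y \<in> lspan Z"
proof (rule lspan_mult_right[OF X Z _ _ assms(5)])
  show y: "y \<in> carrier A" using assms(6) lspan_closed[OF Y] by auto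
  show "t \<otimes> y \<in> lspan Z" if "t \<in> X" for t
    by (rule lspan_mult_left[OF Y Z _ _ assms(6)]) (use that X assms(4) in auto)
qed

lemma lspan_commute:
  assumes X: "X \<subseteq> carrier A" and "\<And>s t. s \<in> X \<Longrightarrow> t \<in> X \<Longrightarrow> s \<otimes> t = t \<otimes> s"
    and "x \<in> lspan X" "y \<in> lspan X"
  shows "x \<otimes> y = y \<otimes> x"
proof -
  have *: "x \<otimes> t = t \<otimes> x" if "x \<in> lspan X" "t \<in> carrier A" "\<And>s. s \<in> X \<Longrightarrow> s \<otimes> t = t \<otimes> s" for x t
    using that(1)
  proof induction
    case zero
    then show ?case using that by (simp add: zero_mult)
  next
    case (step u x c)
    then have "u \<in> carrier A" "x \<in> carrier A" using X lspan_closed[OF X] by auto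
    then show ?case using that(2) that(3)[OF step(1)] step(3)
      by (simp add: l_distr r_distr smult_mult_l smult_mult_r smult_closed)
  qed
  have "s \<otimes> y = y \<otimes> s" if "s \<in> X" for s
    using *[of y s] assms that X by (metis subsetD)
  then show ?thesis using *[of x y] assms lspan_closed[OF X] by blast
qed

text \<open>The first nonzero coefficient of a linear relation has been divided out, so that no coefficients
  occur in the statement.\<close>

lemma lspan_finite_dependent:
  fixes y :: "nat \<Rightarrow> 'a"
  assumes "finite T" "T \<subseteq> carrier A" "\<And>i. y i \<in> lspan T"
  shows "\<exists>k. y k \<in> lspan (y ` {k<..})"
  using assms
proof (induction T arbitrary: y rule: finite_induct)
  case empty
  then have "y 0 = \<zero>" by (simp add: lspan_empty)
  then show ?case using lspan.zero by metis
next
  case (insert t T)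
  have T: "T \<subseteq> carrier A" and t: "t \<in> carrier A" using insert.prems by auto
  have yc: "y i \<in> carrier A" for i using insert.prems lspan_closed by blast
  show ?case
  proof (cases "\<exists>K. \<forall>i\<ge>K. y i \<in> lspan T")
    case True
    then obtain K where K: "\<And>i. i \<ge> K \<Longrightarrow> y i \<in> lspan T" by blast
    have "\<exists>k. y (K + k) \<in> lspan ((\<lambda>i. y (K + i)) ` {k<..})"
      by (rule insert.IH[OF T]) (simp add: K)
    then obtain k where k: "y (K + k) \<in> lspan ((\<lambda>i. y (K + i)) ` {k<..})" by blast
    have "(\<lambda>i. y (K + i)) ` {k<..} \<subseteq> y ` {K + k<..}" by auto
    then show ?thesis using k lspan_mono by blast
  next
    case False
    then have "\<forall>i. \<exists>m\<ge>Suc i. y m \<notin> lspan T" by blast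
    \<comment> \<open>Gaussian elimination with the pivot taken later in the sequence:
      \<open>y (m i)\<close> has a nonzero coefficient at \<open>t\<close>, and a multiple of it
      removes \<open>t\<close> from \<open>y i\<close>. As \<open>m i\<close> exceeds
      \<open>i\<close>, a relation expressing one modified vector by later ones does the same for
      the original vectors.\<close>
    then obtain m where m: "\<And>i. m i \<ge> Suc i" "\<And>i. y (m i) \<notin> lspan T" by metis
    have "\<exists>c. y i \<ominus> c \<odot> y (m i) \<in> lspan T" for i
    proof -
      obtain b z where bz: "y i = b \<odot> t \<oplus> z" "z \<in> lspan T"
        using lspan_insertE insert.prems by metis
      obtain d u where du: "y (m i) = d \<odot> t \<oplus> u" "u \<in> lspan T"
        using lspan_insertE insert.prems by metis
      have zu: "z \<in> carrier A" "u \<in> carrier A" using bz du lspan_closed[OF T] by auto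
      have d: "d \<noteq> 0"
      proof
        assume "d = 0"
        then have "y (m i) = u" using du t zu by (simp add: smult_zero_left)
        then show False using m(2)[of i] du by simp
      qed
      have "(b / d) \<odot> y (m i) = b \<odot> t \<oplus> (b / d) \<odot> u"
        using d t zu unfolding du by (simp add: smult_r_distr smult_closed smult_assoc[symmetric])
      then have "y i \<ominus> (b / d) \<odot> y (m i) = z \<ominus> (b / d) \<odot> u"
        unfolding bz using t zu
        by (simp add: a_minus_def minus_add smult_closed a_ac r_neg2 r_neg1)
      moreover have "z \<ominus> (b / d) \<odot> u \<in> lspan T" using bz du T by (intro lspan_diff lspan_smult)
      ultimately show ?thesis by metis
    qed
    then obtain c where c: "\<And>i. y i \<ominus> c i \<odot> y (m i) \<in> lspan T" by metis
    define y' where "y' i = y i \<ominus> c i \<odot> y (m i)" for i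
    obtain k where k: "y' k \<in> lspan (y' ` {k<..})" using insert.IH[of y', OF T] c unfolding y'_def by blast
    have Y: "y ` {k<..} \<subseteq> carrier A" using yc by auto
    have mem: "c i \<odot> y (m i) \<in> lspan (y ` {k<..})" if "i \<ge> k" for i
    proof (intro lspan_smult[OF Y] lspan_base[OF Y] imageI)
      show "m i \<in> {k<..}" using m(1)[of i] that by simp
    qed
    have "y' ` {k<..} \<subseteq> lspan (y ` {k<..})"
    proof
      fix x assume "x \<in> y' ` {k<..}"
      then obtain i where i: "x = y' i" "i > k" by blast
      then show "x \<in> lspan (y ` {k<..})"
        unfolding i(1) y'_def by (intro lspan_diff[OF Y] lspan_base[OF Y] mem) auto
    qed
    then have "y' k \<in> lspan (y ` {k<..})" using k lspan_least[OF Y] by blast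
    then have "y' k \<oplus> c k \<odot> y (m k) \<in> lspan (y ` {k<..})" using mem[of k] lspan_add[OF Y] by simp
    moreover have "y' k \<oplus> c k \<odot> y (m k) = y k"
      using yc by (simp add: y'_def a_minus_def a_assoc l_neg smult_closed)
    ultimately show ?thesis by metis
  qed
qed

text \<open>Some power of \<open>s\<close> is a combination of higher powers. Multiplying by
  \<open>t\<close> lowers exponents, so a itself is a combination of positive powers and has the
  form sr. Then t = ta = (ts)r = ar, hence st = sr = a. Only \<open>s\<close> and a have to lie in
  the finite-dimensional span.\<close>

lemma finite_dimensional_left_inverse:
  assumes X: "finite X" "X \<subseteq> carrier A" and mult: "\<And>x y. x \<in> X \<Longrightarrow> y \<in> X \<Longrightarrow> x \<otimes> y \<in> lspan X"
    and s: "s \<in> lspan X" and a: "a \<in> lspan X" and t: "t \<in> carrier A"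
    and e: "a \<otimes> a = a" "a \<otimes> s = s" "s \<otimes> a = s" "a \<otimes> t = t" "t \<otimes> a = t" and ts: "t \<otimes> s = a"
  shows "s \<otimes> t = a"
proof -
  have sc: "s \<in> carrier A" and ac: "a \<in> carrier A" using s a lspan_closed[OF X(2)] by auto
  \<comment> \<open>The zeroth power is a, the identity of the corner.\<close>
  define pow where "pow n = ((\<otimes>) s ^^ n) a" for n
  have pow_Suc: "pow (Suc n) = s \<otimes> pow n" for n by (simp add: pow_def)
  have pow: "pow n \<in> lspan X" for n
  proof (induction n)
    case (Suc n)
    then show ?case unfolding pow_Suc using lspan_mult[OF X(2) X(2) X(2) mult s] by blast
  qed (simp add: pow_def a)
  have powc: "pow n \<in> carrier A" for n using pow lspan_closed[OF X(2)] by blast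
  have apow: "a \<otimes> pow n = pow n" for n
    by (cases n) (auto simp: pow_Suc m_assoc[symmetric] powc sc ac e, simp add: pow_def e)
  have tpow: "t \<otimes> pow (Suc n) = pow n" for n
    using powc sc t ts by (simp add: pow_Suc m_assoc[symmetric] apow)
  obtain k where k: "pow k \<in> lspan (pow ` {k<..})"
    using lspan_finite_dependent[of X pow, OF X pow] by blast
  have "pow 0 \<in> lspan (pow ` {0<..})"
    using k
  proof (induction k)
    case (Suc k)
    have "t \<otimes> pow (Suc k) \<in> lspan (pow ` {k<..})"
    proof (rule lspan_mult_left[OF _ _ t _ Suc.prems])
      show "t \<otimes> u \<in> lspan (pow ` {k<..})" if u: "u \<in> pow ` {Suc k<..}" for u
      proof -
        obtain j where "u = pow j" "j > Suc k" using u by blast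
        then obtain i where "u = pow (Suc i)" "i > k" by (cases j) auto
        then show ?thesis using lspan_base[of "pow ` {k<..}" "pow i"] powc by (auto simp: tpow)
      qed
    qed (use powc in auto)
    then show ?case using Suc.IH by (simp add: tpow)
  qed
  moreover have "x \<in> s <# carrier A" if "x \<in> lspan (pow ` {0<..})" for x
    using that
  proof induction
    case zero
    then show ?case using zero_mult[OF sc] by (force simp: mem_principal)
  next
    case (step u x c)
    then obtain n r where n: "u = s \<otimes> pow n" "r \<in> carrier A" "x = s \<otimes> r"
      by (auto simp: mem_principal gr0_conv_Suc pow_Suc)
    then have "c \<odot> u \<oplus> x = s \<otimes> (c \<odot> pow n \<oplus> r)"
      using sc powc by (simp add: r_distr smult_mult_r smult_closed)
    then show ?case using n powc smult_closed by (auto simp: mem_principal)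
  qed
  ultimately have "a \<in> s <# carrier A" by (auto simp: pow_def)
  then obtain r where r: "r \<in> carrier A" "a = s \<otimes> r" by (auto simp: mem_principal)
  have "t = t \<otimes> (s \<otimes> r)" using r e by simp
  also have "\<dots> = a \<otimes> r" using r(1) sc t ts by (simp add: m_assoc[symmetric])
  finally have "s \<otimes> t = s \<otimes> a \<otimes> r" using r(1) sc ac by (simp add: m_assoc)
  then show ?thesis using r e by simp
qed

end

section \<open>Monomials in a generating Leavitt family\<close>

lemma (in wf_digraph) awalk_append_split:
  "awalk u (p @ q) w \<longleftrightarrow> (\<exists>x. awalk u p x \<and> awalk x q w)"
  by (metis awalk_append_iff awalk_appendI)

text \<open>Generation is stated as an induction principle. Neither universality nor nonvanishing of
  the vertices is assumed, so that a quotient of the Leavitt path algebra is an instance for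
  \<open>E\<close> and, once enough elements are killed, also for a quotient graph with the same
  \<open>P\<close>, \<open>S\<close>, \<open>T\<close>.\<close>

locale leavitt_generated = nonunital_algebra A + wf_digraph G
  for A :: "('k::field, 'a, 'm) module_scheme" (structure) and G :: "('v, 'e) pre_digraph" +
  fixes P :: "'v \<Rightarrow> 'a" and S T :: "'e \<Rightarrow> 'a"
  assumes family: "leavitt_family G A P S T"
    and generated: "\<And>Q. \<lbrakk>Q \<subseteq> carrier A; P ` verts G \<subseteq> Q; S ` arcs G \<subseteq> Q; T ` arcs G \<subseteq> Q; \<zero> \<in> Q;
      \<And>x y. x \<in> Q \<Longrightarrow> y \<in> Q \<Longrightarrow> x \<oplus> y \<in> Q; \<And>x y. x \<in> Q \<Longrightarrow> y \<in> Q \<Longrightarrow> x \<otimes> y \<in> Q;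
      \<And>c x. x \<in> Q \<Longrightarrow> c \<odot> x \<in> Q\<rbrakk> \<Longrightarrow> carrier A \<subseteq> Q"
begin

lemma P_closed [simp]: "v \<in> verts G \<Longrightarrow> P v \<in> carrier A"
  and S_closed [simp]: "e \<in> arcs G \<Longrightarrow> S e \<in> carrier A"
  and T_closed [simp]: "e \<in> arcs G \<Longrightarrow> T e \<in> carrier A"
  and P_P: "v \<in> verts G \<Longrightarrow> w \<in> verts G \<Longrightarrow> P v \<otimes> P w = (if v = w then P v else \<zero>)"
  and P_S: "e \<in> arcs G \<Longrightarrow> P (tail G e) \<otimes> S e = S e"
  and S_P: "e \<in> arcs G \<Longrightarrow> S e \<otimes> P (head G e) = S e"
  and P_T: "e \<in> arcs G \<Longrightarrow> P (head G e) \<otimes> T e = T e"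
  and T_P: "e \<in> arcs G \<Longrightarrow> T e \<otimes> P (tail G e) = T e"
  and T_S: "e \<in> arcs G \<Longrightarrow> f \<in> arcs G \<Longrightarrow> T e \<otimes> S f = (if e = f then P (head G e) else \<zero>)"
  and P_sum: "finite_emitter G v \<Longrightarrow> P v = (\<Oplus>e\<in>out_arcs G v. S e \<otimes> T e)"
  using family unfolding leavitt_family_def by auto

lemma S_T_closed [simp]: "e \<in> arcs G \<Longrightarrow> S e \<otimes> T e \<in> carrier A"
  by (simp add: m_closed)

lemma P_in_subgroup:
  assumes "additive_subgroup M A" "finite_emitter G v" "\<And>e. e \<in> out_arcs G v \<Longrightarrow> S e \<otimes> T e \<in> M"
  shows "P v \<in> M"
  unfolding P_sum[OF assms(2)] by (rule finsum_in_subgroup[OF assms(1,3)])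

text \<open>The vertex argument is the source; the empty path does not determine it by itself. The
  recursion leaves the range vertex as last factor, so that multiplication by vertices needs no
  separate treatment of the empty path.\<close>

fun rpath :: "'v \<Rightarrow> 'e list \<Rightarrow> 'a" where
  "rpath u [] = P u"
| "rpath u (e # p) = S e \<otimes> rpath (head G e) p"

fun gpath :: "'v \<Rightarrow> 'e list \<Rightarrow> 'a" where
  "gpath u [] = P u"
| "gpath u (e # p) = gpath (head G e) p \<otimes> T e"

lemma rpath_closed [simp]: "awalk u p w \<Longrightarrow> rpath u p \<in> carrier A"
  by (induction p arbitrary: u) (auto simp: awalk_simps m_closed)

lemma gpath_closed [simp]: "awalk u p w \<Longrightarrow> gpath u p \<in> carrier A"
  by (induction p arbitrary: u) (auto simp: awalk_simps m_closed)

lemma P_rpath: "awalk u p w \<Longrightarrow> v \<in> verts G \<Longrightarrow> P v \<otimes> rpath u p = (if v = u then rpath u p else \<zero>)"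
proof (induction p arbitrary: u)
  case (Cons e p)
  then have e: "e \<in> arcs G" "u = tail G e" "awalk (head G e) p w" by (auto simp: awalk_simps)
  have "P v \<otimes> (S e \<otimes> rpath (head G e) p) = P v \<otimes> (P u \<otimes> S e) \<otimes> rpath (head G e) p"
    using e Cons(3) by (simp add: P_S m_assoc)
  also have "\<dots> = (P v \<otimes> P u) \<otimes> (S e \<otimes> rpath (head G e) p)"
    using e Cons(3) by (simp add: m_assoc m_closed)
  also have "\<dots> = (if v = u then S e \<otimes> rpath (head G e) p else \<zero>)"
    using e Cons(3) by (simp add: P_P zero_mult m_closed m_assoc[symmetric] P_S)
  finally show ?case by simp
qed (auto simp: awalk_simps P_P)

lemma gpath_P: "awalk u p w \<Longrightarrow> v \<in> verts G \<Longrightarrow> gpath u p \<otimes> P v = (if v = u then gpath u p else \<zero>)"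
proof (induction p arbitrary: u)
  case (Cons e p)
  then have e: "e \<in> arcs G" "u = tail G e" "awalk (head G e) p w" by (auto simp: awalk_simps)
  have "gpath (head G e) p \<otimes> T e \<otimes> P v = gpath (head G e) p \<otimes> (T e \<otimes> P u) \<otimes> P v"
    using e Cons(3) by (simp add: T_P m_assoc)
  also have "\<dots> = (gpath (head G e) p \<otimes> T e) \<otimes> (P u \<otimes> P v)"
    using e Cons(3) by (simp add: m_assoc m_closed)
  also have "\<dots> = (if v = u then gpath (head G e) p \<otimes> T e else \<zero>)"
    using e Cons(3) by (simp add: P_P zero_mult m_closed m_assoc T_P)
  finally show ?case by simp
qed (auto simp: awalk_simps P_P)

lemma rpath_P: "awalk u p w \<Longrightarrow> v \<in> verts G \<Longrightarrow> rpath u p \<otimes> P v = (if v = w then rpath u p else \<zero>)"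
  by (induction p arbitrary: u) (auto simp: awalk_simps P_P m_assoc zero_mult)

lemma P_gpath: "awalk u p w \<Longrightarrow> v \<in> verts G \<Longrightarrow> P v \<otimes> gpath u p = (if v = w then gpath u p else \<zero>)"
  by (induction p arbitrary: u) (auto simp: awalk_simps P_P m_assoc[symmetric] zero_mult)

lemma rpath_append: "awalk u p w \<Longrightarrow> awalk w q x \<Longrightarrow> rpath u (p @ q) = rpath u p \<otimes> rpath w q"
  by (induction p arbitrary: u) (auto simp: awalk_simps P_rpath m_assoc)

lemma gpath_append: "awalk u p w \<Longrightarrow> awalk w q x \<Longrightarrow> gpath u (p @ q) = gpath w q \<otimes> gpath u p"
  by (induction p arbitrary: u) (auto simp: awalk_simps gpath_P m_assoc)

lemma gpath_rpath_Cons: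
  assumes "awalk u (e # p) w" "awalk u' (f # q) w'"
  shows "gpath u (e # p) \<otimes> rpath u' (f # q) =
    (if e = f then gpath (head G e) p \<otimes> rpath (head G e) q else \<zero>)"
proof -
  have e: "e \<in> arcs G" "awalk (head G e) p w" and f: "f \<in> arcs G" "awalk (head G f) q w'"
    using assms by (auto simp: awalk_simps)
  have "gpath u (e # p) \<otimes> rpath u' (f # q) = gpath (head G e) p \<otimes> ((T e \<otimes> S f) \<otimes> rpath (head G f) q)"
    using e f by (simp add: m_assoc m_closed)
  then show ?thesis using e f by (auto simp: T_S P_rpath zero_mult)
qed

lemma gpath_rpath: "awalk u p w \<Longrightarrow> gpath u p \<otimes> rpath u p = P w"
proof (induction p arbitrary: u)
  case (Cons e p)
  then have "awalk (head G e) p w" by (auto simp: awalk_simps)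
  then show ?case using Cons.IH gpath_rpath_Cons[OF Cons.prems Cons.prems] by simp
qed (auto simp: awalk_simps P_P)

text \<open>Equal first edges cancel and different ones give \<open>\<zero>\<close>. Hence the
  product vanishes unless one path is an initial segment of the other, and then the remaining
  segment survives, as a real or as a ghost path.\<close>

lemma gpath_rpath_cases:
  assumes "awalk u p w" "awalk u' q w'"
  obtains "gpath u p \<otimes> rpath u' q = \<zero>"
  | r where "u = u'" "q = p @ r" "awalk w r w'" "gpath u p \<otimes> rpath u' q = rpath w r"
  | r where "u = u'" "p = q @ r" "awalk w' r w" "gpath u p \<otimes> rpath u' q = gpath w' r"
proof -
  have "gpath u p \<otimes> rpath u' q = \<zero> \<or>
    (\<exists>r. u = u' \<and> q = p @ r \<and> awalk w r w' \<and> gpath u p \<otimes> rpath u' q = rpath w r) \<or>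
    (\<exists>r. u = u' \<and> p = q @ r \<and> awalk w' r w \<and> gpath u p \<otimes> rpath u' q = gpath w' r)"
    using assms
  proof (induction p arbitrary: u u' q)
    case Nil
    then have "u \<in> verts G" "w = u" by (auto simp: awalk_simps)
    then show ?case using Nil.prems(2) P_rpath[OF Nil.prems(2), of u] by (cases "u = u'") auto
  next
    case (Cons e p)
    show ?case
    proof (cases q)
      case Nil
      then have "u' \<in> verts G" "w' = u'" using Cons.prems by (auto simp: awalk_simps)
      then show ?thesis using Nil gpath_P[OF Cons.prems(1), of u'] Cons.prems(1) by auto
    next
      case (Cons f q')
      note q = this
      have q': "awalk (head G f) q' w'" "u' = tail G f" "awalk (head G e) p w" "u = tail G e"
        using Cons.prems q by (auto simp: awalk_simps)
      show ?thesis
      proof (cases "e = f")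
        case True
        have "gpath u (e # p) \<otimes> rpath u' (f # q') = gpath (head G e) p \<otimes> rpath (head G e) q'"
          using gpath_rpath_Cons Cons.prems q True by simp
        then show ?thesis using Cons.IH[OF q'(3) q'(1)] q True q' by auto
      next
        case False
        then show ?thesis using gpath_rpath_Cons[of u e p w u' f q' w'] Cons.prems q by auto
      qed
    qed
  qed
  then show ?thesis using that by blast
qed

text \<open>A real path times a ghost path, both ending at the same vertex. The predicate sees both
  paths and their sources, so that ghost lengths can be bounded or all paths confined to finite
  sets.\<close>

definition monomials :: "('v \<Rightarrow> 'e list \<Rightarrow> 'v \<Rightarrow> 'e list \<Rightarrow> bool) \<Rightarrow> 'a set" where
  "monomials Q = {rpath u p \<otimes> gpath v q | u p v q w. awalk u p w \<and> awalk v q w \<and> Q u p v q}"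

lemma monomials_closed: "monomials Q \<subseteq> carrier A"
  by (auto simp: monomials_def m_closed)

lemma monomialsI: "awalk u p w \<Longrightarrow> awalk v q w \<Longrightarrow> Q u p v q \<Longrightarrow> rpath u p \<otimes> gpath v q \<in> monomials Q"
  unfolding monomials_def by blast

lemma monomialsE:
  assumes "x \<in> monomials Q"
  obtains u p v q w where "x = rpath u p \<otimes> gpath v q" "awalk u p w" "awalk v q w" "Q u p v q"
  using assms unfolding monomials_def by blast

abbreviation "inside W F \<equiv> (\<lambda>u p v q. u \<in> W \<and> v \<in> W \<and> set p \<subseteq> F \<and> set q \<subseteq> F)"

text \<open>Cancellation leaves \<open>\<zero>\<close> or one monomial, built from edges and sources
  that already occur in the factors. This is why finite \<open>W\<close> and \<open>F\<close> give a
  finite-dimensional subalgebra when there are only finitely many paths along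
  \<open>F\<close>.\<close>

lemma monomials_mult:
  assumes "x \<in> monomials (inside W F)" "y \<in> monomials (inside W F)"
  shows "x \<otimes> y \<in> lspan (monomials (inside W F))"
proof -
  note l = lspan_base[OF monomials_closed]
  obtain u p v q w where x: "x = rpath u p \<otimes> gpath v q" "awalk u p w" "awalk v q w" "inside W F u p v q"
    using assms(1) by (rule monomialsE)
  obtain u' p' v' q' w' where y: "y = rpath u' p' \<otimes> gpath v' q'" "awalk u' p' w'" "awalk v' q' w'" "inside W F u' p' v' q'"
    using assms(2) by (rule monomialsE)
  have xy: "x \<otimes> y = rpath u p \<otimes> (gpath v q \<otimes> rpath u' p') \<otimes> gpath v' q'"
    using x y by (simp add: m_assoc m_closed)
  from x(3) y(2) show ?thesis
  proof (cases rule: gpath_rpath_cases)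
    case 1
    then have "x \<otimes> y = \<zero>" unfolding xy using x y by (simp add: zero_mult)
    then show ?thesis by (simp add: lspan.zero)
  next
    case (2 r)
    have "x \<otimes> y = rpath u (p @ r) \<otimes> gpath v' q'" unfolding xy 2(4) by (simp add: rpath_append[OF x(2) 2(3)])
    also have "\<dots> \<in> lspan (monomials (inside W F))"
      using x(4) y(4) 2(2) by (intro l monomialsI[OF awalk_appendI[OF x(2) 2(3)] y(3)]) auto
    finally show ?thesis .
  next
    case (3 r)
    have "x \<otimes> y = rpath u p \<otimes> gpath v' (q' @ r)"
      unfolding xy 3(4) using x(2) y(3) 3(3) by (simp add: gpath_append[OF y(3) 3(3)] m_assoc)
    also have "\<dots> \<in> lspan (monomials (inside W F))"
      using x(4) y(4) 3(2) by (intro l monomialsI[OF x(2) awalk_appendI[OF y(3) 3(3)]]) auto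
    finally show ?thesis .
  qed
qed

lemma P_eq_monomial: "v \<in> verts G \<Longrightarrow> P v = rpath v [] \<otimes> gpath v []"
  by (simp add: P_P)

lemma monomials_True: "monomials (inside UNIV UNIV) = monomials (\<lambda>_ _ _ _. True)"
  by (simp add: monomials_def)

lemma carrier_eq_lspan: "carrier A = lspan (monomials (\<lambda>_ _ _ _. True))"
proof
  let ?M = "monomials (\<lambda>_ _ _ _. True)"
  note l = lspan_base[OF monomials_closed]
  show "carrier A \<subseteq> lspan ?M"
  proof (rule generated)
    show "P ` verts G \<subseteq> lspan ?M"
    proof
      fix x assume "x \<in> P ` verts G"
      then obtain v where "x = P v" "v \<in> verts G" by blast
      then have "x = rpath v [] \<otimes> gpath v []" "v \<in> verts G" using P_eq_monomial by blast+
      moreover from this have "rpath v [] \<otimes> gpath v [] \<in> ?M"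
        by (intro monomialsI[of _ _ v]) (simp_all add: awalk_simps)
      ultimately show "x \<in> lspan ?M" using l by blast
    qed
    show "S ` arcs G \<subseteq> lspan ?M"
    proof
      fix x assume "x \<in> S ` arcs G"
      then obtain e where e: "x = S e" "e \<in> arcs G" by auto
      then have "x = rpath (tail G e) [e] \<otimes> gpath (head G e) []" by (simp add: S_P)
      moreover have "rpath (tail G e) [e] \<otimes> gpath (head G e) [] \<in> ?M"
        using e by (intro monomialsI[of _ _ "head G e"]) (auto simp: awalk_simps)
      ultimately show "x \<in> lspan ?M" using l by simp
    qed
    show "T ` arcs G \<subseteq> lspan ?M"
    proof
      fix x assume "x \<in> T ` arcs G"
      then obtain e where e: "x = T e" "e \<in> arcs G" by auto
      then have "x = rpath (head G e) [] \<otimes> gpath (tail G e) [e]" by (simp add: P_T)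
      moreover have "rpath (head G e) [] \<otimes> gpath (tail G e) [e] \<in> ?M"
        using e by (intro monomialsI[of _ _ "head G e"]) (auto simp: awalk_simps)
      ultimately show "x \<in> lspan ?M" using l by simp
    qed
    show "x \<otimes> y \<in> lspan ?M" if "x \<in> lspan ?M" "y \<in> lspan ?M" for x y
      using lspan_mult[OF monomials_closed monomials_closed monomials_closed monomials_mult]
        that unfolding monomials_True[symmetric] by blast
  qed (rule lspan_closed[OF monomials_closed] lspan.zero lspan_add[OF monomials_closed]
      lspan_smult[OF monomials_closed]; assumption)+
qed (rule lspan_closed[OF monomials_closed])

lemma inside_finite:
  assumes "x \<in> carrier A"
  obtains W F where "finite W" "finite F" "x \<in> lspan (monomials (inside W F))"
proof -
  obtain X where X: "finite X" "X \<subseteq> monomials (\<lambda>_ _ _ _. True)" "x \<in> lspan X"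
    using assms lspan_finite carrier_eq_lspan by blast
  have "\<exists>W F. finite W \<and> finite F \<and> X \<subseteq> monomials (inside W F)"
    using X(1,2)
  proof (induction X rule: finite_induct)
    case (insert y X)
    then obtain W F where WF: "finite W" "finite F" "X \<subseteq> monomials (inside W F)" by auto
    obtain u p v q w where y: "y = rpath u p \<otimes> gpath v q" "awalk u p w" "awalk v q w"
      using insert.prems by (auto elim: monomialsE)
    have "insert y X \<subseteq> monomials (inside (insert u (insert v W)) (F \<union> set p \<union> set q))"
    proof
      fix x assume "x \<in> insert y X"
      then show "x \<in> monomials (inside (insert u (insert v W)) (F \<union> set p \<union> set q))"
      proof
        assume "x = y"
        then show ?thesis using y by (auto intro: monomialsI)
      next
        assume "x \<in> X"
        then obtain u' p' v' q' w' where "x = rpath u' p' \<otimes> gpath v' q'" "awalk u' p' w'" "awalk v' q' w'"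
          "inside W F u' p' v' q'"
          by (elim monomialsE[OF subsetD[OF WF(3)]])
        then show ?thesis by (auto intro!: monomialsI)
      qed
    qed
    then show ?case using WF
      by (intro exI[of _ "insert u (insert v W)"] exI[of _ "F \<union> set p \<union> set q"]) auto
  qed auto
  then show ?thesis using X(3) lspan_mono that by blast
qed

text \<open>Every monomial, with any scalar, is fixed by left multiplication with its source
  vertex.\<close>

lemma two_sided_ideal_P_eq_carrier:
  assumes J: "two_sided_ideal J A" and P: "P ` verts G \<subseteq> J"
  shows "J = carrier A"
proof
  have sub: "additive_subgroup J A" and m: "\<And>a x. a \<in> J \<Longrightarrow> x \<in> carrier A \<Longrightarrow> a \<otimes> x \<in> J"
    using J unfolding two_sided_ideal_def by auto
  show JA: "J \<subseteq> carrier A" using additive_subgroupD(1)[OF sub] .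
  have mono: "c \<odot> x \<in> J" if x: "x \<in> monomials (\<lambda>_ _ _ _. True)" for x c
  proof -
    obtain u p v q w where y: "x = rpath u p \<otimes> gpath v q" "awalk u p w" "awalk v q w"
      using x by (rule monomialsE)
    then have "u \<in> verts G" by auto
    then have "c \<odot> x = P u \<otimes> (c \<odot> x)"
      using y P_rpath[OF y(2), of u] by (simp add: smult_mult_r m_closed m_assoc[symmetric])
    moreover have "P u \<otimes> (c \<odot> x) \<in> J"
      using P \<open>u \<in> verts G\<close> y by (intro m smult_closed) (auto simp: m_closed)
    ultimately show ?thesis by simp
  qed
  have "x \<in> J" if "x \<in> lspan (monomials (\<lambda>_ _ _ _. True))" for x
    using that by induction (use mono additive_subgroupD[OF sub] in auto)
  then show "carrier A \<subseteq> J" using carrier_eq_lspan by auto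
qed

text \<open>The sum of the vertices at which the ghost paths of a start fixes each of its monomials
  from the right. It replaces the missing identity.\<close>

lemma local_right_unit:
  assumes "a \<in> carrier A"
  obtains V where "finite V" "V \<subseteq> verts G" "a \<otimes> (\<Oplus>v\<in>V. P v) = a"
proof -
  obtain W F where W: "finite W" "a \<in> lspan (monomials (inside W F))"
    using inside_finite[OF assms] by metis
  define q where "q = (\<Oplus>v\<in>W \<inter> verts G. P v)"
  have fin: "finite (W \<inter> verts G)" using W by auto
  have qc: "q \<in> carrier A" unfolding q_def by (rule finsum_closed) auto
  have Pq: "P v \<otimes> q = P v" if v: "v \<in> W \<inter> verts G" for v
  proof -
    have q: "q = P v \<oplus> (\<Oplus>v\<in>W \<inter> verts G - {v}. P v)"
      unfolding q_def using fin v by (subst insert_Diff[OF v, symmetric], subst finsum_insert) auto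
    have c: "(\<Oplus>v\<in>W \<inter> verts G - {v}. P v) \<in> carrier A" by (rule finsum_closed) auto
    have "(\<Oplus>v\<in>W \<inter> verts G - {v}. P v) \<in> {x \<in> carrier A. P v \<otimes> x = \<zero>}"
      using v by (intro finsum_in_subgroup additive_subgroup_annihilator) (auto simp: P_P)
    then show ?thesis using v c by (simp add: q r_distr P_P)
  qed
  have mono: "x \<otimes> q = x" if x: "x \<in> monomials (inside W F)" for x
  proof -
    obtain u p v r w where y: "x = rpath u p \<otimes> gpath v r" "awalk u p w" "awalk v r w" "v \<in> W"
      using x by (auto elim!: monomialsE)
    have v: "v \<in> W \<inter> verts G" using y by auto
    have "gpath v r \<otimes> q = gpath v r \<otimes> (P v \<otimes> q)"
      using gpath_P[OF y(3), of v] y v qc by (simp add: m_assoc[symmetric])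
    also have "\<dots> = gpath v r" using Pq[OF v] gpath_P[OF y(3), of v] v by simp
    finally show ?thesis using y qc by (simp add: m_assoc)
  qed
  have "x \<otimes> q = x" if "x \<in> lspan (monomials (inside W F))" for x
    using that
  proof induction
    case (step t x c)
    then show ?case using qc mono monomials_closed lspan_closed[OF monomials_closed]
      by (auto simp: l_distr smult_mult_l smult_closed subset_iff)
  qed (use qc zero_mult in auto)
  then show ?thesis using that[OF fin] W unfolding q_def by blast
qed

lemma exists_vertex_right:
  assumes "a \<in> carrier A" "a \<noteq> \<zero>"
  obtains v where "v \<in> verts G" "a \<otimes> P v \<noteq> \<zero>"
proof -
  have "a = \<zero>" if *: "\<And>v. v \<in> verts G \<Longrightarrow> a \<otimes> P v = \<zero>"
  proof -
    obtain V where V: "V \<subseteq> verts G" "a \<otimes> (\<Oplus>v\<in>V. P v) = a" using local_right_unit[OF assms(1)] .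
    have "(\<Oplus>v\<in>V. P v) \<in> {x \<in> carrier A. a \<otimes> x = \<zero>}"
      using * assms V(1) by (intro finsum_in_subgroup additive_subgroup_annihilator) auto
    then show ?thesis using V(2) by simp
  qed
  then show ?thesis using that assms(2) by blast
qed

text \<open>With a local unit q, a scalar multiple of a is a times the scalar multiple of q. This
  allows an ideal of the ring to be divided out in the category of algebras.\<close>

lemma two_sided_ideal_is_algebra_ideal:
  assumes J: "two_sided_ideal J A" shows "algebra_ideal J A"
proof -
  have "c \<odot> a \<in> J" if a: "a \<in> J" for c a
  proof -
    have ac: "a \<in> carrier A"
      using J a additive_subgroupD(1) unfolding two_sided_ideal_def by blast
    obtain V where V: "V \<subseteq> verts G" "a \<otimes> (\<Oplus>v\<in>V. P v) = a" using local_right_unit[OF ac] .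
    have q: "(\<Oplus>v\<in>V. P v) \<in> carrier A" using V(1) by (intro finsum_closed) auto
    then have "c \<odot> a = a \<otimes> (c \<odot> (\<Oplus>v\<in>V. P v))" using ac V(2) by (simp add: smult_mult_r)
    then show ?thesis using J a q smult_closed unfolding two_sided_ideal_def by simp
  qed
  then show ?thesis using J unfolding algebra_ideal_def by blast
qed

end

section \<open>Reduction of nonzero elements to vertices\<close>

context wf_digraph
begin

lemma closed_pathI: "p \<noteq> [] \<Longrightarrow> awalk u p u \<Longrightarrow> closed_path G p"
  unfolding closed_path_def by blast

text \<open>A repeated source cuts out a shorter closed subpath, and an exit of the subpath is an
  exit of the whole path.\<close>

lemma condition_L_closed_path_exit:
  assumes L: "condition_L G" and "closed_path G p"
  shows "has_exit G p"
  using assms(2)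
proof (induction "length p" arbitrary: p rule: less_induct)
  case less
  show ?case
  proof (cases "distinct (map (tail G) p)")
    case True
    then show ?thesis using L less.prems unfolding condition_L_def simple_closed_path_def by blast
  next
    case False
    then obtain xs ys zs y where d: "map (tail G) p = xs @ [y] @ ys @ [y] @ zs"
      using not_distinct_decomp by blast
    have split: "\<exists>us vs. q = us @ vs \<and> map (tail G) vs = bs" if "map (tail G) q = as @ bs" for q as bs
      using that by (intro exI[of _ "take (length as) q"] exI[of _ "drop (length as) q"]) (simp add: drop_map[symmetric])
    obtain p1 q1 where q1: "p = p1 @ q1" "map (tail G) q1 = [y] @ ys @ [y] @ zs"
      using split[OF d] by blast
    obtain e q2 where q2: "q1 = e # q2" "tail G e = y" "map (tail G) q2 = ys @ [y] @ zs"
      using q1(2) by (cases q1) auto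
    obtain p2 q3 where q3: "q2 = p2 @ q3" "map (tail G) q3 = [y] @ zs"
      using split[OF q2(3)] by blast
    obtain f p3 where "q3 = f # p3" "tail G f = y"
      using q3(2) by (cases q3) auto
    with q1 q2 q3 have p: "p = p1 @ e # p2 @ f # p3" "tail G e = y" "tail G f = y" by auto
    obtain u where "awalk u p u" using less.prems unfolding closed_path_def by blast
    then have "awalk y (e # p2) y"
      unfolding p(1) using p(2,3) by (auto simp: awalk_append_split awalk_Cons_iff simp del: awalk_append_iff)
    then have "closed_path G (e # p2)" by (intro closed_pathI) auto
    moreover have "length (e # p2) < length p" by (simp add: p)
    ultimately have "has_exit G (e # p2)" by (rule less.hyps[rotated])
    then show ?thesis unfolding has_exit_def p(1) by auto
  qed
qed

end

context leavitt_generated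
begin

text \<open>Follow the closed path up to the edge \<open>e\<close> that has the exit
  \<open>f\<close>, then leave along \<open>f\<close>. The ghost of this path cancels the common
  initial segment, and then the ghost of \<open>f\<close> meets \<open>e\<close>.\<close>

lemma exit_kills_closed_path:
  assumes "awalk v p v" "has_exit G p"
  obtains \<mu> w where "awalk v \<mu> w" "gpath v \<mu> \<otimes> rpath v p = \<zero>"
proof -
  obtain e f where ef: "e \<in> set p" "f \<in> arcs G" "tail G f = tail G e" "f \<noteq> e"
    using assms(2) unfolding has_exit_def by auto
  obtain p1 p2 where p: "p = p1 @ e # p2" using split_list[OF ef(1)] by blast
  have w: "awalk v p1 (tail G e)" "awalk (tail G e) (e # p2) v"
    using assms(1) unfolding p by (auto simp: awalk_append_split awalk_Cons_iff simp del: awalk_append_iff)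
  have f: "awalk (tail G e) [f] (head G f)" using ef by (auto simp: awalk_simps)
  have "gpath v (p1 @ [f]) \<otimes> rpath v p = gpath (tail G e) [f] \<otimes> (gpath v p1 \<otimes> rpath v p1) \<otimes> rpath (tail G e) (e # p2)"
    unfolding p gpath_append[OF w(1) f] rpath_append[OF w]
    using w f by (simp add: m_assoc m_closed del: rpath.simps gpath.simps)
  also have "\<dots> = gpath (tail G e) [f] \<otimes> rpath (tail G e) (e # p2)"
    using w gpath_P[OF f, of "tail G e"] unfolding gpath_rpath[OF w(1)] by auto
  also have "\<dots> = \<zero>" using gpath_rpath_Cons[OF f w(2)] ef by simp
  finally show ?thesis using that awalk_appendI[OF w(1) f] by blast
qed

abbreviation "closed_at v \<equiv> {p. p \<noteq> [] \<and> awalk v p v}"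

lemma rpath_image_closed: "X \<subseteq> closed_at v \<Longrightarrow> rpath v ` X \<subseteq> carrier A"
  by auto

text \<open>A nonzero value requires \<open>\<mu>\<close> and \<open>d @ \<mu>\<close> to be
  comparable. Since \<open>d\<close> is nonempty, \<open>\<mu>\<close> is the initial segment, and
  the rest is a closed path of the same length as \<open>d\<close>.\<close>

lemma closed_at_conjugate:
  assumes d: "d \<in> closed_at v" and m: "awalk v \<mu> w"
  shows "gpath v \<mu> \<otimes> rpath v d \<otimes> rpath v \<mu> = \<zero> \<or>
    (\<exists>r\<in>closed_at w. gpath v \<mu> \<otimes> rpath v d \<otimes> rpath v \<mu> = rpath w r)"
proof -
  have d': "awalk v d v" "d \<noteq> []" using d by auto
  have e: "gpath v \<mu> \<otimes> rpath v d \<otimes> rpath v \<mu> = gpath v \<mu> \<otimes> rpath v (d @ \<mu>)"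
    using d' m by (simp add: rpath_append[OF d'(1) m] m_assoc)
  from m awalk_appendI[OF d'(1) m] show ?thesis
  proof (cases rule: gpath_rpath_cases)
    case (2 r)
    then have "length r = length d" by (metis add_left_cancel add.commute length_append)
    then have r: "r \<in> closed_at w" using 2 d' by auto
    show ?thesis by (intro disjI2 bexI[OF _ r]) (use 2 e in simp)
  next
    case (3 r)
    then have "length \<mu> = length d + length \<mu> + length r" by (metis length_append)
    then show ?thesis using d' by simp
  qed (use e in auto)
qed

lemma closed_combination_conjugate:
  assumes x: "x \<in> lspan (rpath v ` X)" and X: "X \<subseteq> closed_at v" and m: "awalk v \<mu> w" and Y: "Y \<subseteq> closed_at w"
    and XY: "\<And>d. d \<in> X \<Longrightarrow> gpath v \<mu> \<otimes> rpath v d \<otimes> rpath v \<mu> \<in> insert \<zero> (rpath w ` Y)"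
  shows "gpath v \<mu> \<otimes> x \<otimes> rpath v \<mu> \<in> lspan (rpath w ` Y)"
proof -
  let ?Z = "(\<lambda>d. gpath v \<mu> \<otimes> rpath v d) ` X"
  have Z: "?Z \<subseteq> carrier A" using X m by (auto simp: m_closed)
  have "gpath v \<mu> \<otimes> x \<in> lspan ?Z"
    by (rule lspan_mult_left[OF rpath_image_closed[OF X] Z _ _ x]) (use m Z in \<open>auto intro: lspan_base\<close>)
  then show ?thesis
  proof (rule lspan_mult_right[OF Z rpath_image_closed[OF Y], rotated 2])
    show "t \<otimes> rpath v \<mu> \<in> lspan (rpath w ` Y)" if "t \<in> ?Z" for t
      using that XY lspan.zero lspan_base[OF rpath_image_closed[OF Y]] by fastforce
  qed (use m in auto)
qed

text \<open>An exit of a closed path \<open>\<gamma>\<close> at \<open>v\<close> yields a path \<open>\<mu>\<close> with \<open>\<mu>\<^sup>* \<gamma> = 0\<close>, and conjugation by \<open>\<mu>\<close> turns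
  the other closed paths at \<open>v\<close> into closed paths or \<open>0\<close>; so the number of terms decreases.\<close>

lemma closed_combination_killed_finite:
  assumes L: "condition_L G" and "finite X" "card X \<le> n" "X \<subseteq> closed_at v" "v \<in> verts G" "x \<in> lspan (rpath v ` X)"
  shows "\<exists>\<mu> w. awalk v \<mu> w \<and> gpath v \<mu> \<otimes> x \<otimes> rpath v \<mu> = \<zero>"
  using assms(2-)
proof (induction n arbitrary: v X x)
  case 0
  then have "x = \<zero>" by (simp add: lspan_empty)
  then show ?case using 0 by (intro exI[of _ "[]"] exI[of _ v]) (simp add: awalk_simps zero_mult)
next
  case (Suc n)
  show ?case
  proof (cases "X = {}")
    case True
    then have "x = \<zero>" using Suc.prems by (simp add: lspan_empty)
    then show ?thesis using Suc.prems by (intro exI[of _ "[]"] exI[of _ v]) (simp add: awalk_simps zero_mult)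
  next
    case False
    then obtain \<gamma> where \<gamma>: "\<gamma> \<in> X" by blast
    then have \<gamma>c: "awalk v \<gamma> v" "\<gamma> \<noteq> []" using Suc.prems by auto
    then obtain \<mu> w where \<mu>: "awalk v \<mu> w" "gpath v \<mu> \<otimes> rpath v \<gamma> = \<zero>"
      using exit_kills_closed_path condition_L_closed_path_exit[OF L] closed_pathI by metis
    have X': "X - {\<gamma>} \<subseteq> closed_at v" using Suc.prems by auto
    have ins: "rpath v ` X = insert (rpath v \<gamma>) (rpath v ` (X - {\<gamma>}))" using \<gamma> by auto
    obtain c y where y: "x = c \<odot> rpath v \<gamma> \<oplus> y" "y \<in> lspan (rpath v ` (X - {\<gamma>}))"
      using lspan_insertE[of "rpath v \<gamma>" "rpath v ` (X - {\<gamma>})" x] Suc.prems(5) rpath_image_closed[OF Suc.prems(3)]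
      unfolding ins by metis
    have yc: "y \<in> carrier A" using y lspan_closed[OF rpath_image_closed[OF X']] by auto
    have "gpath v \<mu> \<otimes> x = c \<odot> (gpath v \<mu> \<otimes> rpath v \<gamma>) \<oplus> gpath v \<mu> \<otimes> y"
      unfolding y(1) using yc \<mu> \<gamma>c by (simp add: r_distr smult_mult_r smult_closed)
    then have xy: "gpath v \<mu> \<otimes> x = gpath v \<mu> \<otimes> y" using \<mu> yc by (simp add: smult_zero_right m_closed)
    let ?f = "\<lambda>d. gpath v \<mu> \<otimes> rpath v d \<otimes> rpath v \<mu>"
    have "\<forall>d\<in>X. \<exists>r. ?f d \<noteq> \<zero> \<longrightarrow> r \<in> closed_at w \<and> ?f d = rpath w r"
      using closed_at_conjugate[OF _ \<mu>(1)] Suc.prems(3) by blast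
    from bchoice[OF this]
    obtain g where g: "\<And>d. d \<in> X \<Longrightarrow> ?f d \<noteq> \<zero> \<Longrightarrow> g d \<in> closed_at w \<and> ?f d = rpath w (g d)"
      by blast
    \<comment> \<open>Some conjugates vanish and several may coincide; with \<open>\<gamma>\<close>
      already removed, at most \<open>n\<close> closed paths remain.\<close>
    define Y where "Y = g ` {d \<in> X - {\<gamma>}. ?f d \<noteq> \<zero>}"
    have Y: "Y \<subseteq> closed_at w" "finite Y" using g Suc.prems unfolding Y_def by auto
    have "card Y \<le> card (X - {\<gamma>})"
      unfolding Y_def using Suc.prems
      by (intro order_trans[OF card_image_le] card_mono) auto
    then have cY: "card Y \<le> n" using Suc.prems \<gamma> by (simp add: card_Diff_singleton)
    have "?f d \<in> insert \<zero> (rpath w ` Y)" if d: "d \<in> X - {\<gamma>}" for d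
    proof (cases "?f d = \<zero>")
      case False
      then have "g d \<in> Y" "?f d = rpath w (g d)" using d g unfolding Y_def by auto
      then show ?thesis by (metis imageI insertCI)
    qed simp
    then have "gpath v \<mu> \<otimes> y \<otimes> rpath v \<mu> \<in> lspan (rpath w ` Y)"
      by (rule closed_combination_conjugate[OF y(2) X' \<mu>(1) Y(1)])
    then obtain \<mu>' w' where \<mu>': "awalk w \<mu>' w'" "gpath w \<mu>' \<otimes> (gpath v \<mu> \<otimes> y \<otimes> rpath v \<mu>) \<otimes> rpath w \<mu>' = \<zero>"
      using Suc.IH[OF Y(2) cY Y(1)] awalk_last_in_verts[OF \<mu>(1)] by blast
    have "gpath v (\<mu> @ \<mu>') \<otimes> x \<otimes> rpath v (\<mu> @ \<mu>') = \<zero>"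
      unfolding gpath_append[OF \<mu>(1) \<mu>'(1)] rpath_append[OF \<mu>(1) \<mu>'(1)]
      using \<mu>' \<mu>(1) yc xy Suc.prems(5) lspan_closed[OF rpath_image_closed[OF Suc.prems(3)]]
      by (auto simp: m_assoc m_closed)
    then show ?thesis using awalk_appendI[OF \<mu>(1) \<mu>'(1)] by blast
  qed
qed

lemma closed_combination_killed:
  assumes "condition_L G" "v \<in> verts G" "x \<in> lspan (rpath v ` closed_at v)"
  obtains \<mu> w where "awalk v \<mu> w" "gpath v \<mu> \<otimes> x \<otimes> rpath v \<mu> = \<zero>"
proof -
  obtain F where F: "finite F" "F \<subseteq> rpath v ` closed_at v" "x \<in> lspan F"
    using lspan_finite[OF assms(3)] .
  obtain X where X: "X \<subseteq> closed_at v" "finite X" "F = rpath v ` X"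
    using finite_subset_image[OF F(1,2)] by blast
  then have "x \<in> lspan (rpath v ` X)" using F by simp
  then show ?thesis using closed_combination_killed_finite[OF assms(1) X(2) order_refl X(1) assms(2)] that by blast
qed

section \<open>Combinations of real paths, and the reduction theorem\<close>

definition real_elements :: "'v \<Rightarrow> 'a set" where
  "real_elements w = lspan {rpath u p | u p. awalk u p w}"

lemma rpaths_closed: "{rpath u p | u p. awalk u p w} \<subseteq> carrier A"
  by auto

lemma real_elements_closed: "real_elements w \<subseteq> carrier A"
  unfolding real_elements_def by (rule lspan_closed[OF rpaths_closed])

text \<open>The ghost of a shortest path in a minimal support turns this path into the vertex
  \<open>w\<close> and any other one into \<open>\<zero>\<close> or a nonempty closed path at
  \<open>w\<close>.\<close>

lemma real_leading_term:
  assumes a: "a \<in> real_elements w" "a \<noteq> \<zero>"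
  obtains u p c x where "awalk u p w" "c \<noteq> 0" "x \<in> lspan (rpath w ` closed_at w)"
    "gpath u p \<otimes> a = c \<odot> P w \<oplus> x"
proof -
  let ?D = "{\<pi>. awalk (fst \<pi>) (snd \<pi>) w}" and ?r = "\<lambda>\<pi>. rpath (fst \<pi>) (snd \<pi>)"
  have D: "{rpath u p | u p. awalk u p w} = ?r ` ?D" unfolding image_def by auto
  have cl: "?r ` X \<subseteq> carrier A" if "X \<subseteq> ?D" for X using that by auto
  obtain F where F: "finite F" "F \<subseteq> ?r ` ?D" "a \<in> lspan F"
    using lspan_finite[OF a(1)[unfolded real_elements_def D]] .
  obtain T0 where "T0 \<subseteq> ?D" "finite T0" "F = ?r ` T0"
    using finite_subset_image[OF F(1,2)] by blast
  \<comment> \<open>Minimal cardinality of the support replaces linear independence: a vanishing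
    coefficient would allow a smaller support.\<close>
  define supp where "supp X \<longleftrightarrow> finite X \<and> X \<subseteq> ?D \<and> a \<in> lspan (?r ` X)" for X
  have "supp T0" using F \<open>T0 \<subseteq> ?D\<close> \<open>finite T0\<close> \<open>F = ?r ` T0\<close> unfolding supp_def by simp
  from ex_has_least_nat[of supp, OF this, of card]
  obtain T where "supp T" and T_min: "\<And>X. supp X \<Longrightarrow> card T \<le> card X" by blast
  then have T: "finite T" "T \<subseteq> ?D" "a \<in> lspan (?r ` T)" unfolding supp_def by blast+
  have "T \<noteq> {}" using T(3) a(2) by (auto simp: lspan_empty)
  then obtain \<pi>0 where "\<pi>0 \<in> T" by blast
  from ex_has_least_nat[of "\<lambda>\<pi>. \<pi> \<in> T", OF this, of "\<lambda>\<pi>. length (snd \<pi>)"]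
  obtain \<pi> where \<pi>: "\<pi> \<in> T" "\<And>\<pi>'. \<pi>' \<in> T \<Longrightarrow> length (snd \<pi>) \<le> length (snd \<pi>')"
    by blast
  obtain u p where up: "\<pi> = (u, p)" by fastforce
  have p: "awalk u p w" using \<pi>(1) T(2) up by auto
  have ins: "?r ` T = insert (rpath u p) (?r ` (T - {\<pi>}))" using \<pi>(1) up by force
  have T': "T - {\<pi>} \<subseteq> ?D" using T by auto
  obtain c y where y: "a = c \<odot> rpath u p \<oplus> y" "y \<in> lspan (?r ` (T - {\<pi>}))"
    by (rule lspan_insertE[OF cl[OF T(2), unfolded ins] T(3)[unfolded ins]])
  have yc: "y \<in> carrier A" using y lspan_closed[OF cl[OF T']] by auto
  have "c \<noteq> 0"
  proof
    assume "c = 0"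
    then have "a \<in> lspan (?r ` (T - {\<pi>}))" using y yc p by (simp add: smult_zero_left)
    then have "card T \<le> card (T - {\<pi>})" using T(1) T' by (intro T_min) (simp add: supp_def)
    then show False using T(1) \<pi>(1) by (metis card_Diff1_less not_less)
  qed
  moreover have "gpath u p \<otimes> a = c \<odot> P w \<oplus> gpath u p \<otimes> y"
    unfolding y(1) using yc p by (simp add: r_distr smult_mult_r smult_closed gpath_rpath)
  moreover have "gpath u p \<otimes> y \<in> lspan (rpath w ` closed_at w)"
  proof (rule lspan_mult_left[OF cl[OF T'] rpath_image_closed _ _ y(2)])
    show "gpath u p \<otimes> t \<in> lspan (rpath w ` closed_at w)" if t: "t \<in> ?r ` (T - {\<pi>})" for t
    proof -
      obtain u' p' where t': "(u', p') \<in> T" "(u', p') \<noteq> (u, p)" "t = rpath u' p'"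
      proof -
        obtain \<pi>' where "\<pi>' \<in> T - {\<pi>}" "t = ?r \<pi>'" using t by blast
        then show ?thesis using up by (intro that[of "fst \<pi>'" "snd \<pi>'"]) simp_all
      qed
      then have p': "awalk u' p' w" "length p \<le> length p'" using T \<pi>(2)[OF t'(1)] up by auto
      from p p'(1) show ?thesis
      proof (cases rule: gpath_rpath_cases)
        case (2 r)
        then have "r \<in> closed_at w" using t' by auto
        then show ?thesis using 2 t' by (auto intro!: lspan_base rpath_image_closed)
      next
        \<comment> \<open>By the choice of \<open>p\<close> as a shortest path, \<open>r\<close> is
          empty; then both paths coincide, which is excluded.\<close>
        case (3 r)
        then show ?thesis using t' p' by auto
      qed (use t' lspan.zero in auto)
    qed
  qed (use p in auto)
  ultimately show ?thesis using that p by blast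
qed

text \<open>The additional path \<open>q\<close> makes the result show also that a nonzero real
  element ending at \<open>w\<close> is not annihilated by an edge leaving \<open>w\<close>. Both
  \<open>q\<close> empty and \<open>q\<close> a single edge are used.\<close>

lemma real_reduction:
  assumes L: "condition_L G" and a: "a \<in> real_elements w" "a \<noteq> \<zero>" and q: "awalk w q w'"
  obtains b d c z where "b \<in> carrier A" "d \<in> carrier A" "c \<noteq> 0" "z \<in> verts G" "b \<otimes> (a \<otimes> rpath w q) \<otimes> d = c \<odot> P z"
proof -
  obtain u p c x where l: "awalk u p w" "c \<noteq> 0" "x \<in> lspan (rpath w ` closed_at w)" "gpath u p \<otimes> a = c \<odot> P w \<oplus> x"
    using real_leading_term[OF a] .
  have ac: "a \<in> carrier A" using a real_elements_closed by auto
  have xc: "x \<in> carrier A" using l(3) lspan_closed[OF rpath_image_closed] by blast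
  have conj: "gpath v \<mu> \<otimes> (c \<odot> P v \<oplus> t) \<otimes> rpath v \<mu> = c \<odot> P v' \<oplus> gpath v \<mu> \<otimes> t \<otimes> rpath v \<mu>"
    if "awalk v \<mu> v'" "t \<in> carrier A" for v \<mu> v' t
  proof -
    have v: "v \<in> verts G" using that by auto
    then show ?thesis
      using that gpath_P[OF that(1) v] by (simp add: r_distr l_distr smult_mult_l smult_mult_r smult_closed m_closed gpath_rpath)
  qed
  define x' where "x' = gpath w q \<otimes> x \<otimes> rpath w q"
  have "x' \<in> lspan (rpath w' ` closed_at w')"
    unfolding x'_def
    by (rule closed_combination_conjugate[OF l(3) order_refl q order_refl])
      (use closed_at_conjugate[OF _ q] in blast)
  moreover from this have x'c: "x' \<in> carrier A" using lspan_closed[OF rpath_image_closed] by blast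
  moreover have w': "w' \<in> verts G" using q by auto
  ultimately obtain \<mu> z where \<mu>: "awalk w' \<mu> z" "gpath w' \<mu> \<otimes> x' \<otimes> rpath w' \<mu> = \<zero>"
    using closed_combination_killed[OF L, of w' x'] by blast
  let ?b = "gpath w' \<mu> \<otimes> (gpath w q \<otimes> gpath u p)"
  have "?b \<otimes> (a \<otimes> rpath w q) \<otimes> rpath w' \<mu> = gpath w' \<mu> \<otimes> (gpath w q \<otimes> (gpath u p \<otimes> a) \<otimes> rpath w q) \<otimes> rpath w' \<mu>"
    using ac q l(1) \<mu>(1) by (simp add: m_assoc m_closed)
  also have "gpath w q \<otimes> (gpath u p \<otimes> a) \<otimes> rpath w q = c \<odot> P w' \<oplus> x'"
    unfolding l(4) conj[OF q xc] x'_def ..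
  also have "gpath w' \<mu> \<otimes> (c \<odot> P w' \<oplus> x') \<otimes> rpath w' \<mu> = c \<odot> P z"
    unfolding conj[OF \<mu>(1) x'c] using \<mu> by (auto simp: smult_closed)
  finally show ?thesis
    using that[of ?b "rpath w' \<mu>"] l \<mu>(1) q by (auto simp: m_closed)
qed

text \<open>The part of the vertex \<open>w\<close> not covered by the edges in \<open>F\<close>.
  For a breaking vertex and its edges ending outside \<open>H\<close> it is the image of
  \<open>breaking_element\<close>.\<close>

definition cutoff :: "'v \<Rightarrow> 'e set \<Rightarrow> 'a" where
  "cutoff w F = P w \<ominus> (\<Oplus>e\<in>F. S e \<otimes> T e)"

text \<open>All clauses are proved in a single induction on \<open>F\<close>: adding an edge
  subtracts one projection, and the clauses about the previous stage evaluate the products with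
  it.\<close>

lemma cutoff_props:
  assumes "finite F" "F \<subseteq> out_arcs G w" "w \<in> verts G"
  shows "cutoff w F \<in> carrier A \<and> P w \<otimes> cutoff w F = cutoff w F \<and> cutoff w F \<otimes> P w = cutoff w F \<and>
    (\<forall>f\<in>F. T f \<otimes> cutoff w F = \<zero> \<and> cutoff w F \<otimes> S f = \<zero>) \<and>
    (\<forall>f\<in>out_arcs G w - F. cutoff w F \<otimes> S f = S f \<and> T f \<otimes> cutoff w F = T f) \<and>
    (\<forall>a\<in>carrier A. a \<otimes> P w = a \<and> (\<forall>e\<in>F. a \<otimes> S e = \<zero>) \<longrightarrow> a \<otimes> cutoff w F = a)"
  using assms(1,2)
proof (induction F rule: finite_induct)
  case empty
  have "cutoff w {} = P w" using assms(3) by (simp add: cutoff_def a_minus_def)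
  then show ?case using assms(3) P_S T_P by (auto simp: P_P)
next
  case (insert e F)
  define q where "q = cutoff w F"
  have q: "q \<in> carrier A" "P w \<otimes> q = q" "q \<otimes> P w = q" "\<And>f. f \<in> F \<Longrightarrow> T f \<otimes> q = \<zero> \<and> q \<otimes> S f = \<zero>"
    "\<And>f. f \<in> out_arcs G w \<Longrightarrow> f \<notin> F \<Longrightarrow> q \<otimes> S f = S f \<and> T f \<otimes> q = T f"
    "\<And>a. a \<in> carrier A \<Longrightarrow> a \<otimes> P w = a \<Longrightarrow> \<forall>e\<in>F. a \<otimes> S e = \<zero> \<Longrightarrow> a \<otimes> q = a"
    using insert unfolding q_def by auto
  have e: "e \<in> arcs G" "tail G e = w" "e \<in> out_arcs G w" using insert.prems by auto
  have F: "f \<in> arcs G" if "f \<in> F" for f using that insert.prems by auto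
  let ?q = "q \<ominus> S e \<otimes> T e"
  have sc: "(\<Oplus>e\<in>F. S e \<otimes> T e) \<in> carrier A" using F by (intro finsum_closed) auto
  have "(\<Oplus>e\<in>insert e F. S e \<otimes> T e) = S e \<otimes> T e \<oplus> (\<Oplus>e\<in>F. S e \<otimes> T e)"
    using insert.hyps e F by (intro finsum_insert) auto
  then have cut: "cutoff w (insert e F) = ?q"
    unfolding cutoff_def q_def using sc e assms(3) by (simp add: a_minus_def minus_add a_ac)
  have left: "b \<otimes> ?q = b \<otimes> q \<ominus> (b \<otimes> S e) \<otimes> T e" if "b \<in> carrier A" for b
    using that q(1) e by (simp add: diff_mult m_assoc)
  have right: "?q \<otimes> b = q \<otimes> b \<ominus> S e \<otimes> (T e \<otimes> b)" if "b \<in> carrier A" for b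
    using that q(1) e by (simp add: diff_mult m_assoc)
  have m0: "y \<ominus> \<zero> = y" if "y \<in> carrier A" for y using that by (simp add: a_minus_def)
  show ?case
    unfolding cut
  proof (intro conjI ballI impI)
    show "P w \<otimes> ?q = ?q" using left[of "P w"] q(2) e P_S[of e] assms(3) by simp
    show "?q \<otimes> P w = ?q" using right[of "P w"] q(3) e T_P[of e] assms(3) by simp
    show "T f \<otimes> ?q = \<zero>" if f: "f \<in> insert e F" for f
    proof (cases "f = e")
      case True
      then show ?thesis using left[of "T e"] e q(5)[of e] insert.hyps by (simp add: T_S P_T diff_eq_zero)
    next
      case False
      then show ?thesis using left[of "T f"] f F e q(4)[of f] by (simp add: T_S zero_mult diff_eq_zero)
    qed
    show "?q \<otimes> S f = \<zero>" if f: "f \<in> insert e F" for f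
    proof (cases "f = e")
      case True
      then show ?thesis using right[of "S e"] e q(5)[of e] insert.hyps by (simp add: T_S S_P diff_eq_zero)
    next
      case False
      then show ?thesis using right[of "S f"] f F e q(4)[of f] by (simp add: T_S zero_mult diff_eq_zero)
    qed
    show "?q \<otimes> S f = S f" if f: "f \<in> out_arcs G w - insert e F" for f
      using right[of "S f"] f e q(5)[of f] T_S[of e f] by (auto simp: zero_mult m0)
    show "T f \<otimes> ?q = T f" if f: "f \<in> out_arcs G w - insert e F" for f
      using left[of "T f"] f e q(5)[of f] T_S[of f e] by (auto simp: zero_mult m0)
    show "a \<otimes> ?q = a" if "a \<in> carrier A" "a \<otimes> P w = a \<and> (\<forall>e\<in>insert e F. a \<otimes> S e = \<zero>)" for a
      using left[OF that(1)] q(6)[OF that(1)] that e by (auto simp: zero_mult m0)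
    show "?q \<in> carrier A" using q e by simp
  qed
qed

text \<open>On multiplying by \<open>q\<close>, the condition \<open>P w \<otimes> q = q\<close>
  removes the monomials whose ghost path does not start at \<open>w\<close>, and
  \<open>T f \<otimes> q = \<zero>\<close> those whose ghost path starts with \<open>f\<close>. What
  remains are real paths ending at \<open>w\<close>; \<open>F\<close> collects the first edges of
  the ghost paths starting at \<open>w\<close>.\<close>

lemma real_part:
  assumes "x \<in> lspan (monomials (\<lambda>_ _ _ _. True))" and w: "w \<in> verts G"
  shows "\<exists>F a. finite F \<and> F \<subseteq> out_arcs G w \<and> a \<in> real_elements w \<and>
    (\<forall>q\<in>carrier A. P w \<otimes> q = q \<and> (\<forall>f\<in>F. T f \<otimes> q = \<zero>) \<longrightarrow> x \<otimes> q = a \<otimes> q)"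
  using assms(1)
proof induction
  case zero
  show ?case unfolding real_elements_def by (intro exI[of _ "{}"] exI[of _ \<zero>]) (simp add: lspan.zero)
next
  case (step t x c)
  have tc: "t \<in> carrier A" and xc: "x \<in> carrier A"
    using step monomials_closed lspan_closed[OF monomials_closed] by auto
  obtain F a where Fa: "finite F" "F \<subseteq> out_arcs G w" "a \<in> real_elements w"
    "\<And>q. q \<in> carrier A \<Longrightarrow> P w \<otimes> q = q \<Longrightarrow> \<forall>f\<in>F. T f \<otimes> q = \<zero> \<Longrightarrow> x \<otimes> q = a \<otimes> q"
    using step by blast
  have ac: "a \<in> carrier A" using Fa real_elements_closed by auto
  obtain u p v r z where t: "t = rpath u p \<otimes> gpath v r" "awalk u p z" "awalk v r z"
    using step(1) by (rule monomialsE)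
  have "\<exists>F' b. finite F' \<and> F' \<subseteq> out_arcs G w \<and> b \<in> real_elements w \<and>
    (\<forall>q\<in>carrier A. P w \<otimes> q = q \<and> (\<forall>f\<in>F'. T f \<otimes> q = \<zero>) \<longrightarrow> t \<otimes> q = b \<otimes> q)"
  proof (cases "v = w")
    case False
    have "t \<otimes> q = \<zero> \<otimes> q" if q: "q \<in> carrier A" "P w \<otimes> q = q" for q
    proof -
      have "t \<otimes> q = rpath u p \<otimes> ((gpath v r \<otimes> P w) \<otimes> q)" using t q w by (simp add: m_assoc m_closed)
      then show ?thesis using gpath_P[OF t(3) w] False q t by (auto simp: zero_mult)
    qed
    then show ?thesis unfolding real_elements_def by (intro exI[of _ "{}"] exI[of _ \<zero>]) (simp add: lspan.zero)
  next
    case v: True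
    show ?thesis
    proof (cases r)
      case Nil
      then have "t = rpath u p" "z = w" using t v w rpath_P[OF t(2) w] by (auto simp: awalk_simps)
      then have "t \<in> real_elements w" unfolding real_elements_def using t by (intro lspan_base rpaths_closed) auto
      then show ?thesis by (intro exI[of _ "{}"] exI[of _ t]) simp
    next
      case (Cons f r')
      then have f: "f \<in> out_arcs G w" "f \<in> arcs G" "awalk (head G f) r' z" using t(3) v by (auto simp: awalk_simps)
      have "t \<otimes> q = \<zero> \<otimes> q" if "q \<in> carrier A" "T f \<otimes> q = \<zero>" for q
        using that t Cons f by (simp add: m_assoc m_closed zero_mult)
      then show ?thesis unfolding real_elements_def
        using f by (intro exI[of _ "{f}"] exI[of _ \<zero>]) (simp add: lspan.zero)
    qed
  qed
  then obtain F' b where Fb: "finite F'" "F' \<subseteq> out_arcs G w" "b \<in> real_elements w"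
    "\<And>q. q \<in> carrier A \<Longrightarrow> P w \<otimes> q = q \<Longrightarrow> \<forall>f\<in>F'. T f \<otimes> q = \<zero> \<Longrightarrow> t \<otimes> q = b \<otimes> q"
    by blast
  have bc: "b \<in> carrier A" using Fb real_elements_closed by auto
  have "c \<odot> b \<oplus> a \<in> real_elements w"
    using Fa(3) Fb(3) unfolding real_elements_def by (intro lspan_add lspan_smult rpaths_closed)
  moreover have "(c \<odot> t \<oplus> x) \<otimes> q = (c \<odot> b \<oplus> a) \<otimes> q"
    if "q \<in> carrier A" "P w \<otimes> q = q" "\<forall>f\<in>F \<union> F'. T f \<otimes> q = \<zero>" for q
    using that Fa(4)[of q] Fb(4)[of q] tc xc ac bc by (simp add: l_distr smult_mult_l smult_closed)
  ultimately show ?case using Fa(1,2) Fb(1,2)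
    by (intro exI[of _ "F \<union> F'"] exI[of _ "c \<odot> b \<oplus> a"]) auto
qed

text \<open>The edge cancels against the first edge of a nonempty ghost path or annihilates it; an
  empty ghost path stays empty, and the edge joins the real path.\<close>

lemma short_monomials_S:
  assumes x: "x \<in> lspan (monomials (\<lambda>_ _ _ q. length q \<le> Suc n))" and e: "e \<in> arcs G"
  shows "x \<otimes> S e \<in> lspan (monomials (\<lambda>_ _ _ q. length q \<le> n))"
proof (rule lspan_mult_right[OF monomials_closed monomials_closed _ _ x])
  fix t assume "t \<in> monomials (\<lambda>_ _ _ q. length q \<le> Suc n)"
  then obtain u p v q w where t: "t = rpath u p \<otimes> gpath v q" "awalk u p w" "awalk v q w" "length q \<le> Suc n"
    by (rule monomialsE)
  have ew: "awalk (tail G e) [e] (head G e)" using e by (rule arc_implies_awalk)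
  have Se: "S e = rpath (tail G e) [e]" using e by (simp add: S_P)
  have tS: "t \<otimes> S e = rpath u p \<otimes> (gpath v q \<otimes> rpath (tail G e) [e])"
    unfolding t(1) Se using t(2,3) ew by (simp add: m_assoc del: rpath.simps)
  from t(3) ew show "t \<otimes> S e \<in> lspan (monomials (\<lambda>_ _ _ q. length q \<le> n))"
  proof (cases rule: gpath_rpath_cases)
    case 1
    then show ?thesis using tS t lspan.zero by (simp add: zero_mult)
  next
    case (2 r)
    have "t \<otimes> S e = rpath u (p @ r) \<otimes> gpath (head G e) []"
      unfolding tS 2(4) using t(2) 2(3) e by (simp add: rpath_append[OF t(2) 2(3)] rpath_P m_assoc)
    also have "\<dots> \<in> monomials (\<lambda>_ _ _ q. length q \<le> n)"
      using e by (intro monomialsI[OF awalk_appendI[OF t(2) 2(3)]]) (auto simp: awalk_simps)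
    finally show ?thesis by (rule lspan_base[OF monomials_closed])
  next
    case (3 r)
    have "t \<otimes> S e \<in> monomials (\<lambda>_ _ _ q. length q \<le> n)"
      unfolding tS 3(4) by (rule monomialsI[OF t(2) 3(3)]) (use t(4) 3(2) in auto)
    then show ?thesis by (rule lspan_base[OF monomials_closed])
  qed
qed (use e in simp)

text \<open>The obstacle to shortening ghosts by edges is a vertex \<open>w\<close> with aP(w)
  nonzero but killed by every edge leaving \<open>w\<close>. Such a \<open>w\<close> turns out to be
  a sink, and then aP(w) is itself a combination of real paths.\<close>

lemma reduction_to_vertex_short:
  assumes L: "condition_L G" and nz: "\<And>v. v \<in> verts G \<Longrightarrow> P v \<noteq> \<zero>"
    and a: "a \<in> lspan (monomials (\<lambda>_ _ _ q. length q \<le> n))" "a \<noteq> \<zero>"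
  shows "\<exists>b\<in>carrier A. \<exists>d\<in>carrier A. \<exists>c z. c \<noteq> 0 \<and> z \<in> verts G \<and> b \<otimes> a \<otimes> d = c \<odot> P z"
  using a
proof (induction n arbitrary: a)
  case 0
  have ac: "a \<in> carrier A" using 0 lspan_closed[OF monomials_closed] by blast
  obtain w where w: "w \<in> verts G" "a \<otimes> P w \<noteq> \<zero>" using exists_vertex_right[OF ac 0(2)] .
  have "a \<otimes> P w \<in> real_elements w"
    unfolding real_elements_def
  proof (rule lspan_mult_right[OF monomials_closed rpaths_closed _ _ 0(1)])
    fix t assume "t \<in> monomials (\<lambda>_ _ _ q. length q \<le> 0)"
    then obtain u p v z where t: "t = rpath u p \<otimes> gpath v []" "awalk u p z" "awalk v [] z"
      by (auto elim!: monomialsE)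
    then have "t = rpath u p" using rpath_P[OF t(2)] by (auto simp: awalk_simps)
    then have "t \<otimes> P w = (if w = z then rpath u p else \<zero>)" using rpath_P[OF t(2) w(1)] by simp
    then show "t \<otimes> P w \<in> lspan {rpath u p |u p. awalk u p w}"
      using t lspan_base[OF rpaths_closed] lspan.zero by auto
  qed (use w in auto)
  then obtain b d c z where *: "b \<in> carrier A" "d \<in> carrier A" "c \<noteq> 0" "z \<in> verts G"
    "b \<otimes> (a \<otimes> P w \<otimes> rpath w []) \<otimes> d = c \<odot> P z"
    using real_reduction[OF L _ w(2)] w(1) by (metis awalk_Nil_iff)
  then have "b \<otimes> a \<otimes> (P w \<otimes> d) = c \<odot> P z"
    using w(1) ac by (simp add: m_assoc m_closed) (simp add: m_assoc[symmetric] P_P)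
  then show ?case using * w(1) m_closed P_closed by blast
next
  case (Suc n)
  have ac: "a \<in> carrier A" using Suc.prems lspan_closed[OF monomials_closed] by blast
  obtain w where w: "w \<in> verts G" "a \<otimes> P w \<noteq> \<zero>" using exists_vertex_right[OF ac Suc.prems(2)] .
  show ?case
  proof (cases "\<exists>e\<in>out_arcs G w. a \<otimes> S e \<noteq> \<zero>")
    case True
    then obtain e where e: "e \<in> arcs G" "a \<otimes> S e \<noteq> \<zero>" by auto
    obtain b d c z where *: "b \<in> carrier A" "d \<in> carrier A" "c \<noteq> 0" "z \<in> verts G" "b \<otimes> (a \<otimes> S e) \<otimes> d = c \<odot> P z"
      using Suc.IH[OF short_monomials_S[OF Suc.prems(1) e(1)] e(2)] by blast
    then have "b \<otimes> a \<otimes> (S e \<otimes> d) = c \<odot> P z" using ac e by (simp add: m_assoc m_closed)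
    then show ?thesis using * e m_closed S_closed by blast
  next
    case False
    define x where "x = a \<otimes> P w"
    have xc: "x \<in> carrier A" and xP: "x \<otimes> P w = x" and x0: "x \<noteq> \<zero>"
      using ac w by (auto simp: x_def m_closed m_assoc P_P)
    have xS: "x \<otimes> S e = \<zero>" if "e \<in> out_arcs G w" for e
      using that ac w False P_S[of e] by (auto simp: x_def m_assoc)
    obtain F a0 where F: "finite F" "F \<subseteq> out_arcs G w" and a0: "a0 \<in> real_elements w"
      and xa: "\<And>q. q \<in> carrier A \<Longrightarrow> P w \<otimes> q = q \<Longrightarrow> \<forall>f\<in>F. T f \<otimes> q = \<zero> \<Longrightarrow> x \<otimes> q = a0 \<otimes> q"
      using real_part[OF _ w(1), of x] xc carrier_eq_lspan by blast
    have a0c: "a0 \<in> carrier A" using a0 real_elements_closed by auto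
    obtain q where q: "q \<in> carrier A" "P w \<otimes> q = q" "\<forall>f\<in>F. T f \<otimes> q = \<zero>"
      "\<And>f. f \<in> out_arcs G w - F \<Longrightarrow> q \<otimes> S f = S f"
      "\<And>a. a \<in> carrier A \<Longrightarrow> a \<otimes> P w = a \<Longrightarrow> \<forall>e\<in>F. a \<otimes> S e = \<zero> \<Longrightarrow> a \<otimes> q = a"
      using cutoff_props[OF F w(1)] by blast
    have "x \<otimes> q = x" using q(5)[OF xc xP] xS F(2) by blast
    then have a0q: "a0 \<otimes> q = x" using xa[OF q(1-3)] by simp
    then have a0n: "a0 \<noteq> \<zero>" using x0 q(1) zero_mult by auto
    \<comment> \<open>An edge \<open>f\<close> outside \<open>F\<close> is fixed by
      \<open>q\<close>, so \<open>a0\<close> times \<open>f\<close> equals \<open>x\<close> times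
      \<open>f\<close>, which is \<open>\<zero>\<close>. But real elements cannot be annihilated in
      this way.\<close>
    have sub: "out_arcs G w \<subseteq> F"
    proof (rule ccontr)
      assume "\<not> ?thesis"
      then obtain f where f: "f \<in> out_arcs G w - F" by blast
      then have fa: "f \<in> arcs G" "tail G f = w" by auto
      have "a0 \<otimes> S f = a0 \<otimes> q \<otimes> S f" using q(1) a0c fa by (simp add: m_assoc q(4)[OF f])
      then have z: "a0 \<otimes> rpath w [f] = \<zero>" using xS f a0q fa by (simp add: S_P)
      have "awalk w [f] (head G f)" using fa by (auto simp: awalk_simps)
      from real_reduction[OF L a0 a0n this] obtain b d c z where
        "b \<in> carrier A" "d \<in> carrier A" "c \<noteq> 0" "z \<in> verts G" "b \<otimes> (a0 \<otimes> rpath w [f]) \<otimes> d = c \<odot> P z"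
        by blast
      moreover from this have "c \<odot> P z = \<zero>" unfolding z by (simp add: zero_mult)
      ultimately have "P z = \<zero>" using smult_assoc[of "P z" "inverse c" c] by (simp add: smult_zero_right smult_one)
      then show False using nz \<open>z \<in> verts G\<close> by blast
    qed
    \<comment> \<open>Otherwise \<open>w\<close> is a finite emitter, and the sum relation expresses
      P(w) by edges that \<open>x\<close> kills.\<close>
    have "out_arcs G w = {}"
    proof (rule ccontr)
      assume "out_arcs G w \<noteq> {}"
      then have fe: "finite_emitter G w" unfolding finite_emitter_def using sub F w finite_subset by blast
      have "P w \<in> {y \<in> carrier A. x \<otimes> y = \<zero>}"
        by (rule P_in_subgroup[OF additive_subgroup_annihilator[OF xc] fe])
          (use xS xc in \<open>auto simp: m_assoc[symmetric] zero_mult\<close>)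
      then show False using xP x0 by simp
    qed
    then have "x \<otimes> P w = a0 \<otimes> P w" using xa[of "P w"] F w by (simp add: P_P)
    then obtain b d c z where *: "b \<in> carrier A" "d \<in> carrier A" "c \<noteq> 0" "z \<in> verts G"
      "b \<otimes> (x \<otimes> P w) \<otimes> d = c \<odot> P z"
      using real_reduction[OF L a0 a0n, of "[]" w] w(1) by (metis awalk_Nil_iff rpath.simps(1))
    have "x \<otimes> P w = a \<otimes> P w" by (simp add: xP) (simp add: x_def)
    then have "b \<otimes> a \<otimes> (P w \<otimes> d) = c \<odot> P z"
      using w(1) ac * by (simp add: m_assoc m_closed)
    then show ?thesis using * w(1) m_closed P_closed by blast
  qed
qed

theorem reduction_to_vertex:
  assumes "condition_L G" "\<And>v. v \<in> verts G \<Longrightarrow> P v \<noteq> \<zero>" "a \<in> carrier A" "a \<noteq> \<zero>"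
  obtains b d z where "b \<in> carrier A" "d \<in> carrier A" "z \<in> verts G" "b \<otimes> a \<otimes> d = P z"
proof -
  have "\<exists>n. a \<in> lspan (monomials (\<lambda>_ _ _ q. length q \<le> n))"
  proof -
    obtain X where X: "finite X" "X \<subseteq> monomials (\<lambda>_ _ _ _. True)" "a \<in> lspan X"
      using assms(3) lspan_finite carrier_eq_lspan by blast
    have "\<exists>n. X \<subseteq> monomials (\<lambda>_ _ _ q. length q \<le> n)"
      using X(1,2)
    proof (induction X rule: finite_induct)
      case (insert y X)
      then obtain n where n: "X \<subseteq> monomials (\<lambda>_ _ _ q. length q \<le> n)" by auto
      obtain u p v q w where y: "y = rpath u p \<otimes> gpath v q" "awalk u p w" "awalk v q w"
        using insert.prems by (auto elim: monomialsE)
      have "insert y X \<subseteq> monomials (\<lambda>_ _ _ r. length r \<le> max n (length q))"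
      proof
        fix x assume "x \<in> insert y X"
        then show "x \<in> monomials (\<lambda>_ _ _ r. length r \<le> max n (length q))"
        proof
          assume "x = y"
          then show ?thesis using y by (auto intro: monomialsI)
        next
          assume "x \<in> X"
          then obtain u' p' v' q' w' where "x = rpath u' p' \<otimes> gpath v' q'" "awalk u' p' w'" "awalk v' q' w'"
            "length q' \<le> n"
            by (elim monomialsE[OF subsetD[OF n]])
          then show ?thesis by (auto intro!: monomialsI)
        qed
      qed
      then show ?case by blast
    qed auto
    then show ?thesis using X(3) lspan_mono by blast
  qed
  then obtain b d c z where *: "b \<in> carrier A" "d \<in> carrier A" "c \<noteq> 0" "z \<in> verts G" "b \<otimes> a \<otimes> d = c \<odot> P z"
    using reduction_to_vertex_short[OF assms(1,2) _ assms(4)] by blast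
  have "(inverse c \<odot> b) \<otimes> a \<otimes> d = inverse c \<odot> (b \<otimes> a \<otimes> d)"
    using * assms(3) by (simp add: smult_mult_l smult_closed m_closed)
  also have "\<dots> = P z" using * smult_assoc[of "P z" "inverse c" c] by (simp add: smult_one)
  finally show ?thesis using that * smult_closed by blast
qed

end

section \<open>Purely infinite simple algebras generated by a Leavitt family\<close>

text \<open>Because u'u = e, the map from x to uxu' is multiplicative on the corner at e, and
  multiplying by u' and u on the two sides inverts it. It carries the pair \<open>s\<close>,
  \<open>t\<close> to the idempotent uu', which lies in every right ideal containing u.\<close>

lemma (in rng) infinite_idempotent_transfer:
  assumes e: "idempotent R e"
    and st: "s \<in> carrier R" "t \<in> carrier R" "e \<otimes> s = s" "s \<otimes> e = s" "e \<otimes> t = t" "t \<otimes> e = t"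
      "t \<otimes> s = e" "s \<otimes> t \<noteq> e"
    and u: "u \<in> carrier R" "u' \<in> carrier R" "u' \<otimes> u = e" "u \<otimes> e = u" "e \<otimes> u' = u'"
  shows "infinite_idempotent R (u \<otimes> u')"
proof -
  have ec: "e \<in> carrier R" and ee: "e \<otimes> e = e" using e by (auto simp: idempotent_def)
  note c = st(1,2) u(1,2) ec
  have mid: "(u \<otimes> x \<otimes> u') \<otimes> (u \<otimes> y \<otimes> u') = u \<otimes> (x \<otimes> y) \<otimes> u'"
    if "x \<in> carrier R" "y \<in> carrier R" "e \<otimes> y = y" for x y
  proof -
    have "(u \<otimes> x \<otimes> u') \<otimes> (u \<otimes> y \<otimes> u') = u \<otimes> x \<otimes> ((u' \<otimes> u) \<otimes> y) \<otimes> u'"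
      using that c by (simp add: m_assoc m_closed)
    then show ?thesis using that c u(3) by (simp add: m_assoc m_closed)
  qed
  have ue: "u \<otimes> u' = u \<otimes> e \<otimes> u'" by (simp add: u)
  show ?thesis
  proof (rule infinite_idempotentI)
    show "idempotent R (u \<otimes> u')" unfolding idempotent_def ue mid[OF ec ec ee] ee using c by (simp add: m_closed)
    show "u \<otimes> s \<otimes> u' \<in> carrier R" "u \<otimes> t \<otimes> u' \<in> carrier R" using c by (simp_all add: m_closed)
    show "(u \<otimes> u') \<otimes> (u \<otimes> s \<otimes> u') = u \<otimes> s \<otimes> u'" "(u \<otimes> u') \<otimes> (u \<otimes> t \<otimes> u') = u \<otimes> t \<otimes> u'"
      "(u \<otimes> s \<otimes> u') \<otimes> (u \<otimes> u') = u \<otimes> s \<otimes> u'" "(u \<otimes> t \<otimes> u') \<otimes> (u \<otimes> u') = u \<otimes> t \<otimes> u'"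
      unfolding ue using mid c st ee by simp_all
    show "(u \<otimes> t \<otimes> u') \<otimes> (u \<otimes> s \<otimes> u') = u \<otimes> u'" using mid[of t s] c st u by simp
    show "(u \<otimes> s \<otimes> u') \<otimes> (u \<otimes> t \<otimes> u') \<noteq> u \<otimes> u'"
    proof
      assume *: "(u \<otimes> s \<otimes> u') \<otimes> (u \<otimes> t \<otimes> u') = u \<otimes> u'"
      have "s \<otimes> t = (e \<otimes> s) \<otimes> (t \<otimes> e)" using st by simp
      also have "\<dots> = u' \<otimes> (u \<otimes> (s \<otimes> t) \<otimes> u') \<otimes> u"
        unfolding u(3)[symmetric] using c by (simp add: m_assoc m_closed)
      also have "u \<otimes> (s \<otimes> t) \<otimes> u' = u \<otimes> u'" using mid[of s t] c st * by simp
      also have "u' \<otimes> (u \<otimes> u') \<otimes> u = (u' \<otimes> u) \<otimes> (u' \<otimes> u)" using c by (simp add: m_assoc m_closed)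
      finally show False using u ee st by simp
    qed
  qed
qed

context leavitt_generated
begin

text \<open>The range vertex of an edge is the product of its ghost, its source vertex and the edge;
  this gives heredity. Saturation is the sum relation.\<close>

lemma ideal_vertices:
  assumes J: "two_sided_ideal J A"
  shows "hereditary G {v \<in> verts G. P v \<in> J}" "saturated G {v \<in> verts G. P v \<in> J}"
proof -
  have sub: "additive_subgroup J A" and m: "\<And>a x. a \<in> J \<Longrightarrow> x \<in> carrier A \<Longrightarrow> a \<otimes> x \<in> J \<and> x \<otimes> a \<in> J"
    using J unfolding two_sided_ideal_def by auto
  have "P (head G e) \<in> J" if "e \<in> arcs G" "P (tail G e) \<in> J" for e
    using that m[of "P (tail G e)" "S e"] m[of "S e" "T e"] by (simp add: P_S T_S)
  then show "hereditary G {v \<in> verts G. P v \<in> J}" unfolding hereditary_def by auto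
  have "P v \<in> J" if "finite_emitter G v" "head G ` out_arcs G v \<subseteq> {v \<in> verts G. P v \<in> J}" for v
  proof (rule P_in_subgroup[OF sub that(1)])
    fix e assume e: "e \<in> out_arcs G v"
    then have "head G e \<in> {v \<in> verts G. P v \<in> J}" using that(2) by blast
    then have "P (head G e) \<in> J" "e \<in> arcs G" using e by auto
    then show "S e \<otimes> T e \<in> J"
      using m[of "P (head G e)" "S e"] m[of "S e" "T e"] by (simp add: S_P)
  qed
  then show "saturated G {v \<in> verts G. P v \<in> J}" unfolding saturated_def finite_emitter_def by auto
qed

section \<open>Graph conditions that imply simplicity and pure infiniteness\<close>

lemma simple_of_graph:
  assumes L: "condition_L G" and nz: "\<And>v. v \<in> verts G \<Longrightarrow> P v \<noteq> \<zero>"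
    and triv: "\<And>X. hereditary G X \<Longrightarrow> saturated G X \<Longrightarrow> X = {} \<or> X = verts G" and ne: "verts G \<noteq> {}"
  shows "simple_rng A"
proof -
  have "J = carrier A" if J: "two_sided_ideal J A" "J \<noteq> {\<zero>}" for J
  proof -
    have sub: "additive_subgroup J A" and m: "\<And>a x. a \<in> J \<Longrightarrow> x \<in> carrier A \<Longrightarrow> a \<otimes> x \<in> J \<and> x \<otimes> a \<in> J"
      using J unfolding two_sided_ideal_def by auto
    then obtain a where a: "a \<in> J" "a \<noteq> \<zero>" "a \<in> carrier A" using J(2) additive_subgroupD(1,2)[OF sub] by blast
    obtain b d z where bdz: "b \<in> carrier A" "d \<in> carrier A" "z \<in> verts G" "b \<otimes> a \<otimes> d = P z"
      using reduction_to_vertex[OF L nz a(3,2)] by blast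
    then have "P z \<in> J" using m a by metis
    then have "{v \<in> verts G. P v \<in> J} = verts G" using triv[OF ideal_vertices[OF J(1)]] bdz(3) by auto
    then show ?thesis by (intro two_sided_ideal_P_eq_carrier[OF J(1)]) auto
  qed
  moreover obtain v where "v \<in> verts G" using ne by blast
  ultimately show ?thesis unfolding simple_rng_def using nz P_P P_closed by metis
qed

text \<open>The vertices from which no closed path can be reached form a hereditary and saturated
  set, and this set misses the base of \<open>c\<close>.\<close>

lemma connects_to_closed_path:
  assumes triv: "\<And>X. hereditary G X \<Longrightarrow> saturated G X \<Longrightarrow> X = {} \<or> X = verts G"
    and c: "closed_path G c" and v: "v \<in> verts G"
  shows "\<exists>p w q. awalk v p w \<and> q \<in> closed_at w"
proof -
  define X where "X = {v \<in> verts G. \<nexists>p w q. awalk v p w \<and> q \<in> closed_at w}"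
  have her: "hereditary G X"
    unfolding hereditary_def
  proof (intro conjI ballI impI)
    fix e assume e: "e \<in> arcs G" "tail G e \<in> X"
    have "\<not> (awalk (head G e) p w \<and> q \<in> closed_at w)" for p w q
    proof
      assume "awalk (head G e) p w \<and> q \<in> closed_at w"
      then have "awalk (tail G e) (e # p) w \<and> q \<in> closed_at w" using e by (auto simp: awalk_Cons_iff)
      then show False using e(2) unfolding X_def by blast
    qed
    then show "head G e \<in> X" unfolding X_def using e by auto
  qed (auto simp: X_def)
  have "v \<in> X" if fe: "finite_emitter G v" and h: "head G ` out_arcs G v \<subseteq> X" for v
  proof (rule ccontr)
    assume "v \<notin> X"
    then obtain p w q where p: "awalk v p w" "q \<in> closed_at w" using fe unfolding X_def finite_emitter_def by auto
    \<comment> \<open>Appending the closed path guarantees a first edge even if \<open>p\<close> is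
      empty.\<close>
    have "p @ q \<noteq> []" "awalk v (p @ q) w" using p by (auto intro: awalk_appendI simp del: awalk_append_iff)
    then obtain e r where r: "e \<in> out_arcs G v" "awalk (head G e) r w" by (cases "p @ q") (auto simp: awalk_Cons_iff)
    then have "head G e \<notin> X" using p(2) unfolding X_def by blast
    then show False using h r(1) by blast
  qed
  then have sat: "saturated G X" unfolding saturated_def by (auto simp: X_def)
  obtain u where "awalk u c u" "c \<noteq> []" using c unfolding closed_path_def by blast
  then have "u \<in> verts G" "u \<notin> X" unfolding X_def using awalk_Nil_iff[of u u] by auto
  then have "X = {}" using triv[OF her sat] by auto
  then show ?thesis using v unfolding X_def by blast
qed

text \<open>An exit gives \<open>\<mu>\<close> whose ghost annihilates the path \<open>q\<close>. If
  \<open>q\<close> times its ghost were the vertex, the ghost of \<open>\<mu>\<close> would be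
  \<open>\<zero>\<close>, and with it the vertex at the end of \<open>\<mu>\<close>.\<close>

lemma closed_path_infinite:
  assumes L: "condition_L G" and nz: "\<And>v. v \<in> verts G \<Longrightarrow> P v \<noteq> \<zero>" and q: "q \<in> closed_at w"
  shows "gpath w q \<otimes> rpath w q = P w" "rpath w q \<otimes> gpath w q \<noteq> P w"
proof -
  have q': "awalk w q w" "q \<noteq> []" using q by auto
  then have w: "w \<in> verts G" by auto
  show "gpath w q \<otimes> rpath w q = P w" by (rule gpath_rpath[OF q'(1)])
  obtain \<mu> z where \<mu>: "awalk w \<mu> z" "gpath w \<mu> \<otimes> rpath w q = \<zero>"
    using exit_kills_closed_path[OF q'(1) condition_L_closed_path_exit[OF L closed_pathI[OF q'(2,1)]]] .
  show "rpath w q \<otimes> gpath w q \<noteq> P w"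
  proof
    assume *: "rpath w q \<otimes> gpath w q = P w"
    have "gpath w \<mu> = gpath w \<mu> \<otimes> (rpath w q \<otimes> gpath w q)"
      unfolding * using gpath_P[OF \<mu>(1) w] by simp
    also have "\<dots> = \<zero>" using \<mu> q' by (simp add: m_assoc[symmetric] zero_mult)
    finally have "P z = \<zero>" using gpath_rpath[OF \<mu>(1)] \<mu> by (simp add: zero_mult)
    then show False using nz[of z] \<mu>(1) by auto
  qed
qed

text \<open>The reduction to a vertex multiplies a on both sides, whereas \<open>J\<close> absorbs
  factors only on the right. Interchanging the factors of u'(ay) = P(w) moves the left factor behind
  a, so the idempotent (ay)u' lies in \<open>J\<close> and inherits infiniteness from P(w).\<close>

lemma purely_infinite_of_graph:
  assumes L: "condition_L G" and nz: "\<And>v. v \<in> verts G \<Longrightarrow> P v \<noteq> \<zero>"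
    and triv: "\<And>X. hereditary G X \<Longrightarrow> saturated G X \<Longrightarrow> X = {} \<or> X = verts G"
    and c: "closed_path G c"
  shows "purely_infinite A"
  unfolding purely_infinite_def
proof (intro allI impI)
  fix J assume J: "right_ideal J A \<and> J \<noteq> {\<zero>}"
  then have sub: "additive_subgroup J A" and m: "\<And>a x. a \<in> J \<Longrightarrow> x \<in> carrier A \<Longrightarrow> a \<otimes> x \<in> J"
    unfolding right_ideal_def by auto
  obtain a where a: "a \<in> J" "a \<noteq> \<zero>" "a \<in> carrier A" using J additive_subgroupD(1,2)[OF sub] by blast
  obtain b d z where bdz: "b \<in> carrier A" "d \<in> carrier A" "z \<in> verts G" "b \<otimes> a \<otimes> d = P z"
    using reduction_to_vertex[OF L nz a(3,2)] by blast
  obtain p w q where p: "awalk z p w" and q: "q \<in> closed_at w"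
    using connects_to_closed_path[OF triv c bdz(3)] by blast
  have w: "w \<in> verts G" and q': "awalk w q w" using q by auto
  define u' where "u' = P w \<otimes> (gpath z p \<otimes> b)"
  define y where "y = d \<otimes> rpath z p"
  have cl: "u' \<in> carrier A" "y \<in> carrier A" using bdz p w by (simp_all add: u'_def y_def m_closed)
  have "u' \<otimes> (a \<otimes> y) = P w \<otimes> (gpath z p \<otimes> (b \<otimes> a \<otimes> d) \<otimes> rpath z p)"
    using bdz(1-3) p w a(3) by (simp add: u'_def y_def m_assoc m_closed)
  also have "\<dots> = P w"
    unfolding bdz(4) gpath_P[OF p bdz(3)] using w by (simp add: gpath_rpath[OF p] P_P)
  finally have e: "u' \<otimes> (a \<otimes> y) = P w" .
  have "infinite_idempotent A ((a \<otimes> y) \<otimes> u')"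
  proof (rule infinite_idempotent_transfer[where e = "P w"])
    show "idempotent A (P w)" using w by (simp add: idempotent_def P_P)
    show "P w \<otimes> rpath w q = rpath w q" "rpath w q \<otimes> P w = rpath w q"
      "P w \<otimes> gpath w q = gpath w q" "gpath w q \<otimes> P w = gpath w q"
      using q' w P_rpath[OF q' w] rpath_P[OF q' w] P_gpath[OF q' w] gpath_P[OF q' w] by auto
    show "P w \<otimes> u' = u'" using w bdz p by (simp add: u'_def m_assoc[symmetric] m_closed P_P)
    show "(a \<otimes> y) \<otimes> P w = a \<otimes> y" using w bdz p a(3) rpath_P[OF p w] by (simp add: y_def m_assoc m_closed)
  qed (use closed_path_infinite[OF L nz q] q' e cl a(3) in \<open>auto simp: m_closed\<close>)
  moreover have "(a \<otimes> y) \<otimes> u' \<in> J" using m a cl by blast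
  ultimately show "\<exists>a\<in>J. infinite_idempotent A a" by blast
qed

section \<open>Graph conditions forced by simplicity and pure infiniteness\<close>

text \<open>An idempotent \<open>q\<close> below a vertex behaves like a sink when all edges and
  ghosts there annihilate it: of all monomials only the vertex itself survives between two copies of
  \<open>q\<close>. The corner consists of multiples of \<open>q\<close> and is commutative.\<close>

lemma local_sink_zero:
  assumes simple: "simple_rng A" and pi: "purely_infinite A" and v: "v \<in> verts G"
    and q: "q \<in> carrier A" "q \<otimes> q = q" "P v \<otimes> q = q" "q \<otimes> P v = q"
    and e: "\<And>e. e \<in> out_arcs G v \<Longrightarrow> q \<otimes> S e = \<zero> \<and> T e \<otimes> q = \<zero>"
  shows "q = \<zero>"
proof (rule ccontr)
  assume nz: "q \<noteq> \<zero>"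
  have left: "q \<otimes> rpath u p = (if u = v \<and> p = [] then q else \<zero>)" if p: "awalk u p w" for u p w
  proof (cases "u = v")
    case True
    show ?thesis
    proof (cases p)
      case Nil
      then show ?thesis using True q by simp
    next
      case (Cons f p')
      then have f: "f \<in> out_arcs G v" "f \<in> arcs G" "awalk (head G f) p' w" using p True by (auto simp: awalk_Cons_iff)
      then have "q \<otimes> rpath u p = (q \<otimes> S f) \<otimes> rpath (head G f) p'" using q Cons by (simp add: m_assoc)
      then show ?thesis using e[OF f(1)] f Cons by (simp add: zero_mult)
    qed
  next
    case False
    have "q \<otimes> rpath u p = q \<otimes> (P v \<otimes> rpath u p)" using q v p by (simp add: m_assoc[symmetric])
    then show ?thesis using P_rpath[OF p v] False q by (auto simp: zero_mult)
  qed
  have right: "gpath u p \<otimes> q = (if u = v \<and> p = [] then q else \<zero>)" if p: "awalk u p w" for u p w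
  proof (cases "u = v")
    case True
    show ?thesis
    proof (cases p)
      case Nil
      then show ?thesis using True q by simp
    next
      case (Cons f p')
      then have f: "f \<in> out_arcs G v" "f \<in> arcs G" "awalk (head G f) p' w" using p True by (auto simp: awalk_Cons_iff)
      then have "gpath u p \<otimes> q = gpath (head G f) p' \<otimes> (T f \<otimes> q)" using q Cons by (simp add: m_assoc)
      then show ?thesis using e[OF f(1)] f Cons by (simp add: zero_mult)
    qed
  next
    case False
    have "gpath u p \<otimes> q = (gpath u p \<otimes> P v) \<otimes> q" using q v p by (simp add: m_assoc)
    then show ?thesis using gpath_P[OF p v] False q by (auto simp: zero_mult)
  qed
  have qc: "{q} \<subseteq> carrier A" using q by auto
  have corner: "q \<otimes> x \<otimes> q \<in> lspan {q}" if "x \<in> carrier A" for x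
  proof -
    let ?M = "monomials (\<lambda>_ _ _ _. True)"
    have Y: "(\<otimes>) q ` ?M \<subseteq> carrier A" using q(1) monomials_closed by (blast intro: m_closed)
    have "q \<otimes> x \<in> lspan ((\<otimes>) q ` ?M)"
      by (rule lspan_mult_left[OF monomials_closed Y q(1)]) (use that carrier_eq_lspan Y in \<open>auto intro!: lspan_base\<close>)
    then show ?thesis
    proof (rule lspan_mult_right[OF Y qc q(1), rotated])
      fix t assume "t \<in> (\<otimes>) q ` ?M"
      then obtain m where m: "m \<in> ?M" "t = q \<otimes> m" by blast
      obtain u p u' p' w where p: "m = rpath u p \<otimes> gpath u' p'" "awalk u p w" "awalk u' p' w"
        using m(1) by (rule monomialsE)
      have "t \<otimes> q = (q \<otimes> rpath u p) \<otimes> (gpath u' p' \<otimes> q)"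
        unfolding m(2) p(1) using p q(1) by (simp add: m_assoc m_closed)
      also have "\<dots> = \<zero> \<or> \<dots> = q" unfolding left[OF p(2)] right[OF p(3)] using q by (auto simp: zero_mult)
      finally show "t \<otimes> q \<in> lspan {q}" using lspan.zero lspan_base[OF qc] by auto
    qed
  qed
  have "\<not> purely_infinite A"
  proof (rule simple_commutative_corner_not_purely_infinite[OF simple _ nz])
    show "idempotent A q" using q by (simp add: idempotent_def)
    show "(q \<otimes> x \<otimes> q) \<otimes> (q \<otimes> y \<otimes> q) = (q \<otimes> y \<otimes> q) \<otimes> (q \<otimes> x \<otimes> q)"
      if "x \<in> carrier A" "y \<in> carrier A" for x y
      by (rule lspan_commute[OF qc _ corner[OF that(1)] corner[OF that(2)]]) auto
  qed
  then show False using pi by simp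
qed

text \<open>Edges in \<open>D\<close> are cancelled by the cutoff, and the others are
  \<open>\<zero>\<close> together with their ranges. In a quotient this makes the breaking elements
  vanish.\<close>

lemma cutoff_zero:
  assumes simple: "simple_rng A" and pi: "purely_infinite A" and v: "v \<in> verts G"
    and D: "finite D" "D \<subseteq> out_arcs G v" and z: "\<And>e. e \<in> out_arcs G v - D \<Longrightarrow> P (head G e) = \<zero>"
  shows "cutoff v D = \<zero>"
proof (rule local_sink_zero[OF simple pi v])
  note c = cutoff_props[OF D v]
  show cc: "cutoff v D \<in> carrier A" "P v \<otimes> cutoff v D = cutoff v D" "cutoff v D \<otimes> P v = cutoff v D"
    using c by blast+
  show e: "cutoff v D \<otimes> S e = \<zero> \<and> T e \<otimes> cutoff v D = \<zero>" if "e \<in> out_arcs G v" for e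
  proof (cases "e \<in> D")
    case True
    then show ?thesis using c by blast
  next
    case False
    then have "P (head G e) = \<zero>" "e \<in> arcs G" using z that by auto
    then have "S e = \<zero>" "T e = \<zero>" by (metis S_P P_T S_closed T_closed zero_mult)+
    then show ?thesis using cc by (simp add: zero_mult)
  qed
  then have "\<forall>e\<in>D. cutoff v D \<otimes> S e = \<zero>" using D by blast
  then show "cutoff v D \<otimes> cutoff v D = cutoff v D" using c by blast
qed

text \<open>Without an exit each vertex of the closed path emits exactly one edge. Paths along it
  are then invertible and determined by their length, so the corner at \<open>v\<close> is
  commutative, as for Laurent polynomials.\<close>

lemma condition_L_necessary:
  assumes simple: "simple_rng A" and pi: "purely_infinite A" and nz: "\<And>v. v \<in> verts G \<Longrightarrow> P v \<noteq> \<zero>"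
  shows "condition_L G"
  unfolding condition_L_def
proof (intro allI impI, rule ccontr)
  fix p assume p: "simple_closed_path G p" and ex: "\<not> has_exit G p"
  obtain v where v: "awalk v p v" "p \<noteq> []" using p unfolding simple_closed_path_def closed_path_def by blast
  have vv: "v \<in> verts G" using v by auto
  define C where "C = tail G ` set p"
  have vC: "v \<in> C" using v unfolding C_def by (cases p) (auto simp: awalk_Cons_iff)
  have next_arc: "\<exists>e. out_arcs G w = {e} \<and> head G e \<in> C" and ret: "\<exists>\<tau>. awalk w \<tau> v" if wC: "w \<in> C" for w
  proof -
    obtain e where e: "e \<in> set p" "tail G e = w" using wC unfolding C_def by blast
    obtain p1 p2 where p12: "p = p1 @ e # p2" using split_list[OF e(1)] by blast
    have w: "awalk w (e # p2) v"
      using v(1) e(2) unfolding p12 by (auto simp: awalk_append_split awalk_Cons_iff simp del: awalk_append_iff)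
    then show "\<exists>\<tau>. awalk w \<tau> v" by blast
    have "head G e \<in> C"
    proof (cases p2)
      case Nil
      then show ?thesis using w vC by (auto simp: awalk_simps)
    next
      case (Cons f p3)
      then have "tail G f = head G e" "f \<in> set p" using w p12 by (auto simp: awalk_simps)
      then show ?thesis unfolding C_def by (metis imageI)
    qed
    moreover have "out_arcs G w = {e}" using ex e w unfolding has_exit_def by (auto simp: awalk_Cons_iff)
    ultimately show "\<exists>e. out_arcs G w = {e} \<and> head G e \<in> C" by blast
  qed
  \<comment> \<open>The sum relation at such a vertex has a single summand, so the real path times
    its ghost collapses edge by edge to the vertex.\<close>
  have rg: "x \<in> C \<and> rpath w q \<otimes> gpath w q = P w" if "w \<in> C" "awalk w q x" for w q x
    using that
  proof (induction q arbitrary: w)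
    case Nil
    then show ?case by (auto simp: awalk_simps P_P)
  next
    case (Cons e q)
    then have e: "e \<in> arcs G" "tail G e = w" "awalk (head G e) q x" by (auto simp: awalk_simps)
    obtain f where f: "out_arcs G w = {f}" "head G f \<in> C" using next_arc[OF Cons.prems(1)] by blast
    have "e \<in> out_arcs G w" using e by simp
    then have "e = f" unfolding f(1) by simp
    then have out: "out_arcs G w = {e}" "head G e \<in> C" using f by simp_all
    have "finite_emitter G w" using out(1) e unfolding finite_emitter_def by auto
    then have Pw: "P w = S e \<otimes> T e" using P_sum[of w] e(1) by (simp add: out(1))
    have "rpath w (e # q) \<otimes> gpath w (e # q) = S e \<otimes> (rpath (head G e) q \<otimes> gpath (head G e) q) \<otimes> T e"
      using e by (simp add: m_assoc m_closed)
    also have "\<dots> = S e \<otimes> T e" using Cons.IH[OF out(2) e(3)] e by (simp add: S_P)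
    finally show ?case using Cons.IH[OF out(2) e(3)] Pw by simp
  qed
  have uniq: "q = q'" if "w \<in> C" "awalk w q x" "awalk w q' x'" "length q = length q'" for w q q' x x'
    using that
  proof (induction q arbitrary: w q')
    case (Cons e q)
    obtain f r where q': "q' = f # r" using Cons.prems(4) by (cases q') auto
    obtain e' where e': "out_arcs G w = {e'}" "head G e' \<in> C" using next_arc[OF Cons.prems(1)] by blast
    have "e \<in> out_arcs G w" "f \<in> out_arcs G w" using Cons.prems q' by (auto simp: awalk_simps)
    then have "e = f" "head G e \<in> C" using e'(2) unfolding e'(1) by simp_all
    then show ?case using Cons.IH[of "head G e" r] Cons.prems q' by (auto simp: awalk_simps)
  qed auto
  \<comment> \<open>The two concatenations start at \<open>v\<close> and have the same
    length.\<close>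
  have comm_path: "q @ r = r @ q" if "awalk v q v" "awalk v r v" for q r
    using uniq[OF vC awalk_appendI[OF that] awalk_appendI[OF that(2,1)]] by simp
  have rr: "rpath v q \<otimes> rpath v r = rpath v r \<otimes> rpath v q" if "awalk v q v" "awalk v r v" for q r
    using rpath_append[OF that] rpath_append[OF that(2,1)] comm_path[OF that] by simp
  have gg: "gpath v q \<otimes> gpath v r = gpath v r \<otimes> gpath v q" if "awalk v q v" "awalk v r v" for q r
    using gpath_append[OF that] gpath_append[OF that(2,1)] comm_path[OF that] by simp
  have gr: "gpath v r \<otimes> rpath v q = rpath v q \<otimes> gpath v r" if q: "awalk v q v" "awalk v r v" for q r
  proof -
    have "gpath v r \<otimes> rpath v q = gpath v r \<otimes> (rpath v q \<otimes> (rpath v r \<otimes> gpath v r))"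
      using rg[OF vC q(2)] rpath_P[OF q(1) vv] by simp
    also have "\<dots> = gpath v r \<otimes> (rpath v q \<otimes> rpath v r) \<otimes> gpath v r" using q by (simp add: m_assoc m_closed)
    also have "\<dots> = (gpath v r \<otimes> rpath v r) \<otimes> rpath v q \<otimes> gpath v r"
      unfolding rr[OF q] using q by (simp add: m_assoc m_closed)
    also have "\<dots> = rpath v q \<otimes> gpath v r" using P_rpath[OF q(1) vv] by (simp add: gpath_rpath[OF q(2)])
    finally show ?thesis .
  qed
  define M where "M = {rpath v q \<otimes> gpath v r | q r. awalk v q v \<and> awalk v r v}"
  have Mc: "M \<subseteq> carrier A" unfolding M_def by (auto simp: m_closed)
  have M_comm: "s \<otimes> t = t \<otimes> s" if st: "s \<in> M" "t \<in> M" for s t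
  proof -
    obtain q r where s: "s = rpath v q \<otimes> gpath v r" "awalk v q v" "awalk v r v" using st(1) unfolding M_def by blast
    obtain q' r' where t: "t = rpath v q' \<otimes> gpath v r'" "awalk v q' v" "awalk v r' v" using st(2) unfolding M_def by blast
    have "s \<otimes> t = rpath v q \<otimes> (gpath v r \<otimes> rpath v q') \<otimes> gpath v r'"
      unfolding s(1) t(1) using s t by (simp add: m_assoc m_closed)
    also have "\<dots> = (rpath v q \<otimes> rpath v q') \<otimes> (gpath v r \<otimes> gpath v r')"
      unfolding gr[OF t(2) s(3)] using s t by (simp add: m_assoc m_closed)
    also have "\<dots> = (rpath v q' \<otimes> rpath v q) \<otimes> (gpath v r' \<otimes> gpath v r)"
      unfolding rr[OF s(2) t(2)] gg[OF s(3) t(3)] ..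
    also have "\<dots> = rpath v q' \<otimes> (rpath v q \<otimes> gpath v r') \<otimes> gpath v r"
      using s t by (simp add: m_assoc m_closed)
    also have "\<dots> = t \<otimes> s"
      unfolding gr[OF s(2) t(3), symmetric] s(1) t(1) using s t by (simp add: m_assoc m_closed)
    finally show ?thesis .
  qed
  have corner: "P v \<otimes> x \<otimes> P v \<in> lspan M" if "x \<in> carrier A" for x
  proof -
    let ?M = "monomials (\<lambda>_ _ _ _. True)"
    have Y: "(\<otimes>) (P v) ` ?M \<subseteq> carrier A" using P_closed[OF vv] monomials_closed by (blast intro: m_closed)
    have "P v \<otimes> x \<in> lspan ((\<otimes>) (P v) ` ?M)"
      by (rule lspan_mult_left[OF monomials_closed Y P_closed[OF vv]])
        (use that carrier_eq_lspan Y in \<open>auto intro!: lspan_base\<close>)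
    then show ?thesis
    proof (rule lspan_mult_right[OF Y Mc P_closed[OF vv], rotated])
      fix t assume "t \<in> (\<otimes>) (P v) ` ?M"
      then obtain m where m: "m \<in> ?M" "t = P v \<otimes> m" by blast
      obtain u q u' r w where q: "m = rpath u q \<otimes> gpath u' r" "awalk u q w" "awalk u' r w"
        using m(1) by (rule monomialsE)
      have t: "t \<otimes> P v = (P v \<otimes> rpath u q) \<otimes> (gpath u' r \<otimes> P v)"
        unfolding m(2) q(1) using q vv by (simp add: m_assoc m_closed)
      show "t \<otimes> P v \<in> lspan M"
      proof (cases "u = v \<and> u' = v")
        case True
        then have q': "awalk v q w" "awalk v r w" using q by auto
        \<comment> \<open>The common range \<open>w\<close> need not be \<open>v\<close>. Since
          \<open>\<tau>\<close> times its ghost is P(w), both paths can be prolonged by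
          \<open>\<tau>\<close> to closed paths at \<open>v\<close>.\<close>
        have w: "w \<in> C" using rg[OF vC q'(1)] by simp
        obtain \<tau> where \<tau>: "awalk w \<tau> v" using ret[OF w] by blast
        have "t \<otimes> P v = rpath v q \<otimes> gpath v r"
          using t True P_rpath[OF q(2) vv] gpath_P[OF q(3) vv] by simp
        also have "\<dots> = rpath v q \<otimes> (rpath w \<tau> \<otimes> gpath w \<tau>) \<otimes> gpath v r"
          using rg[OF w \<tau>] rpath_P[OF q'(1), of w] awalk_last_in_verts[OF q'(1)] by simp
        also have "\<dots> = rpath v (q @ \<tau>) \<otimes> gpath v (r @ \<tau>)"
          unfolding rpath_append[OF q'(1) \<tau>] gpath_append[OF q'(2) \<tau>] using q' \<tau> by (simp add: m_assoc m_closed)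
        also have "\<dots> \<in> M" unfolding M_def using awalk_appendI[OF q'(1) \<tau>] awalk_appendI[OF q'(2) \<tau>] by blast
        finally show ?thesis by (rule lspan_base[OF Mc])
      next
        case False
        then have "t \<otimes> P v = \<zero>"
          unfolding t using P_rpath[OF q(2) vv] gpath_P[OF q(3) vv] q vv by (auto simp: zero_mult)
        then show ?thesis by (simp add: lspan.zero)
      qed
    qed
  qed
  have "\<not> purely_infinite A"
  proof (rule simple_commutative_corner_not_purely_infinite[OF simple _ nz[OF vv]])
    show "idempotent A (P v)" using vv by (simp add: idempotent_def P_P)
    show "(P v \<otimes> x \<otimes> P v) \<otimes> (P v \<otimes> y \<otimes> P v) = (P v \<otimes> y \<otimes> P v) \<otimes> (P v \<otimes> x \<otimes> P v)"
      if "x \<in> carrier A" "y \<in> carrier A" for x y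
      by (rule lspan_commute[OF Mc M_comm corner[OF that(1)] corner[OF that(2)]])
  qed
  then show False using pi by simp
qed

lemma acyclic_distinct:
  assumes "\<nexists>c. closed_path G c" "awalk u p w" shows "distinct p"
proof (rule ccontr)
  assume "\<not> distinct p"
  then obtain xs ys zs e where p: "p = xs @ [e] @ ys @ [e] @ zs" using not_distinct_decomp by blast
  have "awalk (tail G e) (e # ys) (tail G e)"
    using assms(2) unfolding p by (auto simp: awalk_append_split awalk_Cons_iff simp del: awalk_append_iff)
  then have "closed_path G (e # ys)" by (intro closed_pathI) auto
  then show False using assms(1) by blast
qed

lemma closed_path_necessary:
  assumes simple: "simple_rng A" and pi: "purely_infinite A"
  shows "\<exists>c. closed_path G c"
proof (rule ccontr)
  assume acyclic: "\<nexists>c. closed_path G c"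
  have "right_ideal (carrier A) A" by (rule right_idealI) (auto simp: m_closed)
  moreover have "carrier A \<noteq> {\<zero>}" using simple zero_mult unfolding simple_rng_def by force
  ultimately obtain a where a: "infinite_idempotent A a"
    using pi unfolding purely_infinite_def by blast
  then have ac: "a \<in> carrier A" "a \<otimes> a = a" unfolding infinite_idempotent_def idempotent_def by auto
  obtain s t where st: "s \<in> carrier A" "t \<in> carrier A" "a \<otimes> s = s" "s \<otimes> a = s" "a \<otimes> t = t" "t \<otimes> a = t"
    "t \<otimes> s = a" "s \<otimes> t \<noteq> a" using infinite_idempotentE[OF a] .
  obtain W F where WF: "finite W" "finite F" "a \<in> lspan (monomials (inside W F))" using inside_finite[OF ac(1)] .
  obtain W' F' where WF': "finite W'" "finite F'" "s \<in> lspan (monomials (inside W' F'))" using inside_finite[OF st(1)] .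
  let ?X = "monomials (inside (W \<union> W') (F \<union> F'))"
  \<comment> \<open>Without closed paths no edge repeats, so only finitely many paths use the edges
    occurring in a and \<open>s\<close>.\<close>
  let ?D = "{p. set p \<subseteq> F \<union> F' \<and> distinct p}"
  have "finite ?D" using WF(2) WF'(2) by (intro finite_subset_distinct) auto
  have "?X \<subseteq> (\<lambda>((u, p), (v, q)). rpath u p \<otimes> gpath v q) ` (((W \<union> W') \<times> ?D) \<times> ((W \<union> W') \<times> ?D))"
  proof
    fix x assume "x \<in> ?X"
    then obtain u p v q w where x: "x = rpath u p \<otimes> gpath v q" "awalk u p w" "awalk v q w"
      "inside (W \<union> W') (F \<union> F') u p v q" by (rule monomialsE)
    then show "x \<in> (\<lambda>((u, p), (v, q)). rpath u p \<otimes> gpath v q) ` (((W \<union> W') \<times> ?D) \<times> ((W \<union> W') \<times> ?D))"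
      using acyclic_distinct[OF acyclic x(2)] acyclic_distinct[OF acyclic x(3)]
      by (intro image_eqI[of _ _ "((u, p), (v, q))"]) auto
  qed
  then have X: "finite ?X" by (rule finite_subset) (use WF(1) WF'(1) \<open>finite ?D\<close> in blast)
  have "monomials (inside W F) \<subseteq> ?X" "monomials (inside W' F') \<subseteq> ?X"
    unfolding monomials_def by blast+
  then have "a \<in> lspan ?X" "s \<in> lspan ?X" using WF(3) WF'(3) lspan_mono by blast+
  then have "s \<otimes> t = a"
    using finite_dimensional_left_inverse[OF X monomials_closed monomials_mult] st ac by blast
  then show False using st by simp
qed

end

section \<open>Quotients\<close>

text \<open>The algebra quotient and \<open>A Quot I\<close> are different records, but pure
  infiniteness and simplicity depend only on the four fields on which they agree.\<close>

lemma purely_infinite_simple_cong: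
  fixes R :: "('a, 'm) ring_scheme" and R' :: "('a, 'n) ring_scheme"
  assumes "carrier R = carrier R'" "mult R = mult R'" "add R = add R'" "zero R = zero R'"
  shows "purely_infinite_simple R = purely_infinite_simple R'"
proof -
  have add: "additive_subgroup I R = additive_subgroup I R'" for I
    using assms by (simp add: additive_subgroup_def subgroup_def m_inv_def)
  have ideals: "right_ideal I R = right_ideal I R'" "two_sided_ideal I R = two_sided_ideal I R'" for I
    unfolding right_ideal_def two_sided_ideal_def add by (simp_all add: assms)
  have lcos: "a <#\<^bsub>R\<^esub> carrier R = a <#\<^bsub>R'\<^esub> carrier R'" for a
    by (simp add: l_coset_def assms)
  have sum: "set_add R M N = set_add R' M N" for M N
    by (simp add: set_add_def set_mult_def assms)
  have "infinite_idempotent R a = infinite_idempotent R' a" for a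
    unfolding infinite_idempotent_def idempotent_def proper_direct_summand_def right_module_iso_def
      ideals lcos sum by (simp add: assms)
  then show ?thesis
    unfolding purely_infinite_simple_def purely_infinite_def simple_rng_def ideals by (simp add: assms)
qed

lemma (in alg_quot) purely_infinite_simple_quotient_algebra:
  "purely_infinite_simple (quotient_algebra A I) = purely_infinite_simple (A Quot I)"
  by (rule purely_infinite_simple_cong) (simp_all add: quotient_algebra_def ring.defs module.defs)

locale alg_hom = A: nonunital_algebra A + B: nonunital_algebra B
  for A :: "('k::field, 'a, 'm) module_scheme" and B :: "('k, 'b, 'n) module_scheme" +
  fixes h :: "'a \<Rightarrow> 'b"
  assumes hom: "algebra_hom A B h"
begin

lemma h_closed [simp]: "x \<in> carrier A \<Longrightarrow> h x \<in> carrier B"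
  and h_add: "x \<in> carrier A \<Longrightarrow> y \<in> carrier A \<Longrightarrow> h (x \<oplus>\<^bsub>A\<^esub> y) = h x \<oplus>\<^bsub>B\<^esub> h y"
  and h_mult: "x \<in> carrier A \<Longrightarrow> y \<in> carrier A \<Longrightarrow> h (x \<otimes>\<^bsub>A\<^esub> y) = h x \<otimes>\<^bsub>B\<^esub> h y"
  and h_smult: "x \<in> carrier A \<Longrightarrow> h (c \<odot>\<^bsub>A\<^esub> x) = c \<odot>\<^bsub>B\<^esub> h x"
  using hom unfolding algebra_hom_def by auto

lemma h_zero: "h \<zero>\<^bsub>A\<^esub> = \<zero>\<^bsub>B\<^esub>"
  using h_add[of "\<zero>\<^bsub>A\<^esub>" "\<zero>\<^bsub>A\<^esub>"] B.add.l_cancel_one[of "h \<zero>\<^bsub>A\<^esub>" "h \<zero>\<^bsub>A\<^esub>"] by simp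

lemma h_minus: "x \<in> carrier A \<Longrightarrow> h (\<ominus>\<^bsub>A\<^esub> x) = \<ominus>\<^bsub>B\<^esub> h x"
  using h_add[of "\<ominus>\<^bsub>A\<^esub> x" x] by (simp add: A.l_neg h_zero B.minus_equality)

lemma h_diff: "x \<in> carrier A \<Longrightarrow> y \<in> carrier A \<Longrightarrow> h (x \<ominus>\<^bsub>A\<^esub> y) = h x \<ominus>\<^bsub>B\<^esub> h y"
  by (simp add: a_minus_def h_add h_minus)

lemma h_finsum: "(\<And>i. i \<in> F \<Longrightarrow> f i \<in> carrier A) \<Longrightarrow> h (\<Oplus>\<^bsub>A\<^esub>i\<in>F. f i) = (\<Oplus>\<^bsub>B\<^esub>i\<in>F. h (f i))"
proof (induction F rule: infinite_finite_induct)
  case (insert i F)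
  then show ?case by (simp add: h_add A.finsum_closed Pi_def)
qed (simp_all add: h_zero)

lemma preimage_ideal:
  assumes "two_sided_ideal J B" shows "two_sided_ideal {x \<in> carrier A. h x \<in> J} A"
proof -
  have sub: "additive_subgroup J B" and m: "\<And>a x. a \<in> J \<Longrightarrow> x \<in> carrier B \<Longrightarrow> a \<otimes>\<^bsub>B\<^esub> x \<in> J \<and> x \<otimes>\<^bsub>B\<^esub> a \<in> J"
    using assms unfolding two_sided_ideal_def by auto
  show ?thesis
    by (rule A.two_sided_idealI)
      (use m B.additive_subgroupD[OF sub] in \<open>auto simp: h_zero h_add h_minus h_mult A.m_closed\<close>)
qed

lemma image_ideal:
  assumes J: "two_sided_ideal J A" and surj: "h ` carrier A = carrier B"
  shows "two_sided_ideal (h ` J) B"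
proof -
  have sub: "additive_subgroup J A" and m: "\<And>a x. a \<in> J \<Longrightarrow> x \<in> carrier A \<Longrightarrow> a \<otimes>\<^bsub>A\<^esub> x \<in> J \<and> x \<otimes>\<^bsub>A\<^esub> a \<in> J"
    using J unfolding two_sided_ideal_def by auto
  note s = A.additive_subgroupD[OF sub]
  show ?thesis
  proof (rule B.two_sided_idealI)
    show "h ` J \<subseteq> carrier B" using s(1) by auto
    show "\<zero>\<^bsub>B\<^esub> \<in> h ` J" using s(2) by (simp add: h_zero[symmetric])
    show "x \<oplus>\<^bsub>B\<^esub> y \<in> h ` J" if xy: "x \<in> h ` J" "y \<in> h ` J" for x y
    proof -
      obtain a b where ab: "a \<in> J" "b \<in> J" "x = h a" "y = h b" using xy by blast
      then have "a \<in> carrier A" "b \<in> carrier A" using s(1) by auto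
      then have "x \<oplus>\<^bsub>B\<^esub> y = h (a \<oplus>\<^bsub>A\<^esub> b)" unfolding ab(3,4) by (rule h_add[symmetric])
      then show ?thesis using s(3)[OF ab(1,2)] by simp
    qed
    show "\<ominus>\<^bsub>B\<^esub> x \<in> h ` J" if x: "x \<in> h ` J" for x
    proof -
      obtain a where a: "a \<in> J" "x = h a" using x by blast
      then have "a \<in> carrier A" using s(1) by auto
      then have "\<ominus>\<^bsub>B\<^esub> x = h (\<ominus>\<^bsub>A\<^esub> a)" unfolding a(2) by (rule h_minus[symmetric])
      then show ?thesis using s(4)[OF a(1)] by simp
    qed
    show "x \<otimes>\<^bsub>B\<^esub> r \<in> h ` J" "r \<otimes>\<^bsub>B\<^esub> x \<in> h ` J" if xr: "x \<in> h ` J" "r \<in> carrier B" for x r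
    proof -
      obtain a b where ab: "a \<in> J" "b \<in> carrier A" "x = h a" "r = h b" using xr surj by blast
      then have "a \<in> carrier A" using s(1) by auto
      then have "h (a \<otimes>\<^bsub>A\<^esub> b) = x \<otimes>\<^bsub>B\<^esub> r" "h (b \<otimes>\<^bsub>A\<^esub> a) = r \<otimes>\<^bsub>B\<^esub> x"
        unfolding ab(3,4) using ab(2) h_mult by blast+
      then show "x \<otimes>\<^bsub>B\<^esub> r \<in> h ` J" "r \<otimes>\<^bsub>B\<^esub> x \<in> h ` J" using m[OF ab(1,2)] by (metis image_eqI)+
    qed
  qed
qed

lemma leavitt_generated_image:
  assumes L: "leavitt_generated A G P S T" and surj: "h ` carrier A = carrier B"
  shows "leavitt_generated B G (\<lambda>v. h (P v)) (\<lambda>e. h (S e)) (\<lambda>e. h (T e))"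
proof -
  interpret L: leavitt_generated A G P S T by fact
  show ?thesis
  proof (intro leavitt_generated.intro leavitt_generated_axioms.intro B.nonunital_algebra_axioms L.wf_digraph_axioms)
    show "leavitt_family G B (\<lambda>v. h (P v)) (\<lambda>e. h (S e)) (\<lambda>e. h (T e))"
      unfolding leavitt_family_def
    proof (intro conjI ballI allI impI)
      show "h (P v) = (\<Oplus>\<^bsub>B\<^esub>e\<in>out_arcs G v. h (S e) \<otimes>\<^bsub>B\<^esub> h (T e))" if v: "finite_emitter G v" for v
      proof -
        have "h (P v) = (\<Oplus>\<^bsub>B\<^esub>e\<in>out_arcs G v. h (S e \<otimes>\<^bsub>A\<^esub> T e))"
          unfolding L.P_sum[OF v] by (rule h_finsum) auto
        also have "\<dots> = (\<Oplus>\<^bsub>B\<^esub>e\<in>out_arcs G v. h (S e) \<otimes>\<^bsub>B\<^esub> h (T e))"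
          by (rule B.finsum_cong') (auto simp: h_mult B.m_closed)
        finally show ?thesis .
      qed
    qed (auto simp: h_mult[symmetric] L.P_P L.P_S L.S_P L.P_T L.T_P L.T_S h_zero)
  next
    fix Q
    assume Q: "Q \<subseteq> carrier B" "(\<lambda>v. h (P v)) ` verts G \<subseteq> Q" "(\<lambda>e. h (S e)) ` arcs G \<subseteq> Q"
      "(\<lambda>e. h (T e)) ` arcs G \<subseteq> Q" "\<zero>\<^bsub>B\<^esub> \<in> Q" "\<And>x y. x \<in> Q \<Longrightarrow> y \<in> Q \<Longrightarrow> x \<oplus>\<^bsub>B\<^esub> y \<in> Q"
      "\<And>x y. x \<in> Q \<Longrightarrow> y \<in> Q \<Longrightarrow> x \<otimes>\<^bsub>B\<^esub> y \<in> Q" "\<And>c x. x \<in> Q \<Longrightarrow> c \<odot>\<^bsub>B\<^esub> x \<in> Q"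
    have "carrier A \<subseteq> {x \<in> carrier A. h x \<in> Q}"
    proof (rule L.generated)
      fix x y c assume xy: "x \<in> {x \<in> carrier A. h x \<in> Q}" "y \<in> {x \<in> carrier A. h x \<in> Q}"
      show "x \<oplus>\<^bsub>A\<^esub> y \<in> {x \<in> carrier A. h x \<in> Q}" using xy Q(6)[of "h x" "h y"] by (simp add: h_add)
      show "x \<otimes>\<^bsub>A\<^esub> y \<in> {x \<in> carrier A. h x \<in> Q}" using xy Q(7)[of "h x" "h y"] by (simp add: h_mult A.m_closed)
    next
      fix x c assume x: "x \<in> {x \<in> carrier A. h x \<in> Q}"
      show "c \<odot>\<^bsub>A\<^esub> x \<in> {x \<in> carrier A. h x \<in> Q}" using x Q(8)[of "h x"] by (simp add: h_smult A.smult_closed)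
    qed (use Q(2-5) in \<open>auto simp: h_zero\<close>)
    then show "carrier B \<subseteq> Q" unfolding surj[symmetric] by auto
  qed
qed

end

lemma (in alg_quot) quotient_hom:
  "alg_hom A (quotient_algebra A I) (\<lambda>x. I +> x)" "(\<lambda>x. I +> x) ` carrier A = carrier (quotient_algebra A I)"
  "x \<in> carrier A \<Longrightarrow> I +> x = \<zero>\<^bsub>quotient_algebra A I\<^esub> \<longleftrightarrow> x \<in> I"
proof -
  show "alg_hom A (quotient_algebra A I) (\<lambda>x. I +> x)"
    by (intro alg_hom.intro alg_hom_axioms.intro quot_algebra nonunital_algebra_axioms)
      (auto simp: algebra_hom_def quot_simps)
  show "(\<lambda>x. I +> x) ` carrier A = carrier (quotient_algebra A I)" by (simp add: quot_simps)
  show "I +> x = \<zero>\<^bsub>quotient_algebra A I\<^esub> \<longleftrightarrow> x \<in> I" if "x \<in> carrier A"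
    using a_rcos_self[OF that] a_rcos_const[of x] unfolding quot_simps(2) by auto
qed

lemma (in nonunital_algebra) ideal_generated_ideal:
  assumes X: "X \<subseteq> carrier A"
  shows "two_sided_ideal (ideal_generated A X) A" "X \<subseteq> ideal_generated A X"
proof -
  let ?F = "{I. two_sided_ideal I A \<and> X \<subseteq> I}"
  have c: "carrier A \<in> ?F" using X by (auto intro!: two_sided_idealI simp: m_closed)
  have F: "additive_subgroup J A" "\<And>a x. a \<in> J \<Longrightarrow> x \<in> carrier A \<Longrightarrow> a \<otimes> x \<in> J \<and> x \<otimes> a \<in> J" if "J \<in> ?F" for J
    using that unfolding two_sided_ideal_def by auto
  show "two_sided_ideal (ideal_generated A X) A"
    unfolding ideal_generated_def
  proof (rule two_sided_idealI)
    show "\<Inter>?F \<subseteq> carrier A" using c by blast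
    show "\<zero> \<in> \<Inter>?F" using additive_subgroupD(2) F(1) by blast
    show "x \<oplus> y \<in> \<Inter>?F" if "x \<in> \<Inter>?F" "y \<in> \<Inter>?F" for x y
      using that additive_subgroupD(3) F(1) by blast
    show "\<ominus> x \<in> \<Inter>?F" if "x \<in> \<Inter>?F" for x
      using that additive_subgroupD(4) F(1) by blast
    show "x \<otimes> r \<in> \<Inter>?F" "r \<otimes> x \<in> \<Inter>?F" if "x \<in> \<Inter>?F" "r \<in> carrier A" for x r
      using that F(2) by blast+
  qed
  show "X \<subseteq> ideal_generated A X" unfolding ideal_generated_def by blast
qed

lemma ideal_generated_least: "two_sided_ideal J R \<Longrightarrow> X \<subseteq> J \<Longrightarrow> ideal_generated R X \<subseteq> J"
  unfolding ideal_generated_def by blast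

lemma leavitt_path_algebra_generated:
  assumes wf: "wf_digraph E"
  shows "leavitt_generated (leavitt_path_algebra E :: ('k::field, ('k, 'v, 'e) lpa_free set) module) E
    (lpa_vertex E) (lpa_edge E) (lpa_ghost E)"
proof (intro leavitt_generated.intro leavitt_generated_axioms.intro lpa_algebra[OF wf] wf lpa_family[OF wf])
  let ?F = "free_algebra (lpa_gens E) :: ('k, ('k, 'v, 'e) lpa_free) module"
  let ?J = "leavitt_relation_ideal E :: ('k, 'v, 'e) lpa_free set"
  let ?L = "leavitt_path_algebra E :: ('k, ('k, 'v, 'e) lpa_free set) module"
  fix Q :: "('k, 'v, 'e) lpa_free set set"
  assume Q: "Q \<subseteq> carrier ?L" "lpa_vertex E ` verts E \<subseteq> Q" "lpa_edge E ` arcs E \<subseteq> Q"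
    "lpa_ghost E ` arcs E \<subseteq> Q" "\<zero>\<^bsub>?L\<^esub> \<in> Q" and
    add: "\<And>x y. x \<in> Q \<Longrightarrow> y \<in> Q \<Longrightarrow> x \<oplus>\<^bsub>?L\<^esub> y \<in> Q" and
    mult: "\<And>x y. x \<in> Q \<Longrightarrow> y \<in> Q \<Longrightarrow> x \<otimes>\<^bsub>?L\<^esub> y \<in> Q" and
    smult: "\<And>c x. x \<in> Q \<Longrightarrow> c \<odot>\<^bsub>?L\<^esub> x \<in> Q"
  interpret q: alg_quot ?F ?J by (rule lpa_quot[OF wf])
  interpret h: alg_hom ?F ?L "\<lambda>x. ?J +>\<^bsub>?F\<^esub> x"
    unfolding leavitt_path_algebra_def by (rule q.quotient_hom(1))
  interpret e: free_ev ?L "lpa_gens E" "lpa_class E"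
    by unfold_locales
      (auto simp: lpa_class_def leavitt_path_algebra_def q.quot_simps generator_carrier)
  have gen: "?J +>\<^bsub>?F\<^esub> generator g \<in> Q" if "g \<in> lpa_gens E" for g
    using that Q(2-4) unfolding lpa_gens_def lpa_vertex_def lpa_edge_def lpa_ghost_def lpa_class_def by auto
  have word: "?J +>\<^bsub>?F\<^esub> Poly_Mapping.single (Word w) 1 \<in> Q" if "w \<noteq> []" "set w \<subseteq> lpa_gens E" for w
    using that
  proof (induction w rule: list_nonempty_induct)
    case (single g)
    then show ?case using gen[of g] by (simp add: generator_def)
  next
    case (cons g w)
    have "Poly_Mapping.single (Word (g # w)) (1::'k) = generator g \<otimes>\<^bsub>?F\<^esub> Poly_Mapping.single (Word w) 1"
      by (simp add: generator_def mult_single plus_free_monoid_def free_algebra_simps)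
    moreover have "generator g \<in> carrier ?F" using cons by (auto intro: generator_carrier)
    moreover have "Poly_Mapping.single (Word w) (1::'k) \<in> carrier ?F" using cons by (intro e.single_carrier) auto
    ultimately show ?case using mult[OF gen[of g] cons.IH] cons by (simp add: h.h_mult)
  qed
  have poly: "?J +>\<^bsub>?F\<^esub> p \<in> Q" if "p \<in> carrier ?F" for p
    using that
  proof (induction p rule: e.carrier_induct)
    case zero
    then show ?case using Q(5) h.h_zero by (simp add: free_algebra_simps)
  next
    case (add w c p)
    have w: "Poly_Mapping.single w (1::'k) \<in> carrier ?F" using add by (intro e.single_carrier)
    have "Poly_Mapping.single w c = c \<odot>\<^bsub>?F\<^esub> Poly_Mapping.single w 1" by (simp add: free_algebra_simps mult_single)
    then have "?J +>\<^bsub>?F\<^esub> (Poly_Mapping.single w c) \<in> Q"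
      using smult[OF word[of "letters w"]] add(1) h.h_smult[OF w] by simp
    moreover have "Poly_Mapping.single w c \<in> carrier ?F" using add by (intro e.single_carrier)
    ultimately show ?case
      using \<open>\<And>x y. x \<in> Q \<Longrightarrow> y \<in> Q \<Longrightarrow> x \<oplus>\<^bsub>?L\<^esub> y \<in> Q\<close> add(2,3) h.h_add by (simp add: free_algebra_simps)
  qed
  show "carrier ?L \<subseteq> Q" using poly by (auto simp: leavitt_path_algebra_def q.quot_simps)
qed

lemma quotient_graph_simps [simp]:
  "verts (quotient_graph E H) = verts E - H" "tail (quotient_graph E H) = tail E" "head (quotient_graph E H) = head E"
  "e \<in> arcs (quotient_graph E H) \<longleftrightarrow> e \<in> arcs E \<and> head E e \<in> verts E - H"
  by (simp_all add: quotient_graph_def)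

lemma out_arcs_quotient_graph:
  assumes "wf_digraph E"
  shows "out_arcs (quotient_graph E H) v = {e \<in> out_arcs E v. head E e \<notin> H}"
  using assms unfolding out_arcs_def by (auto simp: wf_digraph_def)

lemma wf_quotient_graph:
  assumes "wf_digraph E" "hereditary E H" shows "wf_digraph (quotient_graph E H)"
  using assms unfolding wf_digraph_def hereditary_def by auto

context leavitt_generated
begin

text \<open>Only the sum relation changes on passing to the quotient graph. At a finite emitter of
  \<open>G\<close> the omitted summands are \<open>\<zero>\<close>; at an infinite emitter that
  becomes finite, a breaking vertex, the vanishing cutoff is the new relation.\<close>

lemma quotient_graph_generated:
  assumes H: "hereditary G H" "saturated G H" and P0: "\<And>v. v \<in> H \<Longrightarrow> P v = \<zero>"
    and cut: "\<And>v. v \<in> breaking_vertices G H \<Longrightarrow> cutoff v {e \<in> out_arcs G v. head G e \<notin> H} = \<zero>"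
  shows "leavitt_generated A (quotient_graph G H) P S T"
proof -
  have S0: "S e = \<zero>" "T e = \<zero>" if "e \<in> arcs G" "head G e \<in> H" for e
    using that P0[of "head G e"] by (metis S_P P_T S_closed T_closed zero_mult)+
  have tl: "tail G e \<in> verts G - H" if "e \<in> arcs G" "head G e \<notin> H" for e
    using that H(1) unfolding hereditary_def by auto
  let ?D = "\<lambda>v. {e \<in> out_arcs G v. head G e \<notin> H}"
  have sum: "P v = (\<Oplus>e\<in>out_arcs (quotient_graph G H) v. S e \<otimes> T e)"
    if "finite_emitter (quotient_graph G H) v" for v
  proof -
    have v: "v \<in> verts G" "v \<notin> H" "?D v \<noteq> {}" "finite (?D v)"
      using that unfolding finite_emitter_def out_arcs_quotient_graph[OF wf_digraph_axioms] by auto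
    have "P v = (\<Oplus>e\<in>?D v. S e \<otimes> T e)"
    proof (cases "finite (out_arcs G v)")
      case True
      then have "finite_emitter G v" using v unfolding finite_emitter_def by auto
      then have "P v = (\<Oplus>e\<in>out_arcs G v. S e \<otimes> T e)" by (rule P_sum)
      also have "\<dots> = (\<Oplus>e\<in>?D v. S e \<otimes> T e)"
        by (rule add.finprod_mono_neutral_cong_right) (use True S0 in \<open>auto simp: zero_mult\<close>)
      finally show ?thesis .
    next
      case False
      have "?D v = {e \<in> out_arcs G v. head G e \<in> verts G - H}" by auto
      then have "v \<in> breaking_vertices G H" using False v unfolding breaking_vertices_def by auto
      then have "cutoff v (?D v) = \<zero>" by (rule cut)
      moreover have "(\<Oplus>e\<in>?D v. S e \<otimes> T e) \<in> carrier A" by (rule finsum_closed) auto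
      ultimately show ?thesis unfolding cutoff_def using v by (simp add: diff_eq_zero)
    qed
    then show ?thesis unfolding out_arcs_quotient_graph[OF wf_digraph_axioms] .
  qed
  show ?thesis
  proof (intro leavitt_generated.intro leavitt_generated_axioms.intro nonunital_algebra_axioms
      wf_quotient_graph wf_digraph_axioms H(1))
    show "leavitt_family (quotient_graph G H) A P S T"
      unfolding leavitt_family_def using sum
      by (auto simp: P_P P_S S_P P_T T_P T_S)
  next
    fix Q
    assume Q: "Q \<subseteq> carrier A" "P ` verts (quotient_graph G H) \<subseteq> Q" "S ` arcs (quotient_graph G H) \<subseteq> Q"
      "T ` arcs (quotient_graph G H) \<subseteq> Q" "\<zero> \<in> Q" and
      cl: "\<And>x y. x \<in> Q \<Longrightarrow> y \<in> Q \<Longrightarrow> x \<oplus> y \<in> Q"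
      "\<And>x y. x \<in> Q \<Longrightarrow> y \<in> Q \<Longrightarrow> x \<otimes> y \<in> Q" "\<And>c x. x \<in> Q \<Longrightarrow> c \<odot> x \<in> Q"
    have "P v \<in> Q" if "v \<in> verts G" for v
      using that Q(2,5) P0[of v] by (cases "v \<in> H") auto
    moreover have "S e \<in> Q" "T e \<in> Q" if "e \<in> arcs G" for e
      using that Q(3-5) S0[of e] by (cases "head G e \<in> H", auto)+
    ultimately show "carrier A \<subseteq> Q" using Q(1,5) cl by (intro generated) auto
  qed
qed

end

section \<open>Branching systems\<close>

definition operator_algebra :: "('k::field, ('x \<Rightarrow> 'k) \<Rightarrow> 'x \<Rightarrow> 'k) module" where
  "operator_algebra =
     \<lparr>carrier = {T. (\<forall>f g. T (\<lambda>x. f x + g x) = (\<lambda>x. T f x + T g x)) \<and> (\<forall>c f. T (\<lambda>x. c * f x) = (\<lambda>x. c * T f x))},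
      mult = (\<circ>), one = undefined, zero = (\<lambda>f x. 0), add = (\<lambda>T U f x. T f x + U f x),
      smult = (\<lambda>c T f x. c * T f x)\<rparr>"

lemma operator_algebra_carrier:
  "T \<in> carrier operator_algebra \<longleftrightarrow>
    (\<forall>f g. T (\<lambda>x. f x + g x) = (\<lambda>x. T f x + T g x)) \<and> (\<forall>c f. T (\<lambda>x. c * f x) = (\<lambda>x. c * T f x))"
  by (simp add: operator_algebra_def)

lemma operator_algebra_simps:
  "T \<otimes>\<^bsub>operator_algebra\<^esub> U = T \<circ> U" "T \<oplus>\<^bsub>operator_algebra\<^esub> U = (\<lambda>f x. T f x + U f x)"
  "\<zero>\<^bsub>operator_algebra\<^esub> = (\<lambda>f x. 0)" "c \<odot>\<^bsub>operator_algebra\<^esub> T = (\<lambda>f x. c * T f x)"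
  by (simp_all add: operator_algebra_def)

lemma operator_algebra_nonunital_algebra:
  "nonunital_algebra (operator_algebra :: ('k::field, ('x \<Rightarrow> 'k) \<Rightarrow> 'x \<Rightarrow> 'k) module)"
proof -
  let ?O = "operator_algebra :: ('k, ('x \<Rightarrow> 'k) \<Rightarrow> 'x \<Rightarrow> 'k) module"
  have "abelian_group ?O"
  proof (rule abelian_groupI)
    fix T assume T: "T \<in> carrier ?O"
    show "\<exists>U\<in>carrier ?O. U \<oplus>\<^bsub>?O\<^esub> T = \<zero>\<^bsub>?O\<^esub>"
      by (rule bexI[of _ "\<lambda>f x. - T f x"])
        (use T in \<open>auto simp: operator_algebra_carrier operator_algebra_simps fun_eq_iff\<close>)
  qed (auto simp: operator_algebra_carrier operator_algebra_simps fun_eq_iff algebra_simps)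
  then have "rng ?O"
    by (intro rng.intro rng_axioms.intro)
      (simp_all add: operator_algebra_carrier operator_algebra_simps o_def)
  then show ?thesis
    by (intro nonunital_algebra.intro nonunital_algebra_axioms.intro)
      (simp_all add: operator_algebra_carrier operator_algebra_simps fun_eq_iff algebra_simps)
qed

lemma operator_algebra_finsum:
  assumes "\<And>i. i \<in> F \<Longrightarrow> T i \<in> carrier (operator_algebra :: ('k::field, ('x \<Rightarrow> 'k) \<Rightarrow> 'x \<Rightarrow> 'k) module)"
  shows "(\<Oplus>\<^bsub>operator_algebra\<^esub>i\<in>F. T i) = (\<lambda>f x. \<Sum>i\<in>F. T i f x)"
proof -
  interpret nonunital_algebra "operator_algebra :: ('k, ('x \<Rightarrow> 'k) \<Rightarrow> 'x \<Rightarrow> 'k) module"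
    by (rule operator_algebra_nonunital_algebra)
  show ?thesis using assms
  proof (induction F rule: infinite_finite_induct)
    case (insert i F)
    then have "(\<Oplus>\<^bsub>operator_algebra\<^esub>i\<in>insert i F. T i) = T i \<oplus>\<^bsub>operator_algebra\<^esub> (\<Oplus>\<^bsub>operator_algebra\<^esub>i\<in>F. T i)"
      by (intro finsum_insert) auto
    then show ?case using insert by (simp add: operator_algebra_simps)
  qed (simp_all add: operator_algebra_simps)
qed

text \<open>The points \<open>(v, n)\<close> with \<open>v \<notin> Y\<close> form a branching system: \<open>branch v\<close> is a bijection of \<open>\<nat>\<close> onto
  \<open>emitted v \<times> \<nat>\<close>, and \<open>S\<^sub>e\<close> moves the fibre over \<open>r(e)\<close> onto the part of the fibre over \<open>s(e)\<close> that
  is labelled by \<open>e\<close>.\<close>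

locale branching = wf_digraph E for E :: "('v, 'e) pre_digraph" +
  fixes Y :: "'v set"
  assumes hereditary: "hereditary E Y" and saturated: "saturated E Y" and countable: "countable (arcs E)"
begin

definition emitted :: "'v \<Rightarrow> 'e set" where
  "emitted v = {e \<in> out_arcs E v. head E e \<notin> Y}"

definition branch :: "'v \<Rightarrow> nat \<Rightarrow> 'e \<times> nat" where
  "branch v = from_nat_into (emitted v \<times> UNIV)"

definition glue :: "'e \<Rightarrow> nat \<Rightarrow> nat" where
  "glue e n = inv_into UNIV (branch (tail E e)) (e, n)"

definition vop :: "'v \<Rightarrow> ('v \<times> nat \<Rightarrow> 'k) \<Rightarrow> 'v \<times> nat \<Rightarrow> 'k::field" where
  "vop u f = (\<lambda>(v, m). if v = u \<and> u \<notin> Y then f (v, m) else 0)"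

text \<open>The operators pull functions back along partial bijections of the points:
  \<open>eop e\<close> copies the fibre over the range of \<open>e\<close> into the block labelled
  \<open>e\<close>, and \<open>gop e\<close> reads that block back. The test for
  \<open>emitted v\<close> guards against the arbitrary value of \<open>branch v\<close> when
  \<open>v\<close> emits no such edge.\<close>

definition eop :: "'e \<Rightarrow> ('v \<times> nat \<Rightarrow> 'k) \<Rightarrow> 'v \<times> nat \<Rightarrow> 'k::field" where
  "eop e f = (\<lambda>(v, m). if e \<in> emitted v \<and> fst (branch v m) = e then f (head E e, snd (branch v m)) else 0)"

definition gop :: "'e \<Rightarrow> ('v \<times> nat \<Rightarrow> 'k) \<Rightarrow> 'v \<times> nat \<Rightarrow> 'k::field" where
  "gop e f = (\<lambda>(w, n). if w = head E e \<and> head E e \<notin> Y then f (tail E e, glue e n) else 0)"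

text \<open>Countability of the edges enters here. The second factor makes the product infinite even
  when \<open>emitted v\<close> is finite.\<close>

lemma bij_branch:
  assumes "emitted v \<noteq> {}" shows "bij_betw (branch v) UNIV (emitted v \<times> UNIV)"
proof -
  have "countable (emitted v)"
    by (rule countable_subset[OF _ countable]) (auto simp: emitted_def)
  then show ?thesis
    unfolding branch_def using assms
    by (intro bij_betw_from_nat_into countable_SIGMA) (auto simp: finite_cartesian_product_iff)
qed

lemma branch_glue: "e \<in> arcs E \<Longrightarrow> head E e \<notin> Y \<Longrightarrow> branch (tail E e) (glue e n) = (e, n)"
  using bij_branch[of "tail E e"] unfolding glue_def
  by (intro f_inv_into_f) (auto simp: bij_betw_def emitted_def)

lemma glue_branch:
  assumes "e \<in> emitted v" "fst (branch v m) = e" shows "glue e (snd (branch v m)) = m"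
proof -
  have "inj (branch v)" using bij_branch[of v] assms by (auto simp: bij_betw_def)
  moreover have "(e, snd (branch v m)) = branch v m" using assms by auto
  ultimately show ?thesis using assms by (simp add: glue_def emitted_def)
qed

lemma branch_emitted: "emitted v \<noteq> {} \<Longrightarrow> fst (branch v m) \<in> emitted v"
  using bij_betwE[OF bij_branch[of v]] by (metis UNIV_I mem_Times_iff)

lemma emitted_not_in_Y: "e \<in> emitted v \<Longrightarrow> v \<notin> Y"
  using hereditary unfolding hereditary_def emitted_def by auto

lemma ops_carrier:
  "vop v \<in> carrier operator_algebra" "eop e \<in> carrier operator_algebra" "gop e \<in> carrier operator_algebra"
  unfolding operator_algebra_carrier vop_def eop_def gop_def by (auto simp: fun_eq_iff)

lemma eop_gop:
  "eop e (gop e f) (v, m) = (if e \<in> emitted v \<and> fst (branch v m) = e then f (v, m) else 0)"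
  using glue_branch[of e v m] by (auto simp: eop_def gop_def emitted_def)

text \<open>The blocks labelled by emitted edges partition the fibre over \<open>v\<close>, and
  edges of \<open>D\<close> into \<open>Y\<close> contribute \<open>\<zero>\<close>. The freedom in
  \<open>D\<close> covers both the sum relation at finite emitters and the sums in the breaking
  elements.\<close>

lemma vop_eq_sum:
  assumes D: "finite D" "emitted v \<subseteq> D" "D \<subseteq> out_arcs E v" and v: "v \<in> Y \<or> emitted v \<noteq> {}"
  shows "vop v = (\<Oplus>\<^bsub>operator_algebra\<^esub>e\<in>D. eop e \<otimes>\<^bsub>operator_algebra\<^esub> (gop e :: ('v \<times> nat \<Rightarrow> 'k::field) \<Rightarrow> _))"
proof -
  interpret O: nonunital_algebra "operator_algebra :: ('k, ('v \<times> nat \<Rightarrow> 'k) \<Rightarrow> 'v \<times> nat \<Rightarrow> 'k) module"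
    by (rule operator_algebra_nonunital_algebra)
  have "vop v f (w, m) = (\<Sum>e\<in>D. eop e (gop e f) (w, m))" for f :: "'v \<times> nat \<Rightarrow> 'k" and w m
  proof (cases "w = v \<and> v \<notin> Y")
    case True
    then have b: "fst (branch v m) \<in> emitted v" using v branch_emitted by blast
    have "(\<Sum>e\<in>D. eop e (gop e f) (w, m)) = (\<Sum>e\<in>D. if e = fst (branch v m) then f (w, m) else 0)"
      using True b by (intro sum.cong refl) (auto simp: eop_gop)
    also have "\<dots> = f (w, m)" using D b by auto
    finally show ?thesis using True by (simp add: vop_def)
  next
    case False
    have "e \<notin> emitted w" if "e \<in> D" for e
    proof
      assume e: "e \<in> emitted w"
      then have "w = v" using that D(3) unfolding emitted_def by auto
      then show False using False emitted_not_in_Y[OF e] by simp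
    qed
    then have "(\<Sum>e\<in>D. eop e (gop e f) (w, m)) = 0" by (intro sum.neutral) (auto simp: eop_gop)
    then show ?thesis using False by (auto simp: vop_def)
  qed
  then have "vop v = (\<lambda>f x. \<Sum>e\<in>D. (eop e \<otimes>\<^bsub>operator_algebra\<^esub> (gop e :: ('v \<times> nat \<Rightarrow> 'k) \<Rightarrow> _)) f x)"
    by (simp add: operator_algebra_simps fun_eq_iff)
  then show ?thesis
    by (subst operator_algebra_finsum) (auto intro!: O.m_closed ops_carrier)
qed

lemma branching_family: "leavitt_family E (operator_algebra :: ('k::field, _) module) vop eop gop"
proof -
  have tl: "tail E e \<notin> Y" if "e \<in> arcs E" "head E e \<notin> Y" for e
    using that emitted_not_in_Y[of e "tail E e"] by (simp add: emitted_def)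
  \<comment> \<open>Saturation of \<open>Y\<close> is used here: a finite emitter outside
    \<open>Y\<close> must have an edge that ends outside \<open>Y\<close>.\<close>
  have fe: "v \<in> Y \<or> emitted v \<noteq> {}" "emitted v \<subseteq> out_arcs E v" "finite (out_arcs E v)" if "finite_emitter E v" for v
    using saturated that unfolding saturated_def finite_emitter_def emitted_def by auto
  show ?thesis
    unfolding leavitt_family_def
  proof (intro conjI ballI allI impI)
    show "gop e \<otimes>\<^bsub>operator_algebra\<^esub> eop f = (if e = f then vop (head E e) else \<zero>\<^bsub>operator_algebra :: ('k, _) module\<^esub>)"
      if "e \<in> arcs E" "f \<in> arcs E" for e f
      using that branch_glue[OF that(1)] by (auto simp: operator_algebra_simps fun_eq_iff gop_def eop_def vop_def emitted_def)
    show "vop v = (\<Oplus>\<^bsub>operator_algebra\<^esub>e\<in>out_arcs E v. eop e \<otimes>\<^bsub>operator_algebra\<^esub> (gop e :: ('v \<times> nat \<Rightarrow> 'k) \<Rightarrow> _))"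
      if "finite_emitter E v" for v
      by (rule vop_eq_sum) (use fe[OF that] in auto)
  qed (auto simp: ops_carrier operator_algebra_simps fun_eq_iff gop_def eop_def vop_def
      emitted_def tl dest: tl)
qed

lemma vop_zero_iff: "vop v = (\<lambda>f x. 0 :: 'k::field) \<longleftrightarrow> v \<in> Y"
proof
  assume "vop v = (\<lambda>f x. 0 :: 'k)"
  then have "vop v (\<lambda>_. 1) (v, 0) = (0 :: 'k)" by simp
  then show "v \<in> Y" by (auto simp: vop_def split: if_splits)
qed (auto simp: vop_def fun_eq_iff)

end

text \<open>The ideal is the kernel of the representation given by the branching system.\<close>

lemma exists_separating_ideal:
  fixes E :: "('v, 'e) pre_digraph"
  assumes wf: "wf_digraph E" and c: "countable (arcs E)" and Y: "hereditary E Y" "saturated E Y"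
  obtains M where "two_sided_ideal M (leavitt_path_algebra E :: ('k::field, ('k, 'v, 'e) lpa_free set) module)"
    "\<And>v. v \<in> verts E \<Longrightarrow> lpa_vertex E v \<in> M \<longleftrightarrow> v \<in> Y"
    "\<And>v H. v \<in> breaking_vertices E H \<Longrightarrow> H \<subseteq> Y \<Longrightarrow> v \<in> Y \<or> (\<exists>e\<in>out_arcs E v. head E e \<notin> Y) \<Longrightarrow>
      breaking_element E H v \<in> M"
proof -
  interpret b: branching E Y using wf c Y by (intro branching.intro branching_axioms.intro)
  let ?O = "operator_algebra :: ('k, ('v \<times> nat \<Rightarrow> 'k) \<Rightarrow> 'v \<times> nat \<Rightarrow> 'k) module"
  let ?L = "leavitt_path_algebra E :: ('k, ('k, 'v, 'e) lpa_free set) module"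
  interpret L: leavitt_generated ?L E "lpa_vertex E" "lpa_edge E" "lpa_ghost E"
    by (rule leavitt_path_algebra_generated[OF wf])
  obtain h where h: "algebra_hom ?L ?O h" "\<And>v. v \<in> verts E \<Longrightarrow> h (lpa_vertex E v) = b.vop v"
    "\<And>e. e \<in> arcs E \<Longrightarrow> h (lpa_edge E e) = b.eop e \<and> h (lpa_ghost E e) = b.gop e"
    using lpa_universal[OF wf operator_algebra_nonunital_algebra b.branching_family] by blast
  interpret h: alg_hom ?L ?O h
    by (intro alg_hom.intro alg_hom_axioms.intro L.nonunital_algebra_axioms operator_algebra_nonunital_algebra h(1))
  have zero: "two_sided_ideal {\<zero>\<^bsub>?O\<^esub>} ?O"
    by (rule h.B.two_sided_idealI) (auto simp: h.B.zero_mult)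
  let ?M = "{x \<in> carrier ?L. h x \<in> {\<zero>\<^bsub>?O\<^esub>}}"
  show ?thesis
  proof (rule that)
    show "two_sided_ideal ?M ?L" by (rule h.preimage_ideal[OF zero])
    show "lpa_vertex E v \<in> ?M \<longleftrightarrow> v \<in> Y" if "v \<in> verts E" for v
      using that h(2)[OF that] b.vop_zero_iff[of v, where 'k = 'k] by (simp add: operator_algebra_simps)
    show "breaking_element E H v \<in> ?M"
      if v: "v \<in> breaking_vertices E H" and H: "H \<subseteq> Y" and Yv: "v \<in> Y \<or> (\<exists>e\<in>out_arcs E v. head E e \<notin> Y)" for v H
    proof -
      let ?D = "{e \<in> out_arcs E v. head E e \<notin> H}"
      have vE: "v \<in> verts E" and "finite {e \<in> out_arcs E v. head E e \<in> verts E - H}"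
        using v unfolding breaking_vertices_def by auto
      moreover have "{e \<in> out_arcs E v. head E e \<in> verts E - H} = ?D" by auto
      ultimately have D: "finite ?D" by simp
      have "b.emitted v \<subseteq> ?D" "v \<in> Y \<or> b.emitted v \<noteq> {}"
        using H Yv unfolding b.emitted_def by auto
      then have sum: "b.vop v = (\<Oplus>\<^bsub>?O\<^esub>e\<in>?D. b.eop e \<otimes>\<^bsub>?O\<^esub> b.gop e)" by (intro b.vop_eq_sum[OF D]) auto
      have "h (\<Oplus>\<^bsub>?L\<^esub>e\<in>?D. lpa_edge E e \<otimes>\<^bsub>?L\<^esub> lpa_ghost E e) = (\<Oplus>\<^bsub>?O\<^esub>e\<in>?D. h (lpa_edge E e \<otimes>\<^bsub>?L\<^esub> lpa_ghost E e))"
        by (rule h.h_finsum) auto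
      also have "\<dots> = (\<Oplus>\<^bsub>?O\<^esub>e\<in>?D. b.eop e \<otimes>\<^bsub>?O\<^esub> b.gop e)"
        by (rule h.B.finsum_cong') (auto simp: h.h_mult h(3) intro!: h.B.m_closed b.ops_carrier)
      finally have "h (\<Oplus>\<^bsub>?L\<^esub>e\<in>?D. lpa_edge E e \<otimes>\<^bsub>?L\<^esub> lpa_ghost E e) = b.vop v" by (simp add: sum)
      moreover have sc: "(\<Oplus>\<^bsub>?L\<^esub>e\<in>?D. lpa_edge E e \<otimes>\<^bsub>?L\<^esub> lpa_ghost E e) \<in> carrier ?L"
        by (rule L.finsum_closed) auto
      moreover have vc: "b.vop v \<in> carrier ?O" by (rule b.ops_carrier)
      ultimately have "h (breaking_element E H v) = \<zero>\<^bsub>?O\<^esub>"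
        unfolding breaking_element_def using vE vc
        by (simp add: h.h_diff h(2)) (simp add: a_minus_def h.B.r_neg)
      moreover have "breaking_element E H v \<in> carrier ?L"
        unfolding breaking_element_def using vE sc by simp
      ultimately show ?thesis by simp
    qed
  qed
qed

section \<open>The quotient by a two-sided ideal\<close>

text \<open>A breaking vertex is a finite emitter of the quotient graph. If all its edges ended in
  \<open>X \<union> H\<close>, saturation of \<open>X\<close> would put it into \<open>X\<close>.
  The last clause is what places the breaking elements of \<open>H\<close> in the separating ideal
  of \<open>X \<union> H\<close>.\<close>

lemma lift_quotient_graph_set:
  assumes wf: "wf_digraph E" and H: "hereditary E H" "saturated E H"
    and X: "hereditary (quotient_graph E H) X" "saturated (quotient_graph E H) X"
  shows "hereditary E (X \<union> H)" "saturated E (X \<union> H)"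
    "v \<in> breaking_vertices E H \<Longrightarrow> v \<in> X \<union> H \<or> (\<exists>e\<in>out_arcs E v. head E e \<notin> X \<union> H)"
proof -
  have X1: "X \<subseteq> verts E - H" and X2: "\<And>e. e \<in> arcs E \<Longrightarrow> head E e \<notin> H \<Longrightarrow> tail E e \<in> X \<Longrightarrow> head E e \<in> X"
    using X(1) wf unfolding hereditary_def wf_digraph_def by auto
  have H1: "H \<subseteq> verts E" and H2: "\<And>e. e \<in> arcs E \<Longrightarrow> tail E e \<in> H \<Longrightarrow> head E e \<in> H"
    using H(1) unfolding hereditary_def by auto
  show "hereditary E (X \<union> H)" unfolding hereditary_def using X1 X2 H1 H2 by blast
  have sat: "v \<in> X"
    if "v \<in> verts E - H" "{e \<in> out_arcs E v. head E e \<notin> H} \<noteq> {}" "finite {e \<in> out_arcs E v. head E e \<notin> H}"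
      "\<And>e. e \<in> out_arcs E v \<Longrightarrow> head E e \<in> X \<union> H" for v
  proof -
    have "finite_emitter (quotient_graph E H) v"
      unfolding finite_emitter_def out_arcs_quotient_graph[OF wf] using that by simp
    moreover have "head (quotient_graph E H) ` out_arcs (quotient_graph E H) v \<subseteq> X"
      unfolding out_arcs_quotient_graph[OF wf] using that(4) by auto
    ultimately show ?thesis using X(2) unfolding saturated_def by blast
  qed
  have "v \<in> X \<union> H" if v: "finite_emitter E v" "head E ` out_arcs E v \<subseteq> X \<union> H" for v
  proof (cases "v \<in> H \<or> head E ` out_arcs E v \<subseteq> H")
    case True
    then show ?thesis using H(2) v(1) unfolding saturated_def by blast
  next
    case False
    have "v \<in> X"
    proof (rule sat)
      show "v \<in> verts E - H" using False v(1) unfolding finite_emitter_def by blast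
      show "{e \<in> out_arcs E v. head E e \<notin> H} \<noteq> {}" using False by blast
      show "finite {e \<in> out_arcs E v. head E e \<notin> H}" using v(1) unfolding finite_emitter_def by (simp del: in_out_arcs_conv)
      show "head E e \<in> X \<union> H" if "e \<in> out_arcs E v" for e using that v(2) by blast
    qed
    then show ?thesis by simp
  qed
  then show "saturated E (X \<union> H)" unfolding saturated_def using X1 H1 by blast
  show "v \<in> X \<union> H \<or> (\<exists>e\<in>out_arcs E v. head E e \<notin> X \<union> H)" if v: "v \<in> breaking_vertices E H"
  proof (rule ccontr)
    assume n: "\<not> ?thesis"
    have eq: "{e \<in> out_arcs E v. head E e \<in> verts E - H} = {e \<in> out_arcs E v. head E e \<notin> H}"
      using wf by (auto simp: wf_digraph_def)
    have "v \<in> X"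
      by (rule sat) (use v n in \<open>auto simp only: breaking_vertices_def eq mem_Collect_eq\<close>)
    then show False using n by blast
  qed
qed

lemma breaking_arcs:
  assumes wf: "wf_digraph E" and v: "v \<in> breaking_vertices E H"
  shows "v \<in> verts E" "finite {e \<in> out_arcs E v. head E e \<notin> H}" "{e \<in> out_arcs E v. head E e \<notin> H} \<subseteq> out_arcs E v"
proof -
  have "{e \<in> out_arcs E v. head E e \<in> verts E - H} = {e \<in> out_arcs E v. head E e \<notin> H}"
    using wf by (auto simp: wf_digraph_def)
  then show "v \<in> verts E" "finite {e \<in> out_arcs E v. head E e \<notin> H}" "{e \<in> out_arcs E v. head E e \<notin> H} \<subseteq> out_arcs E v"
    using v unfolding breaking_vertices_def by auto
qed

lemma breaking_element_closed:
  assumes wf: "wf_digraph E" and v: "v \<in> breaking_vertices E H"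
  shows "breaking_element E H v \<in> carrier (leavitt_path_algebra E :: ('k::field, ('k, 'v, 'e) lpa_free set) module)"
proof -
  interpret L: leavitt_generated "leavitt_path_algebra E :: ('k, ('k, 'v, 'e) lpa_free set) module" E
    "lpa_vertex E" "lpa_edge E" "lpa_ghost E"
    by (rule leavitt_path_algebra_generated[OF wf])
  show ?thesis
    using L.cutoff_props[OF breaking_arcs(2,3,1)[OF wf v]] unfolding breaking_element_def L.cutoff_def by blast
qed

lemma breaking_ideal_props:
  assumes wf: "wf_digraph E" and H: "H \<subseteq> verts E"
  shows "two_sided_ideal (breaking_ideal E H) (leavitt_path_algebra E :: ('k::field, ('k, 'v, 'e) lpa_free set) module)"
    "lpa_vertex E ` H \<union> breaking_element E H ` breaking_vertices E H \<subseteq> (breaking_ideal E H :: ('k, 'v, 'e) lpa_free set set)"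
proof -
  interpret L: leavitt_generated "leavitt_path_algebra E :: ('k, ('k, 'v, 'e) lpa_free set) module" E
    "lpa_vertex E" "lpa_edge E" "lpa_ghost E"
    by (rule leavitt_path_algebra_generated[OF wf])
  have "lpa_vertex E ` H \<union> breaking_element E H ` breaking_vertices E H \<subseteq>
    carrier (leavitt_path_algebra E :: ('k, ('k, 'v, 'e) lpa_free set) module)"
    using H breaking_element_closed[OF wf] by auto
  from L.ideal_generated_ideal[OF this]
  show "two_sided_ideal (breaking_ideal E H) (leavitt_path_algebra E :: ('k, ('k, 'v, 'e) lpa_free set) module)"
    "lpa_vertex E ` H \<union> breaking_element E H ` breaking_vertices E H \<subseteq> (breaking_ideal E H :: ('k, 'v, 'e) lpa_free set set)"
    unfolding breaking_ideal_def by blast+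
qed

locale leavitt_quotient =
  fixes E :: "('v, 'e) pre_digraph" and I :: "('k::field, 'v, 'e) lpa_free set set"
  assumes wf: "wf_digraph E" and count: "countable (arcs E)"
    and ideal: "two_sided_ideal I (leavitt_path_algebra E)"
begin

abbreviation "L \<equiv> leavitt_path_algebra E :: ('k, ('k, 'v, 'e) lpa_free set) module"
abbreviation "R \<equiv> quotient_algebra L I"
abbreviation "\<pi> x \<equiv> I +>\<^bsub>L\<^esub> x"

sublocale L: leavitt_generated L E "lpa_vertex E" "lpa_edge E" "lpa_ghost E"
  by (rule leavitt_path_algebra_generated[OF wf])

sublocale quot: alg_quot L I
  by (intro alg_quot.intro alg_quot_axioms.intro L.nonunital_algebra_axioms L.two_sided_ideal_is_algebra_ideal ideal)

sublocale hom: alg_hom L R "\<lambda>x. \<pi> x"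
  by (rule quot.quotient_hom)

sublocale R: leavitt_generated R E "\<lambda>v. \<pi> (lpa_vertex E v)" "\<lambda>e. \<pi> (lpa_edge E e)" "\<lambda>e. \<pi> (lpa_ghost E e)"
  by (rule hom.leavitt_generated_image[OF L.leavitt_generated_axioms quot.quotient_hom(2)])

lemma zero_iff: "x \<in> carrier L \<Longrightarrow> \<pi> x = \<zero>\<^bsub>R\<^esub> \<longleftrightarrow> x \<in> I"
  by (rule quot.quotient_hom(3))

lemma image_breaking_element:
  assumes "v \<in> breaking_vertices E H"
  shows "\<pi> (breaking_element E H v) = R.cutoff v {e \<in> out_arcs E v. head E e \<notin> H}"
proof -
  let ?D = "{e \<in> out_arcs E v. head E e \<notin> H}"
  have "(\<Oplus>\<^bsub>L\<^esub>e\<in>?D. lpa_edge E e \<otimes>\<^bsub>L\<^esub> lpa_ghost E e) \<in> carrier L" by (rule L.finsum_closed) auto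
  moreover have "\<pi> (\<Oplus>\<^bsub>L\<^esub>e\<in>?D. lpa_edge E e \<otimes>\<^bsub>L\<^esub> lpa_ghost E e) = (\<Oplus>\<^bsub>R\<^esub>e\<in>?D. \<pi> (lpa_edge E e \<otimes>\<^bsub>L\<^esub> lpa_ghost E e))"
    by (rule hom.h_finsum) auto
  moreover have "\<dots> = (\<Oplus>\<^bsub>R\<^esub>e\<in>?D. \<pi> (lpa_edge E e) \<otimes>\<^bsub>R\<^esub> \<pi> (lpa_ghost E e))"
    by (rule hom.B.finsum_cong') (auto simp: hom.h_mult intro!: hom.B.m_closed)
  ultimately show ?thesis
    unfolding breaking_element_def R.cutoff_def using breaking_arcs(1)[OF wf assms] by (simp add: hom.h_diff)
qed

lemma quotient_graph_family:
  assumes H: "hereditary E H" "saturated E H" and sub: "breaking_ideal E H \<subseteq> I"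
  shows "leavitt_generated R (quotient_graph E H)
    (\<lambda>v. \<pi> (lpa_vertex E v)) (\<lambda>e. \<pi> (lpa_edge E e)) (\<lambda>e. \<pi> (lpa_ghost E e))"
proof (rule R.quotient_graph_generated[OF H])
  have HE: "H \<subseteq> verts E" using H(1) unfolding hereditary_def by blast
  have gens: "lpa_vertex E ` H \<union> breaking_element E H ` breaking_vertices E H \<subseteq> I"
    using sub breaking_ideal_props(2)[OF wf HE, where 'k = 'k] by (rule order_trans[rotated])
  show "\<pi> (lpa_vertex E v) = \<zero>\<^bsub>R\<^esub>" if "v \<in> H" for v
    using that gens HE zero_iff[of "lpa_vertex E v"] L.P_closed[of v] by blast
  show "R.cutoff v {e \<in> out_arcs E v. head E e \<notin> H} = \<zero>\<^bsub>R\<^esub>" if "v \<in> breaking_vertices E H" for v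
    using gens that zero_iff[OF breaking_element_closed[OF wf that]] image_breaking_element[OF that] by auto
qed

end

text \<open>The quotient by \<open>I(H, B\<^sub>H)\<close> satisfies Condition (L), so that a strictly larger ideal would contain
  a vertex outside \<open>H\<close>.\<close>

lemma ideal_eq_breaking_ideal:
  fixes I :: "('k::field, 'v, 'e) lpa_free set set"
  assumes wf: "wf_digraph E" and count: "countable (arcs E)" and I: "two_sided_ideal I (leavitt_path_algebra E)"
    and H: "hereditary E H" "saturated E H" and sub: "breaking_ideal E H \<subseteq> I"
    and L: "condition_L (quotient_graph E H)" and vert: "\<And>v. v \<in> verts E \<Longrightarrow> lpa_vertex E v \<in> I \<Longrightarrow> v \<in> H"
  shows "I = breaking_ideal E H"
proof (rule ccontr)
  assume "I \<noteq> breaking_ideal E H"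
  then obtain x where x: "x \<in> I" "x \<notin> breaking_ideal E H" using sub by blast
  have HE: "H \<subseteq> verts E" using H(1) unfolding hereditary_def by blast
  interpret q: leavitt_quotient E "breaking_ideal E H :: ('k, 'v, 'e) lpa_free set set"
    by (intro leavitt_quotient.intro wf count breaking_ideal_props HE)
  interpret G: leavitt_generated q.R "quotient_graph E H" "\<lambda>v. q.\<pi> (lpa_vertex E v)" "\<lambda>e. q.\<pi> (lpa_edge E e)"
    "\<lambda>e. q.\<pi> (lpa_ghost E e)"
    by (rule q.quotient_graph_family[OF H order_refl])
  have sI: "additive_subgroup I q.L" using I unfolding two_sided_ideal_def by blast
  note subI = q.L.additive_subgroupD[OF sI]
  have xL: "x \<in> carrier q.L" using x subI(1) by blast
  then have nz: "q.\<pi> x \<noteq> \<zero>\<^bsub>q.R\<^esub>" using x q.zero_iff by blast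
  have Pnz: "q.\<pi> (lpa_vertex E v) \<noteq> \<zero>\<^bsub>q.R\<^esub>" if "v \<in> verts (quotient_graph E H)" for v
    using that vert sub q.zero_iff[of "lpa_vertex E v"] by auto
  obtain b d z where bdz: "b \<in> carrier q.R" "d \<in> carrier q.R" "z \<in> verts (quotient_graph E H)"
    "b \<otimes>\<^bsub>q.R\<^esub> q.\<pi> x \<otimes>\<^bsub>q.R\<^esub> d = q.\<pi> (lpa_vertex E z)"
    using G.reduction_to_vertex[OF L Pnz q.hom.h_closed[OF xL] nz] by blast
  have "two_sided_ideal (q.\<pi> ` I) q.R" by (rule q.hom.image_ideal[OF I q.quot.quotient_hom(2)])
  then have "q.\<pi> (lpa_vertex E z) \<in> q.\<pi> ` I"
    unfolding bdz(4)[symmetric] using x(1) bdz(1,2) unfolding two_sided_ideal_def by blast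
  then obtain y where y: "y \<in> I" "q.\<pi> (lpa_vertex E z) = q.\<pi> y" by blast
  have zE: "z \<in> verts E" "z \<notin> H" using bdz(3) by auto
  have yL: "y \<in> carrier q.L" using y subI(1) by blast
  \<comment> \<open>The vertex \<open>z\<close> and the element \<open>y\<close> of \<open>I\<close>
    differ by an element of the breaking ideal, which is contained in \<open>I\<close>; so
    \<open>z\<close> itself lies in \<open>I\<close>.\<close>
  have "q.\<pi> (lpa_vertex E z \<ominus>\<^bsub>q.L\<^esub> y) = \<zero>\<^bsub>q.R\<^esub>"
    using zE yL y(2) by (simp add: q.hom.h_diff q.hom.B.diff_eq_zero)
  then have "lpa_vertex E z \<ominus>\<^bsub>q.L\<^esub> y \<in> I" using q.zero_iff zE yL sub by auto
  then have "lpa_vertex E z \<ominus>\<^bsub>q.L\<^esub> y \<oplus>\<^bsub>q.L\<^esub> y \<in> I" using y subI(3) by blast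
  moreover have "lpa_vertex E z \<ominus>\<^bsub>q.L\<^esub> y \<oplus>\<^bsub>q.L\<^esub> y = lpa_vertex E z"
    using zE yL by (simp add: a_minus_def q.L.a_assoc q.L.l_neg)
  ultimately show False using vert zE by simp
qed

context leavitt_quotient
begin

lemma purely_infinite_simple_imp_graph:
  assumes pis: "purely_infinite_simple R"
  shows "\<exists>H. hereditary E H \<and> saturated E H \<and> I = breaking_ideal E H \<and>
      (\<forall>X. hereditary (quotient_graph E H) X \<and> saturated (quotient_graph E H) X \<longrightarrow>
         X = {} \<or> X = verts (quotient_graph E H)) \<and>
      (\<exists>p. closed_path (quotient_graph E H) p) \<and>
      condition_L (quotient_graph E H)"
proof -
  have pi: "purely_infinite R" and simple: "simple_rng R" using pis unfolding purely_infinite_simple_def by auto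
  have zero: "two_sided_ideal {\<zero>\<^bsub>R\<^esub>} R" by (rule hom.B.two_sided_idealI) (auto simp: hom.B.zero_mult)
  define H where "H = {v \<in> verts E. \<pi> (lpa_vertex E v) \<in> {\<zero>\<^bsub>R\<^esub>}}"
  have H: "hereditary E H" "saturated E H" unfolding H_def by (rule R.ideal_vertices[OF zero])+
  have H_iff: "v \<in> H \<longleftrightarrow> lpa_vertex E v \<in> I" if "v \<in> verts E" for v using that by (simp add: H_def zero_iff)
  have HE: "H \<subseteq> verts E" unfolding H_def by blast
  \<comment> \<open>Modulo \<open>I\<close> the edges into \<open>H\<close> vanish, so the image of
    the breaking element is annihilated by every edge at \<open>v\<close>.\<close>
  have "breaking_element E H v \<in> I" if v: "v \<in> breaking_vertices E H" for v
  proof -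
    have "R.cutoff v {e \<in> out_arcs E v. head E e \<notin> H} = \<zero>\<^bsub>R\<^esub>"
      by (rule R.cutoff_zero[OF simple pi breaking_arcs[OF wf v]]) (auto simp: H_def)
    then show ?thesis using image_breaking_element[OF v] zero_iff[OF breaking_element_closed[OF wf v]] by simp
  qed
  then have sub: "breaking_ideal E H \<subseteq> I"
    unfolding breaking_ideal_def using H_iff HE by (intro ideal_generated_least[OF ideal]) auto
  interpret G: leavitt_generated R "quotient_graph E H" "\<lambda>v. \<pi> (lpa_vertex E v)" "\<lambda>e. \<pi> (lpa_edge E e)"
    "\<lambda>e. \<pi> (lpa_ghost E e)"
    by (rule quotient_graph_family[OF H sub])
  have CL: "condition_L (quotient_graph E H)"
    by (rule G.condition_L_necessary[OF simple pi]) (auto simp: H_def)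
  have closed: "\<exists>p. closed_path (quotient_graph E H) p" by (rule G.closed_path_necessary[OF simple pi])
  have I: "I = breaking_ideal E H"
    by (rule ideal_eq_breaking_ideal[OF wf count ideal H sub CL]) (simp add: H_iff)
  have "X = verts (quotient_graph E H)"
    if X: "hereditary (quotient_graph E H) X" "saturated (quotient_graph E H) X" and ne: "X \<noteq> {}" for X
  proof -
    note Y = lift_quotient_graph_set[OF wf H X]
    have XE: "X \<subseteq> verts E - H" using X(1) unfolding hereditary_def by simp
    \<comment> \<open>\<open>M\<close> contains \<open>I\<close> and also a vertex of
      \<open>X\<close>, which is not in \<open>I\<close>. By simplicity \<open>M\<close> maps onto
      \<open>R\<close>, so every vertex lies in \<open>M\<close> and hence in
      \<open>X \<union> H\<close>.\<close>
    obtain M where M: "two_sided_ideal M L" "\<And>v. v \<in> verts E \<Longrightarrow> lpa_vertex E v \<in> M \<longleftrightarrow> v \<in> X \<union> H"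
      "\<And>v H'. v \<in> breaking_vertices E H' \<Longrightarrow> H' \<subseteq> X \<union> H \<Longrightarrow>
        v \<in> X \<union> H \<or> (\<exists>e\<in>out_arcs E v. head E e \<notin> X \<union> H) \<Longrightarrow> breaking_element E H' v \<in> M"
      using exists_separating_ideal[OF wf count Y(1,2)] by blast
    have IM: "I \<subseteq> M"
      unfolding I breaking_ideal_def using M(2,3) HE Y(3) by (intro ideal_generated_least[OF M(1)]) auto
    have sM: "additive_subgroup M L" using M(1) unfolding two_sided_ideal_def by blast
    note subM = L.additive_subgroupD[OF sM]
    obtain x where x: "x \<in> X" using ne by blast
    then have xE: "x \<in> verts E" "x \<notin> H" using XE by auto
    have "\<pi> (lpa_vertex E x) \<in> \<pi> ` M" "\<pi> (lpa_vertex E x) \<noteq> \<zero>\<^bsub>R\<^esub>"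
      using M(2)[OF xE(1)] x H_iff[OF xE(1)] xE zero_iff[of "lpa_vertex E x"] by auto
    moreover have "two_sided_ideal (\<pi> ` M) R" by (rule hom.image_ideal[OF M(1) quot.quotient_hom(2)])
    ultimately have carr: "\<pi> ` M = carrier R" using simple unfolding simple_rng_def by blast
    have "v \<in> X" if v: "v \<in> verts E - H" for v
    proof -
      have "\<pi> (lpa_vertex E v) \<in> \<pi> ` M" unfolding carr using v by simp
      then obtain y where y: "y \<in> M" "\<pi> (lpa_vertex E v) = \<pi> y" by blast
      have yL: "y \<in> carrier L" using y subM(1) by blast
      have "\<pi> (lpa_vertex E v \<ominus>\<^bsub>L\<^esub> y) = \<zero>\<^bsub>R\<^esub>"
        using v yL y(2) by (simp add: hom.h_diff hom.B.diff_eq_zero)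
      then have "lpa_vertex E v \<ominus>\<^bsub>L\<^esub> y \<in> M" using zero_iff v yL IM by auto
      then have "lpa_vertex E v \<ominus>\<^bsub>L\<^esub> y \<oplus>\<^bsub>L\<^esub> y \<in> M" using y subM(3) by blast
      moreover have "lpa_vertex E v \<ominus>\<^bsub>L\<^esub> y \<oplus>\<^bsub>L\<^esub> y = lpa_vertex E v"
        using v yL by (simp add: a_minus_def L.a_assoc L.l_neg)
      ultimately show ?thesis using M(2)[of v] v by auto
    qed
    then show ?thesis using XE by auto
  qed
  then show ?thesis using H I closed CL by blast
qed

lemma graph_imp_purely_infinite_simple:
  assumes H: "hereditary E H" "saturated E H" and I: "I = breaking_ideal E H"
    and triv: "\<And>X. hereditary (quotient_graph E H) X \<Longrightarrow> saturated (quotient_graph E H) X \<Longrightarrow>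
      X = {} \<or> X = verts (quotient_graph E H)"
    and closed: "closed_path (quotient_graph E H) p" and CL: "condition_L (quotient_graph E H)"
  shows "purely_infinite_simple R"
proof -
  have HE: "H \<subseteq> verts E" using H(1) unfolding hereditary_def by blast
  interpret G: leavitt_generated R "quotient_graph E H" "\<lambda>v. \<pi> (lpa_vertex E v)" "\<lambda>e. \<pi> (lpa_edge E e)"
    "\<lambda>e. \<pi> (lpa_ghost E e)"
    by (rule quotient_graph_family[OF H]) (simp add: I)
  \<comment> \<open>The separating ideal of \<open>H\<close> itself contains \<open>I\<close> and no
    vertex outside \<open>H\<close>, so those vertices survive in \<open>R\<close>. A breaking
    vertex emits an edge ending outside \<open>H\<close> by definition, as the last clause
    demands.\<close>
  obtain M where M: "two_sided_ideal M L" "\<And>v. v \<in> verts E \<Longrightarrow> lpa_vertex E v \<in> M \<longleftrightarrow> v \<in> H"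
    "\<And>v H'. v \<in> breaking_vertices E H' \<Longrightarrow> H' \<subseteq> H \<Longrightarrow>
      v \<in> H \<or> (\<exists>e\<in>out_arcs E v. head E e \<notin> H) \<Longrightarrow> breaking_element E H' v \<in> M"
    using exists_separating_ideal[OF wf count H] by blast
  have "breaking_element E H v \<in> M" if "v \<in> breaking_vertices E H" for v
    using that M(3)[OF that order_refl] unfolding breaking_vertices_def by blast
  then have "I \<subseteq> M"
    unfolding I breaking_ideal_def using M(2) HE by (intro ideal_generated_least[OF M(1)]) auto
  then have nz: "\<pi> (lpa_vertex E v) \<noteq> \<zero>\<^bsub>R\<^esub>" if "v \<in> verts (quotient_graph E H)" for v
    using that M(2)[of v] zero_iff[of "lpa_vertex E v"] by auto
  have "verts (quotient_graph E H) \<noteq> {}" using closed G.awalk_hd_in_verts unfolding closed_path_def by blast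
  then have "simple_rng R" by (intro G.simple_of_graph[OF CL nz triv])
  moreover have "purely_infinite R" by (rule G.purely_infinite_of_graph[OF CL nz triv closed])
  ultimately show ?thesis unfolding purely_infinite_simple_def by blast
qed

end

theorem proposition3p3:
  fixes E :: "('v, 'e) pre_digraph"
    and I :: "('k::field, 'v, 'e) lpa_free set set"
  assumes "wf_digraph E" and "countable (verts E)" and "countable (arcs E)"
    and "two_sided_ideal I (leavitt_path_algebra E)"
  shows "purely_infinite_simple (leavitt_path_algebra E Quot I) \<longleftrightarrow>
    (\<exists>H. hereditary E H \<and> saturated E H \<and> I = breaking_ideal E H \<and>
      (\<forall>X. hereditary (quotient_graph E H) X \<and> saturated (quotient_graph E H) X \<longrightarrow>
         X = {} \<or> X = verts (quotient_graph E H)) \<and>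
      (\<exists>p. closed_path (quotient_graph E H) p) \<and>
      condition_L (quotient_graph E H))"
proof -
  interpret leavitt_quotient E I by (rule leavitt_quotient.intro) (use assms in auto)
  show ?thesis
    unfolding quot.purely_infinite_simple_quotient_algebra[symmetric]
  proof (rule iffI, erule purely_infinite_simple_imp_graph)
    assume "\<exists>H. hereditary E H \<and> saturated E H \<and> I = breaking_ideal E H \<and>
      (\<forall>X. hereditary (quotient_graph E H) X \<and> saturated (quotient_graph E H) X \<longrightarrow>
         X = {} \<or> X = verts (quotient_graph E H)) \<and>
      (\<exists>p. closed_path (quotient_graph E H) p) \<and>
      condition_L (quotient_graph E H)"
    then show "purely_infinite_simple R"
      by (elim exE conjE) (rule graph_imp_purely_infinite_simple; blast)
  qed
qed

end
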